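(* Let $\varphi$ be the random homeomorphism of $[0,1]$ defined in the context. Suppose $f$ is a continuous function on the circle $\mathbb{T}$ satisfying $$|f(\delta)-f(0)| = o\left(\frac{1}{\log\log\log\frac{1}{|\delta|}}\right)\qquad\text{as } \delta\to 0 .$$ Then with probability $1$ the Fourier expansion of $f\circ\varphi$ converges at $0$, i.e. the sequence $S_n(f\circ\varphi;0)$ converges as $n\to\infty$.
   Context: $\mathbb{T}$ is the circle group, identified with the interval $[0,1]$ with endpoints glued; functions on $\mathbb{T}$ are regarded as $1$-periodic functions on $\mathbb{R}$ (so $f(\delta)$ makes sense for negative $\delta$). Random homeomorphism: let $X_{n,k}$ ($n\ge 1$, $0<k<2^n$ odd) be independent random variables uniform on $[0,1]$. Set $\varphi(0)=0$, $\varphi(1)=1$ and, inductively in $n$, for odd $0<k<2^n$, $$\varphi(k2^{-n})=\varphi((k-1)2^{-n})+X_{n,k}\left(\varphi((k+1)2^{-n})-\varphi((k-1)2^{-n})\right).$$ This defines an increasing function on the dyadic rationals, which almost surely extends to a homeomorphism of $[0,1]$, again denoted $\varphi$. Since $\varphi(0)=0$ and $\varphi(1)=1$, $f\circ\varphi$ is again a continuous function on $\mathbb{T}$. Fourier partial sums: $S_n(g;x)=\int_0^1 D_n(x-t)g(t)\,dt$ with $D_n(x)=\frac{\sin((2n+1)\pi x)}{\sin(\pi x)}$. *)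

theory Defs
  imports "HOL-Probability.Probability" "HOL-Library.Landau_Symbols"
begin

definition midpoint_indices :: "(nat \<times> nat) set" where
  "midpoint_indices = {(n, k). 1 \<le> n \<and> 0 < k \<and> k < 2 ^ n \<and> odd k}"

(* phi is a homeomorphism of [0,1] whose values at the dyadic rationals are produced by the
   midpoint recursion with ratios x n k. Only the restriction of phi to {0..1} matters; by
   dyadic_homeo_unique below that restriction is determined by x, so phi is "the" continuous
   extension of the function that the recursion defines on the dyadic rationals. *)
definition dyadic_homeo :: "(nat \<Rightarrow> nat \<Rightarrow> real) \<Rightarrow> (real \<Rightarrow> real) \<Rightarrow> bool" where
  "dyadic_homeo x \<phi> \<longleftrightarrow>
     (\<exists>\<psi>. homeomorphism {0..1} {0..1} \<phi> \<psi>) \<and>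
     \<phi> 0 = 0 \<and> \<phi> 1 = 1 \<and>
     (\<forall>(n, k) \<in> midpoint_indices.
        \<phi> (real k / 2 ^ n) =
          \<phi> ((real k - 1) / 2 ^ n)
          + x n k * (\<phi> ((real k + 1) / 2 ^ n) - \<phi> ((real k - 1) / 2 ^ n)))"

lemma dyadic_homeo_unique:
  assumes "dyadic_homeo x \<phi>" "dyadic_homeo x \<phi>'" "t \<in> {0..1}"
  shows "\<phi> t = \<phi>' t"
proof -
  have dy: "\<phi> (real k / 2 ^ n) = \<phi>' (real k / 2 ^ n)" if "k \<le> 2 ^ n" for n k
    using that
  proof (induction n arbitrary: k)
    case 0
    then have "k = 0 \<or> k = 1" by auto
    with assms(1,2) show ?case by (auto simp: dyadic_homeo_def)
  next
    case (Suc n)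
    have ev: "\<phi> (real (2 * j) / 2 ^ Suc n) = \<phi>' (real (2 * j) / 2 ^ Suc n)"
      if "j \<le> 2 ^ n" for j
      using Suc.IH [OF that] by simp
    show ?case
    proof (cases "even k")
      case True
      then obtain j where "k = 2 * j" by blast
      with ev [of j] Suc.prems show ?thesis by (simp only: power_Suc mult_le_cancel1)
    next
      case False
      then obtain j where k: "k = 2 * j + 1" using oddE by blast
      with Suc.prems have j: "j < 2 ^ n" by simp
      with k have mem: "(Suc n, k) \<in> midpoint_indices"
        by (simp add: midpoint_indices_def)
      have "real k - 1 = real (2 * j)" using k by simp
      then have l: "\<phi> ((real k - 1) / 2 ^ Suc n) = \<phi>' ((real k - 1) / 2 ^ Suc n)"
        using ev [of j] j by (simp only: less_imp_le)
      have "real k + 1 = real (2 * (j + 1))" using k by simp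
      then have r: "\<phi> ((real k + 1) / 2 ^ Suc n) = \<phi>' ((real k + 1) / 2 ^ Suc n)"
        using ev [of "j + 1"] j by (simp only:)
      from assms(1) mem have "\<phi> (real k / 2 ^ Suc n) = \<phi> ((real k - 1) / 2 ^ Suc n)
          + x (Suc n) k * (\<phi> ((real k + 1) / 2 ^ Suc n) - \<phi> ((real k - 1) / 2 ^ Suc n))"
        unfolding dyadic_homeo_def by blast
      moreover from assms(2) mem have "\<phi>' (real k / 2 ^ Suc n) = \<phi>' ((real k - 1) / 2 ^ Suc n)
          + x (Suc n) k * (\<phi>' ((real k + 1) / 2 ^ Suc n) - \<phi>' ((real k - 1) / 2 ^ Suc n))"
        unfolding dyadic_homeo_def by blast
      ultimately show ?thesis unfolding l r by (rule trans [OF _ sym])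
    qed
  qed
  let ?D = "{0..1::real} \<inter> (\<Union>k m. {of_nat m / 2 ^ k})"
  have cl: "closure ?D = {0..1}"
    by (subst closure_dyadic_rationals_in_convex_set_pos_1) auto
  have "continuous_on {0..1} \<phi>" "continuous_on {0..1} \<phi>'"
    using assms(1,2) by (auto simp: dyadic_homeo_def homeomorphism_def)
  then have "continuous_on (closure ?D) (\<lambda>s. \<phi> s - \<phi>' s)"
    unfolding cl by (rule continuous_on_diff)
  moreover have "\<phi> s - \<phi>' s = 0" if s: "s \<in> ?D" for s
  proof -
    from s obtain k m where s_eq: "s = real m / 2 ^ k" by auto
    with s have "real m \<le> 2 ^ k" by (simp add: divide_le_eq_1)
    then have "m \<le> 2 ^ k" by (metis of_nat_le_iff of_nat_numeral of_nat_power)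
    with dy [of m k] s_eq show ?thesis by simp
  qed
  ultimately have "\<phi> t - \<phi>' t = 0"
    by (rule continuous_constant_on_closure) (simp_all only: cl assms(3))
  then show ?thesis by simp
qed

(* At integers this is 0 by division by zero rather than the limit 2 * n + 1; those points
   form a null set, so the integral below is unaffected. *)
definition dirichlet_kernel :: "nat \<Rightarrow> real \<Rightarrow> real" where
  "dirichlet_kernel n x = sin ((2 * real n + 1) * pi * x) / sin (pi * x)"

definition fourier_partial_sum :: "nat \<Rightarrow> (real \<Rightarrow> complex) \<Rightarrow> real \<Rightarrow> complex" where
  "fourier_partial_sum n g x =
     (LINT t:{0..1}|lborel. complex_of_real (dirichlet_kernel n (x - t)) * g t)"

end

(* The ratios form a tree of independent uniform variables, so that a restriction of the homeomorphism
   phi to a dyadic interval is an affine image of an independent copy of phi. Write S_n - f(0) as the integral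
   of D_n * h(phi) with h = f - f(0), and cut [0,1] into the dyadic blocks at distance about 2^-K from the
   end points. For 2^N <= n < 2^(N+1) and q = (N - K) div 8, divide a block into 2^(4q) cells. Given the
   values of phi at the ends of the cells, the integrals over the cells are independent and of size at most
   2^-4q; their conditional means are at most a constant times 2^-5q, because E h(phi(t)) is nearly constant
   on scale 2^-3q (averaging over one uniform ratio smoothes the arbitrary bounded function h), while D_n
   oscillates on a finer scale. Hoeffding's lemma then bounds the integral over the block by a constant times
   2^-q outside an event of probability 2 exp(-4^q / 2). A net in n and the Borel-Cantelli lemma give this
   bound simultaneously for all n and all blocks with q >= log2 log N, and these contributions sum to o(1).
   The remaining O(log log N) blocks and the two end intervals contribute O(1) times the supremum of h on a
   neighbourhood of 0 of size exp(-sqrt N), which is o(1 / log log N) by hypothesis. *)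
theory Submission
  imports Defs "HOL-Probability.Hoeffding" "HOL-Real_Asymp.Real_Asymp"
begin

section \<open>Trees of independent uniform variables\<close>

text \<open>Away from 0 nothing better than boundedness is available for h, so cancellation can come
  only from the randomness of phi; this is why the estimates on inner blocks are uniform over all
  measurable h with |h| <= 1. The exponents: 2^(4q) independent terms of size 2^(-4q) have a sum of
  standard deviation 2^(-2q), so the threshold 2^(-q) lies 2^q deviations out. The means must then
  be about 2^(-5q) per cell. Smoothing supplies the missing factor 2^(-q) once values are resolved
  3q levels below the cell, and on each of these 2^(3q) pieces oscillation must gain 2^(-8q), whence
  8 = 5 + 3 in the choice of q.

  The triple logarithm in the hypothesis is the price of the union bound. There are about N blocks
  with some 2^(9q) net points each, so 4^q has to outgrow log N; the scales with smaller q, about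
  log log N of them where N = log2 n, are left to the continuity of f alone.\<close>

definition unif :: "real measure" where
  "unif = uniform_measure lborel {0..1}"

definition trees :: "(bool list \<Rightarrow> real) measure" where
  "trees = PiM UNIV (\<lambda>_. unif)"

text \<open>A list is the path from the root to a node, \<open>False\<close> standing for the left
  half. Dropping the first entry makes restriction to a half interval the same construction one
  level down.\<close>

definition subtree :: "bool \<Rightarrow> (bool list \<Rightarrow> real) \<Rightarrow> (bool list \<Rightarrow> real)" where
  "subtree b \<xi> = (\<lambda>q. \<xi> (b # q))"

definition node :: "real \<Rightarrow> (bool list \<Rightarrow> real) \<Rightarrow> (bool list \<Rightarrow> real) \<Rightarrow> (bool list \<Rightarrow> real)" where
  "node c x y = (\<lambda>p. case p of [] \<Rightarrow> c | b # q \<Rightarrow> if b then y q else x q)"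

lemma node_simps [simp]:
  "node c x y [] = c" "subtree False (node c x y) = x" "subtree True (node c x y) = y"
  by (auto simp: node_def subtree_def)

lemma prob_space_unif: "prob_space unif"
  unfolding unif_def by (rule prob_space_uniform_measure) auto

interpretation unif: prob_space unif by (rule prob_space_unif)

lemma sets_unif [simp, measurable_cong]: "sets unif = sets borel"
  by (simp add: unif_def)

lemma space_unif [simp]: "space unif = UNIV"
  by (simp add: unif_def)

lemma unif_eq_density: "unif = density lborel (indicator {0..1::real})"
  unfolding unif_def uniform_measure_def by (intro density_cong) (auto simp: divide_ennreal_def)

interpretation tree_prod: product_prob_space "\<lambda>_::bool list. unif" UNIV ..

interpretation trees: prob_space trees
  unfolding trees_def by (rule prob_space_PiM) (rule prob_space_unif)

lemma space_trees [simp]: "space trees = UNIV"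
  by (auto simp: trees_def space_PiM)

lemma sets_trees [measurable_cong]: "sets trees = sets (PiM UNIV (\<lambda>_. borel))"
  unfolding trees_def by (intro sets_PiM_cong) auto

lemma measurable_tree_component [measurable]: "(\<lambda>\<xi>. \<xi> p) \<in> borel_measurable trees"
  unfolding trees_def by measurable

lemma measurable_treesI:
  assumes "\<And>p. (\<lambda>x. f x p) \<in> borel_measurable N"
  shows "f \<in> measurable N trees"
proof -
  have "f \<in> measurable N (PiM UNIV (\<lambda>_. borel))"
    using assms by (intro measurable_PiM_single') (auto simp: space_PiM)
  then show ?thesis
    by (simp add: measurable_def sets_trees space_PiM)
qed

lemma measurable_subtree [measurable]: "subtree b \<in> measurable trees trees"
  by (rule measurable_treesI) (simp add: subtree_def)

lemma measurable_node [measurable (raw)]: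
  assumes [measurable]: "f \<in> borel_measurable N" "g \<in> measurable N trees" "h \<in> measurable N trees"
  shows "(\<lambda>z. node (f z) (g z) (h z)) \<in> measurable N trees"
proof (rule measurable_treesI)
  fix p show "(\<lambda>z. node (f z) (g z) (h z) p) \<in> borel_measurable N"
    by (cases p) (auto simp: node_def)
qed

interpretation tree_pair: pair_prob_space trees trees ..
interpretation tree_triple: pair_prob_space unif "trees \<Otimes>\<^sub>M trees" ..

text \<open>Self-similarity of the random tree. A finite box of coordinates splits into a condition
  on the root and one box for each subtree, so the product formula that characterises the infinite
  product measure can be checked factor by factor.\<close>

lemma distr_node: "distr (unif \<Otimes>\<^sub>M (trees \<Otimes>\<^sub>M trees)) trees (\<lambda>z. node (fst z) (fst (snd z)) (snd (snd z))) = trees"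
  (is "?D = _")
  unfolding trees_def
proof (rule tree_prod.PiM_eq)
  show "sets (distr (unif \<Otimes>\<^sub>M (Pi\<^sub>M UNIV (\<lambda>_. unif) \<Otimes>\<^sub>M Pi\<^sub>M UNIV (\<lambda>_. unif))) (Pi\<^sub>M UNIV (\<lambda>_. unif))
     (\<lambda>z. node (fst z) (fst (snd z)) (snd (snd z)))) = sets (Pi\<^sub>M UNIV (\<lambda>_. unif))" by simp
next
  fix J :: "bool list set" and F :: "bool list \<Rightarrow> real set"
  assume J: "finite J" "J \<subseteq> UNIV" and F: "\<And>j. j \<in> J \<Longrightarrow> F j \<in> sets unif"
  define JF JT where "JF = {q. False # q \<in> J}" and "JT = {q. True # q \<in> J}"
  \<comment> \<open>If the box does not involve the root, the root is unconstrained and has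
    probability 1.\<close>
  define A where "A = (if [] \<in> J then F [] else UNIV)"
  define EF where "EF = {x \<in> space trees. \<forall>q\<in>JF. x q \<in> F (False # q)}"
  define ET where "ET = {x \<in> space trees. \<forall>q\<in>JT. x q \<in> F (True # q)}"
  have fin: "finite JF" "finite JT"
    unfolding JF_def JT_def using J finite_vimageI[of J "Cons False"] finite_vimageI[of J "Cons True"]
    by (auto simp: vimage_def)
  have mA: "A \<in> sets unif" using F by (auto simp: A_def)
  have mA': "A \<in> sets borel" using mA by simp
  have box: "{x \<in> space trees. \<forall>q\<in>K. x q \<in> G q} \<in> sets trees"
    if "finite K" "\<And>q. q \<in> K \<Longrightarrow> G q \<in> sets unif" for K and G :: "bool list \<Rightarrow> real set"
  proof (intro sets.sets_Collect_finite_All)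
    fix q assume "q \<in> K"
    then show "{x \<in> space trees. x q \<in> G q} \<in> sets trees"
      using that(2) measurable_sets[OF measurable_tree_component, of "G q" q] by (auto simp: vimage_def)
  qed (rule that(1))
  have mE: "EF \<in> sets trees" "ET \<in> sets trees"
    unfolding EF_def ET_def using fin F by (intro box; auto simp: JF_def JT_def)+
  have emb: "prod_emb UNIV (\<lambda>_. unif) J (Pi\<^sub>E J F) = {x. \<forall>j\<in>J. x j \<in> F j}"
    by (auto simp: prod_emb_def PiE_iff)
  have eF: "emeasure trees EF = (\<Prod>q\<in>JF. emeasure unif (F (False # q)))"
    unfolding EF_def trees_def using fin F by (intro tree_prod.emeasure_PiM_Collect) (auto simp: JF_def)
  have eT: "emeasure trees ET = (\<Prod>q\<in>JT. emeasure unif (F (True # q)))"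
    unfolding ET_def trees_def using fin F by (intro tree_prod.emeasure_PiM_Collect) (auto simp: JT_def)
  have Jeq: "J = (J \<inter> {[]}) \<union> (Cons False ` JF \<union> Cons True ` JT)"
  proof -
    have "p \<in> (J \<inter> {[]}) \<union> (Cons False ` JF \<union> Cons True ` JT)" if "p \<in> J" for p
      using that by (cases p rule: list.exhaust) (auto simp: JF_def JT_def image_iff, metis (full_types))
    then show ?thesis by (auto simp: JF_def JT_def)
  qed
  have eA: "emeasure unif A = (\<Prod>j\<in>J \<inter> {[]}. emeasure unif (F j))"
    using unif.emeasure_space_1 by (auto simp: A_def)
  have pre: "(\<lambda>z. node (fst z) (fst (snd z)) (snd (snd z))) -` {x. \<forall>j\<in>J. x j \<in> F j} = A \<times> (EF \<times> ET)"
  proof -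
    have "(\<forall>j\<in>J. node c x y j \<in> F j) \<longleftrightarrow> c \<in> A \<and> x \<in> EF \<and> y \<in> ET" for c x y
      by (subst Jeq) (auto simp: A_def EF_def ET_def JF_def JT_def node_def ball_Un)
    then show ?thesis by auto
  qed
  have sf: "sigma_finite_measure (trees \<Otimes>\<^sub>M trees)" by unfold_locales
  have "emeasure (distr (unif \<Otimes>\<^sub>M (trees \<Otimes>\<^sub>M trees)) trees (\<lambda>z. node (fst z) (fst (snd z)) (snd (snd z)))) {x. \<forall>j\<in>J. x j \<in> F j}
    = emeasure (unif \<Otimes>\<^sub>M (trees \<Otimes>\<^sub>M trees)) (A \<times> (EF \<times> ET))"
    using box[of J F] J(1) F by (subst emeasure_distr) (auto simp: pre space_pair_measure simp del: vimage_Collect_eq)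
  also have "\<dots> = emeasure unif A * (emeasure trees EF * emeasure trees ET)"
    using mA' mE by (simp add: sigma_finite_measure.emeasure_pair_measure_Times [OF sf] trees.emeasure_pair_measure_Times)
  also have "\<dots> = (\<Prod>j\<in>(J \<inter> {[]}) \<union> (Cons False ` JF \<union> Cons True ` JT). emeasure unif (F j))"
    unfolding eA eF eT using fin J(1)
    by (subst prod.union_disjoint, simp, simp, force, subst prod.union_disjoint) (auto simp: prod.reindex)
  also have "\<dots> = (\<Prod>j\<in>J. emeasure unif (F j))"
    using Jeq by simp
  finally show "emeasure (distr (unif \<Otimes>\<^sub>M (Pi\<^sub>M UNIV (\<lambda>_. unif) \<Otimes>\<^sub>M Pi\<^sub>M UNIV (\<lambda>_. unif))) (Pi\<^sub>M UNIV (\<lambda>_. unif))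
     (\<lambda>z. node (fst z) (fst (snd z)) (snd (snd z)))) (prod_emb UNIV (\<lambda>_. unif) J (Pi\<^sub>E J F)) = (\<Prod>j\<in>J. emeasure unif (F j))"
    unfolding emb trees_def .
qed

lemma nn_integral_trees:
  assumes [measurable]: "F \<in> borel_measurable trees"
  shows "(\<integral>\<^sup>+\<xi>. F \<xi> \<partial>trees) = (\<integral>\<^sup>+c. \<integral>\<^sup>+x. \<integral>\<^sup>+y. F (node c x y) \<partial>trees \<partial>trees \<partial>unif)"
proof -
  have sf: "sigma_finite_measure (trees \<Otimes>\<^sub>M trees)" by unfold_locales
  have "(\<integral>\<^sup>+\<xi>. F \<xi> \<partial>trees) = (\<integral>\<^sup>+z. F (node (fst z) (fst (snd z)) (snd (snd z))) \<partial>(unif \<Otimes>\<^sub>M (trees \<Otimes>\<^sub>M trees)))"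
    by (subst distr_node [symmetric]) (simp add: nn_integral_distr)
  also have "\<dots> = (\<integral>\<^sup>+c. \<integral>\<^sup>+z. F (node c (fst z) (snd z)) \<partial>(trees \<Otimes>\<^sub>M trees) \<partial>unif)"
    by (subst sigma_finite_measure.nn_integral_fst [OF sf, symmetric]) auto
  also have "\<dots> = (\<integral>\<^sup>+c. \<integral>\<^sup>+x. \<integral>\<^sup>+y. F (node c x y) \<partial>trees \<partial>trees \<partial>unif)"
  proof (intro nn_integral_cong)
    fix c
    show "(\<integral>\<^sup>+z. F (node c (fst z) (snd z)) \<partial>(trees \<Otimes>\<^sub>M trees)) = (\<integral>\<^sup>+x. \<integral>\<^sup>+y. F (node c x y) \<partial>trees \<partial>trees)"
      by (subst trees.nn_integral_fst [symmetric]) auto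
  qed
  finally show ?thesis .
qed

text \<open>In contrast to \<open>nn_integral_trees\<close>, the root is integrated innermost, with
  both subtrees frozen: this is the order in which averaging over one ratio smoothes a bounded
  function.\<close>

lemma integral_trees:
  fixes F :: "(bool list \<Rightarrow> real) \<Rightarrow> real"
  assumes [measurable]: "F \<in> borel_measurable trees" and bd: "\<And>\<xi>. \<bar>F \<xi>\<bar> \<le> B"
  shows "(\<integral>\<xi>. F \<xi> \<partial>trees) = (\<integral>z. \<integral>c. F (node c (fst z) (snd z)) \<partial>unif \<partial>(trees \<Otimes>\<^sub>M trees))"
proof -
  have fin: "finite_measure (unif \<Otimes>\<^sub>M (trees \<Otimes>\<^sub>M trees))" by unfold_locales
  have "(\<integral>\<xi>. F \<xi> \<partial>trees) = (\<integral>z. F (node (fst z) (fst (snd z)) (snd (snd z))) \<partial>(unif \<Otimes>\<^sub>M (trees \<Otimes>\<^sub>M trees)))"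
    by (subst distr_node [symmetric]) (simp add: integral_distr)
  also have "\<dots> = (\<integral>z. \<integral>c. F (node c (fst z) (snd z)) \<partial>unif \<partial>(trees \<Otimes>\<^sub>M trees))"
    using bd by (subst tree_triple.integral_snd [of "\<lambda>c z. F (node c (fst z) (snd z))"])
      (auto simp: case_prod_unfold intro!: finite_measure.integrable_const_bound[OF fin, of _ B])
  finally show ?thesis .
qed


section \<open>The random homeomorphism as a function of a tree\<close>

text \<open>Clipping makes the deterministic estimates hold for every tree; almost surely it changes
  nothing.\<close>

definition root :: "(bool list \<Rightarrow> real) \<Rightarrow> real" where
  "root \<xi> = max 0 (min 1 (\<xi> []))"

text \<open>\<open>lam d \<xi> t\<close> is the value of the homeomorphism at \<^term>\<open>t\<close> rounded down to a multiple of
  \<^term>\<open>(1/2)^d\<close>, \<open>len d \<xi> t\<close> the length of the image of the dyadic interval of level \<^term>\<open>d\<close>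
  around \<^term>\<open>t\<close>, and \<open>sqsum d \<xi>\<close> the sum of the squares of these lengths.\<close>

primrec lam :: "nat \<Rightarrow> (bool list \<Rightarrow> real) \<Rightarrow> real \<Rightarrow> real" where
  "lam 0 \<xi> t = (if t < 1 then 0 else 1)"
| "lam (Suc d) \<xi> t = (if t < 1/2 then root \<xi> * lam d (subtree False \<xi>) (2*t)
     else root \<xi> + (1 - root \<xi>) * lam d (subtree True \<xi>) (2*t - 1))"

primrec len :: "nat \<Rightarrow> (bool list \<Rightarrow> real) \<Rightarrow> real \<Rightarrow> real" where
  "len 0 \<xi> t = 1"
| "len (Suc d) \<xi> t = (if t < 1/2 then root \<xi> * len d (subtree False \<xi>) (2*t)
     else (1 - root \<xi>) * len d (subtree True \<xi>) (2*t - 1))"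

primrec sqsum :: "nat \<Rightarrow> (bool list \<Rightarrow> real) \<Rightarrow> real" where
  "sqsum 0 \<xi> = 1"
| "sqsum (Suc d) \<xi> = (root \<xi>)\<^sup>2 * sqsum d (subtree False \<xi>) + (1 - root \<xi>)\<^sup>2 * sqsum d (subtree True \<xi>)"

text \<open>The truncations increase with \<open>d\<close> and stay in the unit interval, so this
  limit exists for every tree and every real argument; continuity and injectivity come later, almost
  surely.\<close>

definition phi :: "(bool list \<Rightarrow> real) \<Rightarrow> real \<Rightarrow> real" where
  "phi \<xi> t = lim (\<lambda>d. lam d \<xi> t)"

lemma root_bounds [simp]: "0 \<le> root \<xi>" "root \<xi> \<le> 1"
  by (auto simp: root_def)

lemma convex_comb_unit:
  fixes c z :: real
  assumes "0 \<le> c" "c \<le> 1" "0 \<le> z" "z \<le> 1"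
  shows "0 \<le> c * z" "c * z \<le> 1" "c \<le> c + (1 - c) * z" "0 \<le> (1 - c) * z" "c + (1 - c) * z \<le> 1"
proof -
  show "c * z \<le> 1" using assms by (simp add: mult_le_one)
  have "(1 - c) * z \<le> 1 - c" using assms by (simp add: mult_left_le)
  then show "c + (1 - c) * z \<le> 1" by simp
qed (use assms in auto)

lemma lam_bounds: "0 \<le> lam d \<xi> t" "lam d \<xi> t \<le> 1"
proof (induction d arbitrary: \<xi> t)
  case (Suc d)
  { case 1 show ?case using convex_comb_unit[of "root \<xi>" "lam d (subtree False \<xi>) (2*t)"]
      convex_comb_unit[of "root \<xi>" "lam d (subtree True \<xi>) (2*t-1)"] root_bounds[of \<xi>] Suc by auto }
  { case 2 show ?case using convex_comb_unit[of "root \<xi>" "lam d (subtree False \<xi>) (2*t)"]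
      convex_comb_unit[of "root \<xi>" "lam d (subtree True \<xi>) (2*t-1)"] root_bounds[of \<xi>] Suc by auto }
qed auto

lemma lam_eq_1: "t \<ge> 1 \<Longrightarrow> lam d \<xi> t = 1"
  by (induction d arbitrary: \<xi> t) auto

lemma lam_eq_0: "t \<le> 0 \<Longrightarrow> lam d \<xi> t = 0"
  by (induction d arbitrary: \<xi> t) auto

lemma lam_le_Suc: "lam d \<xi> t \<le> lam (Suc d) \<xi> t"
proof (induction d arbitrary: \<xi> t)
  case 0
  show ?case
  proof (cases "t \<ge> 1")
    case True then show ?thesis using lam_eq_1[of t "Suc 0" \<xi>] by simp
  next
    case False then show ?thesis using lam_bounds(1)[of "Suc 0" \<xi> t] by simp
  qed
next
  case (Suc d)
  then show ?case
    by (subst (1 2) lam.simps(2)) (auto intro!: mult_left_mono simp del: lam.simps)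
qed

lemma LIMSEQ_lam: "(\<lambda>d. lam d \<xi> t) \<longlonglongrightarrow> phi \<xi> t"
proof -
  have "convergent (\<lambda>d. lam d \<xi> t)"
    using lam_bounds[of _ \<xi> t]
    by (intro Bseq_monoseq_convergent BseqI'[of _ 1]) (auto simp: monoseq_Suc lam_le_Suc simp del: lam.simps)
  then show ?thesis by (simp add: phi_def convergent_LIMSEQ_iff)
qed

lemma lam_le_phi: "lam d \<xi> t \<le> phi \<xi> t"
  by (rule incseq_le[OF _ LIMSEQ_lam]) (simp add: incseq_Suc_iff lam_le_Suc del: lam.simps)

lemma phi_bounds: "0 \<le> phi \<xi> t" "phi \<xi> t \<le> 1"
  using LIMSEQ_le_const[OF LIMSEQ_lam] LIMSEQ_le_const2[OF LIMSEQ_lam] lam_bounds by blast+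

lemma phi_eq_1: "t \<ge> 1 \<Longrightarrow> phi \<xi> t = 1"
  using LIMSEQ_lam[of \<xi> t] by (simp add: lam_eq_1 LIMSEQ_const_iff)

lemma phi_eq_0: "t \<le> 0 \<Longrightarrow> phi \<xi> t = 0"
  using LIMSEQ_lam[of \<xi> t] by (simp add: lam_eq_0 LIMSEQ_const_iff)

lemma phi_less_half:
  assumes "t < 1/2" shows "phi \<xi> t = root \<xi> * phi (subtree False \<xi>) (2*t)"
proof -
  have "(\<lambda>d. lam (Suc d) \<xi> t) \<longlonglongrightarrow> root \<xi> * phi (subtree False \<xi>) (2*t)"
    using assms by (auto intro!: tendsto_intros LIMSEQ_lam)
  moreover have "(\<lambda>d. lam (Suc d) \<xi> t) \<longlonglongrightarrow> phi \<xi> t" by (rule LIMSEQ_Suc[OF LIMSEQ_lam])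
  ultimately show ?thesis using LIMSEQ_unique by blast
qed

lemma phi_ge_half:
  assumes "t \<ge> 1/2" shows "phi \<xi> t = root \<xi> + (1 - root \<xi>) * phi (subtree True \<xi>) (2*t-1)"
proof -
  have "(\<lambda>d. lam (Suc d) \<xi> t) \<longlonglongrightarrow> root \<xi> + (1 - root \<xi>) * phi (subtree True \<xi>) (2*t-1)"
    using assms by (auto intro!: tendsto_intros LIMSEQ_lam)
  moreover have "(\<lambda>d. lam (Suc d) \<xi> t) \<longlonglongrightarrow> phi \<xi> t" by (rule LIMSEQ_Suc[OF LIMSEQ_lam])
  ultimately show ?thesis using LIMSEQ_unique by blast
qed

text \<open>Both branches of the recursion give the root value at the midpoint, so the left one also
  holds on the closed half.\<close>

lemma phi_le_half:
  assumes "t \<le> 1/2" shows "phi \<xi> t = root \<xi> * phi (subtree False \<xi>) (2*t)"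
proof (cases "t = 1/2")
  case True then show ?thesis using phi_ge_half[of t \<xi>] by (simp add: phi_eq_0 phi_eq_1)
qed (use assms phi_less_half in auto)

lemma lam_mono: "s \<le> t \<Longrightarrow> lam d \<xi> s \<le> lam d \<xi> t"
proof (induction d arbitrary: \<xi> s t)
  case (Suc d)
  have "root \<xi> * lam d (subtree False \<xi>) (2 * s) \<le> root \<xi>"
    using lam_bounds by (simp add: mult_left_le)
  moreover have "root \<xi> \<le> root \<xi> + (1 - root \<xi>) * lam d (subtree True \<xi>) (2*t-1)"
    using lam_bounds by (intro convex_comb_unit) auto
  ultimately show ?case using Suc
    by (auto intro!: mult_left_mono)
qed auto

lemma phi_mono: "s \<le> t \<Longrightarrow> phi \<xi> s \<le> phi \<xi> t"
  using LIMSEQ_le[OF LIMSEQ_lam LIMSEQ_lam] lam_mono by blast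

lemma len_bounds: "0 \<le> len d \<xi> t" "len d \<xi> t \<le> 1"
proof (induction d arbitrary: \<xi> t)
  case (Suc d)
  { case 1 show ?case using Suc by auto }
  { case 2 show ?case using Suc by (auto intro!: mult_le_one) }
qed auto

lemma phi_le_lam_len: "phi \<xi> t \<le> lam d \<xi> t + len d \<xi> t"
proof (induction d arbitrary: \<xi> t)
  case 0 then show ?case using phi_bounds[of \<xi> t] by auto
next
  case (Suc d)
  show ?case
  proof (cases "t < 1/2")
    case True
    then show ?thesis
      using mult_left_mono[OF Suc[of "subtree False \<xi>" "2*t"], of "root \<xi>"]
      by (simp add: phi_less_half algebra_simps)
  next
    case False
    then show ?thesis
      using mult_left_mono[OF Suc[of "subtree True \<xi>" "2*t-1"], of "1-root \<xi>"]
      by (simp add: phi_ge_half) (simp add: algebra_simps)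
  qed
qed

section \<open>Joint measurability in the tree and the argument\<close>

lemma measurable_root [measurable]: "root \<in> borel_measurable trees"
  unfolding root_def[abs_def] by measurable

lemma measurable_lam [measurable (raw)]:
  assumes [measurable]: "f \<in> measurable N trees" "g \<in> borel_measurable N"
  shows "(\<lambda>z. lam d (f z) (g z)) \<in> borel_measurable N"
  using assms
proof (induction d arbitrary: f g)
  case 0
  note [measurable] = 0
  show ?case by simp
next
  case (Suc d)
  note [measurable] = Suc(2,3)
  have [measurable]: "(\<lambda>z. lam d (subtree False (f z)) (2 * g z)) \<in> borel_measurable N"
    "(\<lambda>z. lam d (subtree True (f z)) (2 * g z - 1)) \<in> borel_measurable N"
    by (intro Suc(1); simp)+
  show ?case by simp
qed

lemma measurable_len [measurable (raw)]:
  assumes [measurable]: "f \<in> measurable N trees" "g \<in> borel_measurable N"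
  shows "(\<lambda>z. len d (f z) (g z)) \<in> borel_measurable N"
  using assms
proof (induction d arbitrary: f g)
  case 0
  note [measurable] = 0
  show ?case by simp
next
  case (Suc d)
  note [measurable] = Suc(2,3)
  have [measurable]: "(\<lambda>z. len d (subtree False (f z)) (2 * g z)) \<in> borel_measurable N"
    "(\<lambda>z. len d (subtree True (f z)) (2 * g z - 1)) \<in> borel_measurable N"
    by (intro Suc(1); simp)+
  show ?case by simp
qed

lemma measurable_phi [measurable (raw)]:
  assumes [measurable]: "f \<in> measurable N trees" "g \<in> borel_measurable N"
  shows "(\<lambda>z. phi (f z) (g z)) \<in> borel_measurable N"
  by (rule borel_measurable_LIMSEQ_real[OF LIMSEQ_lam]) measurable

lemma measurable_sqsum [measurable]: "sqsum d \<in> borel_measurable trees"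
proof (induction d)
  case (Suc d)
  note [measurable] = Suc
  show ?case by simp
qed simp

lemma sqsum_nonneg: "0 \<le> sqsum d \<xi>"
  by (induction d arbitrary: \<xi>) auto

section \<open>Moments of the ratios and of the image lengths\<close>

lemma nn_integral_unif:
  assumes [measurable]: "F \<in> borel_measurable borel"
  shows "(\<integral>\<^sup>+x. F x \<partial>unif) = (\<integral>\<^sup>+x. F x * indicator {0..1} x \<partial>lborel)"
  unfolding unif_eq_density by (subst nn_integral_density) (auto simp: mult.commute)

lemma AE_unif: "AE c in unif. 0 < c \<and> c < 1"
proof -
  have "AE c in lborel. c \<notin> {0, 1::real}"
    using AE_lborel_singleton[of "0::real"] AE_lborel_singleton[of "1::real"] by eventually_elim auto
  then have "AE c in lborel. 0 < (indicator {0..1} c :: ennreal) \<longrightarrow> 0 < c \<and> c < (1::real)"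
    by eventually_elim (auto simp: indicator_def)
  then show ?thesis unfolding unif_eq_density by (subst AE_density) auto
qed

lemma nn_integral_unif_FTC:
  assumes "f \<in> borel_measurable borel" "\<And>x. 0 \<le> x \<Longrightarrow> x \<le> 1 \<Longrightarrow> (G has_real_derivative f x) (at x)"
    "\<And>x. 0 \<le> x \<Longrightarrow> x \<le> 1 \<Longrightarrow> 0 \<le> f x"
  shows "(\<integral>\<^sup>+x. ennreal (f x) \<partial>unif) = ennreal (G 1 - G 0)"
  using assms nn_integral_FTC_Icc[of f 0 1 G]
  by (subst nn_integral_unif) (auto intro: DERIV_subset simp: has_real_derivative_iff_has_vector_derivative has_vector_derivative_at_within)

lemma nn_integral_unif_powers:
  "(\<integral>\<^sup>+c. ennreal c \<partial>unif) = ennreal (1/2)"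
  "(\<integral>\<^sup>+c. ennreal (1 - c) \<partial>unif) = ennreal (1/2)"
  "(\<integral>\<^sup>+c. ennreal (c\<^sup>2) \<partial>unif) = ennreal (1/3)"
  "(\<integral>\<^sup>+c. ennreal ((1 - c)\<^sup>2) \<partial>unif) = ennreal (1/3)"
proof -
  show "(\<integral>\<^sup>+c. ennreal c \<partial>unif) = ennreal (1/2)"
    by (subst nn_integral_unif_FTC[of "\<lambda>c. c" "\<lambda>c. c\<^sup>2/2"]) (auto intro!: derivative_eq_intros)
  show "(\<integral>\<^sup>+c. ennreal (1 - c) \<partial>unif) = ennreal (1/2)"
    by (subst nn_integral_unif_FTC[of "\<lambda>c. 1 - c" "\<lambda>c. c - c\<^sup>2/2"]) (auto intro!: derivative_eq_intros)
  show "(\<integral>\<^sup>+c. ennreal (c\<^sup>2) \<partial>unif) = ennreal (1/3)"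
    by (subst nn_integral_unif_FTC[of "\<lambda>c. c\<^sup>2" "\<lambda>c. c^3/3"]) (auto intro!: derivative_eq_intros)
  show "(\<integral>\<^sup>+c. ennreal ((1 - c)\<^sup>2) \<partial>unif) = ennreal (1/3)"
    by (subst nn_integral_unif_FTC[of "\<lambda>c. (1-c)\<^sup>2" "\<lambda>c. - ((1-c)^3/3)"]) (auto intro!: derivative_eq_intros)
qed

text \<open>Root and subtree are independent; this factorisation turns recursions over the tree into
  recursions for expectations.\<close>

lemma nn_integral_trees_root:
  assumes f [measurable]: "f \<in> borel_measurable borel" and g [measurable]: "g \<in> borel_measurable trees"
  shows "(\<integral>\<^sup>+\<xi>. f (root \<xi>) * g (subtree b \<xi>) \<partial>trees) = (\<integral>\<^sup>+c. f c \<partial>unif) * (\<integral>\<^sup>+\<xi>. g \<xi> \<partial>trees)"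
proof -
  have f' [measurable]: "f \<in> borel_measurable unif"
    using f measurable_cong_sets[OF sets_unif refl, of borel] by blast
  have "(\<integral>\<^sup>+\<xi>. f (root \<xi>) * g (subtree b \<xi>) \<partial>trees)
    = (\<integral>\<^sup>+c. \<integral>\<^sup>+x. \<integral>\<^sup>+y. f (root (node c x y)) * g (if b then y else x) \<partial>trees \<partial>trees \<partial>unif)"
    by (subst nn_integral_trees) (cases b; auto)+
  also have "\<dots> = (\<integral>\<^sup>+c. \<integral>\<^sup>+x. \<integral>\<^sup>+y. f c * g (if b then y else x) \<partial>trees \<partial>trees \<partial>unif)"
    by (intro nn_integral_cong_AE eventually_mono[OF AE_unif]) (auto simp: root_def)
  also have "\<dots> = (\<integral>\<^sup>+c. f c * (\<integral>\<^sup>+\<xi>. g \<xi> \<partial>trees) \<partial>unif)"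
    using trees.emeasure_space_1 by (cases b) (auto simp: nn_integral_cmult)
  also have "\<dots> = (\<integral>\<^sup>+c. f c \<partial>unif) * (\<integral>\<^sup>+\<xi>. g \<xi> \<partial>trees)"
    by (rule nn_integral_multc) measurable
  finally show ?thesis .
qed

lemma nn_integral_len: "(\<integral>\<^sup>+\<xi>. ennreal (len d \<xi> t) \<partial>trees) = ennreal ((1/2)^d)"
proof (induction d arbitrary: t)
  case 0 show ?case using trees.emeasure_space_1 by simp
next
  case (Suc d)
  have *: "ennreal (1/2) * ennreal ((1/2)^d) = ennreal ((1/2)^Suc d)"
    by (subst ennreal_mult [symmetric]) auto
  have L: "(\<integral>\<^sup>+\<xi>. ennreal (root \<xi>) * ennreal (len d (subtree False \<xi>) (2*t)) \<partial>trees) = ennreal ((1/2)^Suc d)"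
    by (subst nn_integral_trees_root[of ennreal "\<lambda>\<xi>. ennreal (len d \<xi> (2*t))"])
      (auto simp only: Suc nn_integral_unif_powers *, measurable)
  have R: "(\<integral>\<^sup>+\<xi>. ennreal (1 - root \<xi>) * ennreal (len d (subtree True \<xi>) (2*t-1)) \<partial>trees) = ennreal ((1/2)^Suc d)"
    by (subst nn_integral_trees_root[of "\<lambda>c. ennreal (1 - c)" "\<lambda>\<xi>. ennreal (len d \<xi> (2*t-1))"])
      (auto simp only: Suc nn_integral_unif_powers *, measurable)
  show ?case
  proof (cases "t < 1/2")
    case True
    then show ?thesis unfolding L [symmetric] by (intro nn_integral_cong) (auto simp: ennreal_mult len_bounds)
  next
    case False
    then show ?thesis unfolding R [symmetric] by (intro nn_integral_cong) (auto simp: ennreal_mult len_bounds)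
  qed
qed

text \<open>Each level multiplies the expectation by E c^2 + E (1 - c)^2 = 2/3. That this is below 1
  is the source of the continuity of \<open>phi\<close> and of its quantitative form.\<close>

lemma nn_integral_sqsum: "(\<integral>\<^sup>+\<xi>. ennreal (sqsum d \<xi>) \<partial>trees) = ennreal ((2/3)^d)"
proof (induction d)
  case 0 show ?case using trees.emeasure_space_1 by simp
next
  case (Suc d)
  have *: "ennreal (1/3) * ennreal ((2/3)^d) + ennreal (1/3) * ennreal ((2/3)^d) = ennreal ((2/3)^Suc d)"
    by (subst (1 2) ennreal_mult [symmetric], simp, simp, subst ennreal_plus [symmetric]) (auto simp: field_simps)
  have "(\<integral>\<^sup>+\<xi>. ennreal (sqsum (Suc d) \<xi>) \<partial>trees) =
    (\<integral>\<^sup>+\<xi>. ennreal ((root \<xi>)\<^sup>2) * ennreal (sqsum d (subtree False \<xi>)) \<partial>trees) +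
    (\<integral>\<^sup>+\<xi>. ennreal ((1 - root \<xi>)\<^sup>2) * ennreal (sqsum d (subtree True \<xi>)) \<partial>trees)"
    by (subst nn_integral_add [symmetric]) (auto simp: ennreal_mult sqsum_nonneg intro!: nn_integral_cong)
  also have "\<dots> = ennreal (1/3) * ennreal ((2/3)^d) + ennreal (1/3) * ennreal ((2/3)^d)"
    using nn_integral_trees_root[of "\<lambda>c. ennreal (c\<^sup>2)" "\<lambda>\<xi>. ennreal (sqsum d \<xi>)" False]
      nn_integral_trees_root[of "\<lambda>c. ennreal ((1-c)\<^sup>2)" "\<lambda>\<xi>. ennreal (sqsum d \<xi>)" True]
    by (simp add: Suc nn_integral_unif_powers)
  finally show ?case unfolding * .
qed


section \<open>Modulus of continuity of the random function\<close>

lemma sqrt_sqsum_ge: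
  "root \<xi> * sqrt (sqsum d (subtree False \<xi>)) \<le> sqrt (sqsum (Suc d) \<xi>)"
  "(1 - root \<xi>) * sqrt (sqsum d (subtree True \<xi>)) \<le> sqrt (sqsum (Suc d) \<xi>)"
proof -
  have "root \<xi> * sqrt (sqsum d (subtree False \<xi>)) = sqrt ((root \<xi>)\<^sup>2 * sqsum d (subtree False \<xi>))"
    by (simp add: real_sqrt_mult)
  also have "\<dots> \<le> sqrt (sqsum (Suc d) \<xi>)" by (auto simp: sqsum_nonneg)
  finally show "root \<xi> * sqrt (sqsum d (subtree False \<xi>)) \<le> sqrt (sqsum (Suc d) \<xi>)" .
  have "(1 - root \<xi>) * sqrt (sqsum d (subtree True \<xi>)) = sqrt ((1 - root \<xi>)\<^sup>2 * sqsum d (subtree True \<xi>))"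
    by (simp add: real_sqrt_mult)
  also have "\<dots> \<le> sqrt (sqsum (Suc d) \<xi>)" by (auto simp: sqsum_nonneg)
  finally show "(1 - root \<xi>) * sqrt (sqsum d (subtree True \<xi>)) \<le> sqrt (sqsum (Suc d) \<xi>)" .
qed

lemma phi_le_sqrt_sqsum:
  assumes "t \<le> (1/2)^d" shows "phi \<xi> t \<le> sqrt (sqsum d \<xi>)"
  using assms
proof (induction d arbitrary: \<xi> t)
  case 0 then show ?case using phi_bounds by simp
next
  case (Suc d)
  have "t \<le> 1/2" using Suc.prems power_le_one[of "1/2::real" d] by simp
  then have "phi \<xi> t = root \<xi> * phi (subtree False \<xi>) (2*t)" by (rule phi_le_half)
  also have "\<dots> \<le> root \<xi> * sqrt (sqsum d (subtree False \<xi>))"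
    using Suc by (intro mult_left_mono) auto
  also note sqrt_sqsum_ge(1)
  finally show ?case .
qed

lemma one_minus_phi_le_sqrt_sqsum:
  assumes "t \<ge> 1 - (1/2)^d" shows "1 - phi \<xi> t \<le> sqrt (sqsum d \<xi>)"
  using assms
proof (induction d arbitrary: \<xi> t)
  case 0 then show ?case using phi_bounds by simp
next
  case (Suc d)
  have "t \<ge> 1/2" using Suc.prems power_le_one[of "1/2::real" d] by simp
  then have "1 - phi \<xi> t = (1 - root \<xi>) * (1 - phi (subtree True \<xi>) (2*t-1))"
    using phi_ge_half[of t \<xi>] by (simp add: algebra_simps)
  also have "\<dots> \<le> (1 - root \<xi>) * sqrt (sqsum d (subtree True \<xi>))"
    using Suc by (intro mult_left_mono) auto
  also note sqrt_sqsum_ge(2)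
  finally show ?case .
qed

text \<open>Points this close lie in one or in two adjacent dyadic intervals of level
  \<open>d\<close>, and every image length is at most the root of the sum of squares; hence the
  factor 2.\<close>

lemma phi_diff_le_sqrt_sqsum:
  assumes "s \<le> t" "t - s \<le> (1/2)^d" shows "phi \<xi> t - phi \<xi> s \<le> 2 * sqrt (sqsum d \<xi>)"
  using assms
proof (induction d arbitrary: \<xi> s t)
  case 0 then show ?case using phi_bounds[of \<xi> t] phi_bounds[of \<xi> s] by simp
next
  case (Suc d)
  consider "t \<le> 1/2" | "s \<ge> 1/2" | "s < 1/2" "1/2 < t" by linarith
  then show ?case
  proof cases
    case 1
    have "phi \<xi> t - phi \<xi> s = root \<xi> * (phi (subtree False \<xi>) (2*t) - phi (subtree False \<xi>) (2 * s))"
      using 1 Suc.prems by (simp add: phi_le_half algebra_simps)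
    also have "\<dots> \<le> root \<xi> * (2 * sqrt (sqsum d (subtree False \<xi>)))"
      using Suc by (intro mult_left_mono) auto
    finally show ?thesis using sqrt_sqsum_ge(1)[of \<xi> d] by linarith
  next
    case 2
    have "phi \<xi> t - phi \<xi> s = (1 - root \<xi>) * (phi (subtree True \<xi>) (2*t-1) - phi (subtree True \<xi>) (2 * s-1))"
      using 2 Suc.prems by (simp add: phi_ge_half algebra_simps)
    also have "\<dots> \<le> (1 - root \<xi>) * (2 * sqrt (sqsum d (subtree True \<xi>)))"
      using Suc by (intro mult_left_mono) auto
    finally show ?thesis using sqrt_sqsum_ge(2)[of \<xi> d] by linarith
  next
    \<comment> \<open>Once the midpoint separates the points, the one-sided bounds at the inner ends
      of the two halves finish the proof without the induction hypothesis.\<close>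
    case 3
    have "phi \<xi> t - phi \<xi> s = root \<xi> * (1 - phi (subtree False \<xi>) (2 * s)) + (1 - root \<xi>) * phi (subtree True \<xi>) (2*t-1)"
      using 3 by (simp add: phi_less_half phi_ge_half algebra_simps)
    also have "\<dots> \<le> root \<xi> * sqrt (sqsum d (subtree False \<xi>)) + (1 - root \<xi>) * sqrt (sqsum d (subtree True \<xi>))"
      using 3 Suc.prems by (intro add_mono mult_left_mono phi_le_sqrt_sqsum one_minus_phi_le_sqrt_sqsum) auto
    finally show ?thesis using sqrt_sqsum_ge[of \<xi> d] by linarith
  qed
qed

lemma continuous_phi:
  assumes "(\<lambda>d. sqsum d \<xi>) \<longlonglongrightarrow> 0"
  shows "continuous_on UNIV (phi \<xi>)"
proof -
  have "uniformly_continuous_on UNIV (phi \<xi>)"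
    unfolding uniformly_continuous_on_def
  proof (intro allI impI)
    fix e :: real assume "e > 0"
    have "(\<lambda>d. 2 * sqrt (sqsum d \<xi>)) \<longlonglongrightarrow> 2 * sqrt 0"
      by (intro tendsto_intros assms)
    then obtain d where d: "2 * sqrt (sqsum d \<xi>) < e"
      using order_tendstoD(2)[of "\<lambda>d. 2 * sqrt (sqsum d \<xi>)" "2 * sqrt 0" sequentially e] \<open>e > 0\<close>
      by (auto simp: eventually_sequentially)
    have "dist (phi \<xi> x') (phi \<xi> x) < e" if "dist x' x < (1/2)^d" for x x'
    proof -
      have "\<bar>phi \<xi> x' - phi \<xi> x\<bar> \<le> 2 * sqrt (sqsum d \<xi>)"
        using that phi_diff_le_sqrt_sqsum[of x x' d \<xi>] phi_diff_le_sqrt_sqsum[of x' x d \<xi>]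
          phi_mono[of x x' \<xi>] phi_mono[of x' x \<xi>]
        by (cases "x \<le> x'") (auto simp: dist_real_def)
      then show ?thesis using d by (simp add: dist_real_def)
    qed
    then show "\<exists>d>0. \<forall>x\<in>UNIV. \<forall>x'\<in>UNIV. dist x' x < d \<longrightarrow> dist (phi \<xi> x') (phi \<xi> x) < e"
      by (intro exI[of _ "(1/2)^d"]) auto
  qed
  then show ?thesis by (rule uniformly_continuous_imp_continuous)
qed

section \<open>Strict monotonicity\<close>

lemma root_eq: "(\<And>p. 0 < \<xi> p \<and> \<xi> p < 1) \<Longrightarrow> root \<xi> = \<xi> []"
  by (simp add: root_def min_def max_def) (meson less_imp_le not_less)

text \<open>Induction on the scale of 1 - t: passing to the right half doubles this distance, and on
  the left half the value is bounded by the root, which is below 1.\<close>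

lemma phi_less_1:
  assumes "\<And>p. 0 < \<xi> p \<and> \<xi> p < 1" "t < 1"
  shows "phi \<xi> t < 1"
proof -
  have "phi \<xi> t < 1" if "\<And>p. 0 < \<xi> p \<and> \<xi> p < 1" "t \<le> 1 - (1/2)^d" for d
    using that
  proof (induction d arbitrary: \<xi> t)
    case 0 then show ?case by (simp add: phi_eq_0)
  next
    case (Suc d)
    have r: "0 < root \<xi>" "root \<xi> < 1" using Suc.prems root_eq[of \<xi>] by auto
    show ?case
    proof (cases "t < 1/2")
      case True
      have "root \<xi> * phi (subtree False \<xi>) (2*t) \<le> root \<xi>" using phi_bounds by (simp add: mult_left_le)
      then have "root \<xi> * phi (subtree False \<xi>) (2*t) < 1" using r by linarith
      then show ?thesis using True by (simp add: phi_less_half)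
    next
      case False
      have "phi (subtree True \<xi>) (2*t-1) < 1"
        using Suc.prems by (intro Suc.IH) (auto simp: subtree_def)
      then have "(1 - root \<xi>) * phi (subtree True \<xi>) (2*t-1) < (1 - root \<xi>) * 1"
        using r by (intro mult_strict_left_mono) auto
      then show ?thesis using phi_ge_half[of t \<xi>] False by (simp del: mult_less_cancel_left1 mult_less_cancel_left2)
    qed
  qed
  moreover obtain d where "(1/2)^d < 1 - t" using real_arch_pow_inv[of "1-t" "1/2"] assms(2) by auto
  ultimately show ?thesis using assms(1) by (metis diff_less_eq le_diff_eq less_eq_real_def add.commute)
qed

text \<open>Induction on the scale of the gap: it doubles while both points share a half, and when
  the midpoint separates them the left value is below the root and the right value is not.\<close>

lemma phi_strict_mono:
  assumes "\<And>p. 0 < \<xi> p \<and> \<xi> p < 1" "s < t" "0 \<le> s" "t \<le> 1"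
  shows "phi \<xi> s < phi \<xi> t"
proof -
  have "phi \<xi> s < phi \<xi> t" if "\<And>p. 0 < \<xi> p \<and> \<xi> p < 1" "t - s > (1/2)^d" "0 \<le> s" "t \<le> 1" for d
    using that
  proof (induction d arbitrary: \<xi> s t)
    case (Suc d)
    have r: "0 < root \<xi>" "root \<xi> < 1" using Suc.prems root_eq[of \<xi>] by auto
    have st: "s < t" using Suc.prems(2) zero_le_power[of "1/2::real" "Suc d"] by linarith
    have sub: "0 < subtree b \<xi> p \<and> subtree b \<xi> p < 1" for b p
      using Suc.prems by (auto simp: subtree_def)
    consider "t < 1/2" | "s \<ge> 1/2" | "s < 1/2" "1/2 \<le> t" by linarith
    then show ?case
    proof cases
      case 1
      have "phi (subtree False \<xi>) (2 * s) < phi (subtree False \<xi>) (2*t)"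
        using Suc.prems 1 sub by (intro Suc.IH) auto
      then show ?thesis using 1 r st by (simp add: phi_less_half)
    next
      case 2
      have "phi (subtree True \<xi>) (2 * s - 1) < phi (subtree True \<xi>) (2*t-1)"
        using Suc.prems 2 sub by (intro Suc.IH) auto
      then show ?thesis using 2 r st by (simp add: phi_ge_half)
    next
      case 3
      have "phi (subtree False \<xi>) (2 * s) < 1" using 3 sub by (intro phi_less_1) auto
      then have "phi \<xi> s < root \<xi>" using r 3 by (simp add: phi_less_half)
      also have "\<dots> \<le> phi \<xi> t" using 3 r phi_bounds by (simp add: phi_ge_half)
      finally show ?thesis .
    qed
  qed auto
  moreover obtain d where "(1/2)^d < t - s" using real_arch_pow_inv[of "t-s" "1/2"] assms(2) by auto
  ultimately show ?thesis using assms by blast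
qed

section \<open>Almost sure properties of a random tree\<close>

lemma AE_trees_interior: "AE \<xi> in trees. \<forall>p. 0 < \<xi> p \<and> \<xi> p < 1"
proof -
  have "AE \<xi> in trees. 0 < \<xi> p \<and> \<xi> p < 1" for p
    unfolding trees_def using AE_unif by (rule tree_prod.AE_component[rotated]) simp
  then show ?thesis unfolding AE_all_countable by blast
qed

text \<open>The rate 3/4 is one of those strictly between 2/3 and 1: after weighting with (4/3)^d
  the expectations form the convergent series of (8/9)^d, so the random weighted sum is almost
  surely finite and serves as \<open>A\<close>.\<close>

lemma AE_sqsum_geometric: "AE \<xi> in trees. \<exists>A. \<forall>d. sqsum d \<xi> \<le> A * (3/4)^d"
proof -
  have "(\<integral>\<^sup>+\<xi>. (\<Sum>d. ennreal ((4/3)^d) * ennreal (sqsum d \<xi>)) \<partial>trees)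
    = (\<Sum>d. ennreal ((4/3)^d) * ennreal ((2/3)^d))"
    by (subst nn_integral_suminf) (auto simp: nn_integral_cmult nn_integral_sqsum)
  also have "\<dots> = (\<Sum>d. ennreal ((8/9)^d))"
    by (intro suminf_cong) (simp add: ennreal_mult [symmetric] power_mult_distrib [symmetric])
  also have "\<dots> < \<infinity>" by (simp add: suminf_ennreal2 summable_geometric)
  finally have "AE \<xi> in trees. (\<Sum>d. ennreal ((4/3)^d) * ennreal (sqsum d \<xi>)) \<noteq> \<infinity>"
    by (intro nn_integral_noteq_infinite) auto
  then show ?thesis
  proof eventually_elim
    case (elim \<xi>)
    define A where "A = enn2real (\<Sum>d. ennreal ((4/3)^d) * ennreal (sqsum d \<xi>))"
    have "sqsum d \<xi> \<le> A * (3/4)^d" for d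
    proof -
      have "ennreal ((4/3)^d * sqsum d \<xi>) \<le> (\<Sum>d. ennreal ((4/3)^d) * ennreal (sqsum d \<xi>))"
        using sum_le_suminf[of "\<lambda>d. ennreal ((4/3)^d) * ennreal (sqsum d \<xi>)" "{d}"]
        by (simp add: ennreal_mult sqsum_nonneg)
      also have "\<dots> = ennreal A" unfolding A_def using elim by (simp add: less_top)
      finally have "(4/3)^d * sqsum d \<xi> \<le> A" by (simp add: A_def)
      then have "(3/4)^d * ((4/3)^d * sqsum d \<xi>) \<le> (3/4)^d * A" by (intro mult_left_mono) auto
      moreover have "(3/4)^d * ((4/3)^d * sqsum d \<xi>) = sqsum d \<xi>"
        by (simp add: power_divide)
      ultimately show ?thesis by (simp only: mult.commute[of A])
    qed
    then show ?case by blast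
  qed
qed

section \<open>Dyadic indexing\<close>

text \<open>The node with path \<open>p\<close> carries the ratio of the midpoint k / 2^n where (n,
  k) = \<open>dyad p\<close>: the left half sends k / 2^n to k / 2^(n+1), the right half sends it to
  (2^n + k) / 2^(n+1).\<close>

primrec dyad :: "bool list \<Rightarrow> nat \<times> nat" where
  "dyad [] = (1, 1)"
| "dyad (b # q) = (Suc (fst (dyad q)), if b then 2 ^ fst (dyad q) + snd (dyad q) else snd (dyad q))"

lemma dyad_in: "dyad p \<in> midpoint_indices"
  by (induction p) (auto simp: midpoint_indices_def)

lemma dyad_bounds: "1 \<le> fst (dyad p)" "0 < snd (dyad p)" "snd (dyad p) < 2 ^ fst (dyad p)"
  using dyad_in[of p] by (auto simp: midpoint_indices_def)

lemma inj_dyad: "inj dyad"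
proof (rule injI)
  fix p q show "dyad p = dyad q \<Longrightarrow> p = q"
  proof (induction p arbitrary: q)
    case Nil
    then show ?case using dyad_bounds(1)[of "tl q"] by (cases q) auto
  next
    case (Cons b p)
    show ?case
    proof (cases q)
      case Nil
      then show ?thesis using Cons.prems dyad_bounds(1)[of p] by auto
    next
      case (Cons b' q')
      then show ?thesis using Cons.prems Cons.IH[of q'] dyad_bounds[of p] dyad_bounds[of q']
        by (auto simp: prod_eq_iff split: if_splits)
    qed
  qed
qed

lemma range_dyad: "range dyad = midpoint_indices"
proof -
  have "(n, k) \<in> range dyad" if "(n, k) \<in> midpoint_indices" for n k
    using that
  proof (induction n arbitrary: k)
    case 0 then show ?case by (simp add: midpoint_indices_def)
  next
    case (Suc n)
    show ?case
    proof (cases "n = 0")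
      case True
      then have "k = 1" using Suc.prems by (simp add: midpoint_indices_def)
      then show ?thesis using True by (intro image_eqI[of _ _ "[]"]) auto
    next
      case False
      show ?thesis
      proof (cases "k < 2^n")
        case True
        then obtain p where "dyad p = (n, k)" using Suc False by (force simp: midpoint_indices_def image_iff)
        then show ?thesis by (intro image_eqI[of _ _ "False # p"]) auto
      next
        case ge: False
        have "k \<noteq> 2^n" using Suc.prems False by (auto simp: midpoint_indices_def)
        then have "(n, k - 2^n) \<in> midpoint_indices" using Suc.prems ge False by (auto simp: midpoint_indices_def)
        then obtain p where "dyad p = (n, k - 2^n)" using Suc by (force simp: image_iff)
        then show ?thesis using ge by (intro image_eqI[of _ _ "True # p"]) auto
      qed
    qed
  qed
  then show ?thesis using dyad_in by auto
qed

text \<open>The midpoint relation is invariant under affine maps, so on either half it is inherited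
  from the subtree; at the root it is the value of \<open>phi\<close> at 1/2.\<close>

lemma phi_dyad:
  assumes "\<And>p. 0 < \<xi> p \<and> \<xi> p < 1" "dyad p = (n, k)"
  shows "phi \<xi> (real k / 2 ^ n) = phi \<xi> ((real k - 1) / 2 ^ n)
          + \<xi> p * (phi \<xi> ((real k + 1) / 2 ^ n) - phi \<xi> ((real k - 1) / 2 ^ n))"
  using assms
proof (induction p arbitrary: \<xi> n k)
  case Nil
  then have "n = 1" "k = 1" by auto
  moreover have "phi \<xi> (1/2) = \<xi> []"
    using phi_ge_half[of "1/2" \<xi>] root_eq[of \<xi>] Nil(1) by (simp add: phi_eq_0)
  ultimately show ?case by (simp add: phi_eq_0 phi_eq_1)
next
  case (Cons b p)
  obtain m j where mj: "dyad p = (m, j)" by fastforce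
  have j: "0 < j" "j < 2^m" using dyad_in[of p] mj by (auto simp: midpoint_indices_def)
  have n: "n = Suc m" using Cons.prems mj by simp
  \<comment> \<open>This keeps the right neighbour inside the closed left half, where
    \<open>phi_le_half\<close> applies.\<close>
  have j': "real j + 1 \<le> 2^m" using j by (metis Suc_leI of_nat_Suc of_nat_le_iff of_nat_numeral of_nat_power add.commute)
  have IH: "phi (subtree b \<xi>) (real j / 2 ^ m) = phi (subtree b \<xi>) ((real j - 1) / 2 ^ m)
          + \<xi> (b # p) * (phi (subtree b \<xi>) ((real j + 1) / 2 ^ m) - phi (subtree b \<xi>) ((real j - 1) / 2 ^ m))"
    using Cons.IH[of "subtree b \<xi>" m j] Cons.prems(1) mj by (auto simp: subtree_def)
  show ?case
  proof (cases b)
    case False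
    have k: "k = j" using Cons.prems mj False by simp
    have "phi \<xi> (x / 2^n) = root \<xi> * phi (subtree b \<xi>) (x / 2^m)" if "x \<le> 2^m" for x
      using phi_le_half[of "x/2^n" \<xi>] that False n by (simp add: field_simps)
    then have e: "phi \<xi> (real j / 2^n) = root \<xi> * phi (subtree b \<xi>) (real j / 2^m)"
      "phi \<xi> ((real j - 1) / 2^n) = root \<xi> * phi (subtree b \<xi>) ((real j - 1) / 2^m)"
      "phi \<xi> ((real j + 1) / 2^n) = root \<xi> * phi (subtree b \<xi>) ((real j + 1) / 2^m)"
      using j' j by auto
    show ?thesis unfolding k e IH by (simp only: algebra_simps)
  next
    case True
    have k: "k = 2^m + j" using Cons.prems mj True by simp
    have "phi \<xi> ((2^m + x) / 2^n) = root \<xi> + (1 - root \<xi>) * phi (subtree b \<xi>) (x / 2^m)" if "0 \<le> x" for x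
      using phi_ge_half[of "(2^m+x)/2^n" \<xi>] that True n by (simp add: field_simps)
    from this[of "real j"] this[of "real j - 1"] this[of "real j + 1"] j
    have e: "phi \<xi> (real k / 2^n) = root \<xi> + (1 - root \<xi>) * phi (subtree b \<xi>) (real j / 2^m)"
      "phi \<xi> ((real k - 1) / 2^n) = root \<xi> + (1 - root \<xi>) * phi (subtree b \<xi>) ((real j - 1) / 2^m)"
      "phi \<xi> ((real k + 1) / 2^n) = root \<xi> + (1 - root \<xi>) * phi (subtree b \<xi>) ((real j + 1) / 2^m)"
      by (simp_all add: k add_diff_eq add.assoc)
    show ?thesis unfolding e IH by (simp only: algebra_simps)
  qed
qed

lemma dyadic_homeo_phi:
  assumes int: "\<And>p. 0 < \<xi> p \<and> \<xi> p < 1" and lim: "(\<lambda>d. sqsum d \<xi>) \<longlonglongrightarrow> 0"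
    and x: "\<And>p. x (fst (dyad p)) (snd (dyad p)) = \<xi> p"
  shows "dyadic_homeo x (phi \<xi>)"
proof -
  have cont: "continuous_on {0..1} (phi \<xi>)"
    using continuous_phi[OF lim] continuous_on_subset by blast
  have "phi \<xi> ` {0..1} = {0..1}"
  proof (intro equalityI subsetI)
    fix y :: real assume "y \<in> {0..1}"
    then obtain x where "0 \<le> x" "x \<le> 1" "phi \<xi> x = y"
      using IVT'[of "phi \<xi>" 0 y 1] cont by (force simp: phi_eq_0 phi_eq_1)
    then show "y \<in> phi \<xi> ` {0..1}" by force
  qed (auto simp: phi_bounds)
  moreover have "inj_on (phi \<xi>) {0..1}"
  proof (rule linorder_inj_onI')
    fix s t :: real assume "s \<in> {0..1}" "t \<in> {0..1}" "s < t"
    then have "phi \<xi> s < phi \<xi> t" by (intro phi_strict_mono int) auto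
    then show "phi \<xi> s \<noteq> phi \<xi> t" by simp
  qed
  ultimately have "\<exists>\<psi>. homeomorphism {0..1} {0..1} (phi \<xi>) \<psi>"
    using homeomorphism_compact[OF _ cont] by blast
  moreover have "phi \<xi> (real k / 2 ^ n) = phi \<xi> ((real k - 1) / 2 ^ n)
          + x n k * (phi \<xi> ((real k + 1) / 2 ^ n) - phi \<xi> ((real k - 1) / 2 ^ n))"
    if "(n, k) \<in> midpoint_indices" for n k
  proof -
    have "(n, k) \<in> range dyad" using that range_dyad by simp
    then obtain p where "dyad p = (n, k)" by (elim rangeE) simp
    then have "x n k = \<xi> p" using x[of p] by simp
    show ?thesis unfolding \<open>x n k = \<xi> p\<close> by (rule phi_dyad) (rule int, fact)
  qed
  ultimately show ?thesis unfolding dyadic_homeo_def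
    by (simp add: phi_eq_0 phi_eq_1 case_prod_unfold)
qed


section \<open>Averaging over the uniform law\<close>

lemma measurable_unif [simp]: "measurable unif N = measurable borel N"
  by (rule measurable_cong_sets) auto

lemma integrable_unif_bounded:
  fixes f :: "real \<Rightarrow> real"
  assumes "f \<in> borel_measurable borel" "\<And>t. \<bar>f t\<bar> \<le> B"
  shows "integrable unif f"
  using assms by (intro unif.integrable_const_bound[of _ B]) auto

lemma integral_unif:
  fixes f :: "real \<Rightarrow> real"
  assumes "f \<in> borel_measurable borel"
  shows "(\<integral>t. f t \<partial>unif) = (\<integral>t. indicator {0..1} t * f t \<partial>lborel)"
proof -
  have *: "unif = density lborel (\<lambda>t. ennreal (indicator {0..1} t))"
    unfolding unif_eq_density by (intro density_cong) (auto split: split_indicator)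
  show ?thesis unfolding * using assms by (subst integral_density) auto
qed

lemma integral_unif_subinterval:
  fixes g :: "real \<Rightarrow> real"
  assumes [measurable]: "g \<in> borel_measurable borel" and ab: "0 \<le> a" "a < b" "b \<le> 1"
  shows "(\<integral>t. indicator {a..b} t * g t \<partial>unif) = (b - a) * (\<integral>t. g (a + (b - a) * t) \<partial>unif)"
proof -
  have "(\<integral>t. indicator {a..b} t * g t \<partial>unif) = (\<integral>t. indicator {a..b} t * g t \<partial>lborel)"
    using ab by (subst integral_unif) (auto intro!: Bochner_Integration.integral_cong split: split_indicator)
  also have "\<dots> = (b - a) * (\<integral>t. indicator {a..b} (a + (b - a) * t) * g (a + (b - a) * t) \<partial>lborel)"
    using ab by (subst lborel_integral_real_affine[where c = "b - a" and t = a]) auto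
  also have "(\<integral>t. indicator {a..b} (a + (b - a) * t) * g (a + (b - a) * t) \<partial>lborel) =
     (\<integral>t. indicator {0..1} t * g (a + (b - a) * t) \<partial>lborel)"
  proof (intro Bochner_Integration.integral_cong refl)
    fix t
    have "(b - a) * t \<le> b - a \<longleftrightarrow> t \<le> 1" "0 \<le> (b - a) * t \<longleftrightarrow> 0 \<le> t"
      using ab by (simp_all add: zero_le_mult_iff)
    then have "a + (b - a) * t \<in> {a..b} \<longleftrightarrow> t \<in> {0..1}"
      unfolding atLeastAtMost_iff by linarith
    then show "indicator {a..b} (a + (b - a) * t) * g (a + (b - a) * t) = indicator {0..1} t * g (a + (b - a) * t)"
      by (auto split: split_indicator)
  qed
  also have "\<dots> = (\<integral>t. g (a + (b - a) * t) \<partial>unif)" by (subst integral_unif) auto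
  finally show ?thesis .
qed

lemma integral_unif_reflect:
  fixes g :: "real \<Rightarrow> real"
  assumes [measurable]: "g \<in> borel_measurable borel"
  shows "(\<integral>t. g (1 - t) \<partial>unif) = (\<integral>t. g t \<partial>unif)"
proof -
  have "(\<integral>t. g t \<partial>unif) = (\<integral>t. indicator {0..1} t * g t \<partial>lborel)" by (subst integral_unif) auto
  also have "\<dots> = (\<integral>t. indicator {0..1} (1 - t) * g (1 - t) \<partial>lborel)"
    by (subst lborel_integral_real_affine[where c = "-1" and t = 1]) auto
  also have "\<dots> = (\<integral>t. g (1 - t) \<partial>unif)"
    by (subst integral_unif) (auto intro!: Bochner_Integration.integral_cong split: split_indicator)
  finally show ?thesis by simp
qed

lemma AE_unif_neq: "AE t in unif. t \<noteq> (a::real)"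
  unfolding unif_eq_density using AE_lborel_singleton[of a] by (subst AE_density) auto

lemma integral_unif_halves:
  fixes g :: "real \<Rightarrow> real"
  assumes [measurable]: "g \<in> borel_measurable borel" and bd: "\<And>t. \<bar>g t\<bar> \<le> B"
  shows "(\<integral>t. g t \<partial>unif) = (\<integral>t. g (t / 2) / 2 \<partial>unif) + (\<integral>t. g ((1 + t) / 2) / 2 \<partial>unif)"
proof -
  have B: "0 \<le> B" using bd[of 0] by linarith
  have "(\<integral>t. g t \<partial>unif) = (\<integral>t. indicator {0..1/2} t * g t + indicator {1/2..1} t * g t \<partial>unif)"
  proof (intro integral_cong_AE)
    show "AE t in unif. g t = indicator {0..1/2} t * g t + indicator {1/2..1} t * g t"
      using AE_unif AE_unif_neq[of "1/2"] by eventually_elim (auto split: split_indicator)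
  qed auto
  also have "\<dots> = (\<integral>t. indicator {0..1/2} t * g t \<partial>unif) + (\<integral>t. indicator {1/2..1} t * g t \<partial>unif)"
    using bd B by (intro Bochner_Integration.integral_add integrable_unif_bounded[of _ B]) (auto split: split_indicator)
  also have "\<dots> = (\<integral>t. g (t / 2) / 2 \<partial>unif) + (\<integral>t. g ((1 + t) / 2) / 2 \<partial>unif)"
    by (subst (1 2) integral_unif_subinterval) (auto simp: add_divide_distrib mult.commute)
  finally show ?thesis .
qed

text \<open>For y > 0 the uniform laws on [0, y] and [0, l y] have total variation distance 1 - l,
  whatever the regularity of \<open>h\<close>. Concretely, the part of the first integral over u < l
  equals l times the second integral, and the remaining part has mass 1 - l.\<close>

lemma integral_unif_scale_diff:
  fixes h :: "real \<Rightarrow> real"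
  assumes [measurable]: "h \<in> borel_measurable borel" and bd: "\<And>x. \<bar>h x\<bar> \<le> 1" and l: "0 \<le> l" "l \<le> 1"
  shows "\<bar>(\<integral>u. h (u * y) \<partial>unif) - (\<integral>u. h (u * (l * y)) \<partial>unif)\<bar> \<le> 2 * (1 - l)"
proof -
  have bI: "\<bar>\<integral>u. f u \<partial>unif\<bar> \<le> 1" if "\<And>u. \<bar>f u\<bar> \<le> 1" "f \<in> borel_measurable borel" for f :: "real \<Rightarrow> real"
    using unif.integral_le_const[of f 1] unif.integral_ge_const[of f "-1"] integrable_unif_bounded[of f 1] that
    by (auto simp: abs_le_iff minus_le_iff)
  consider "l = 0" | "0 < l" "l < 1" | "l = 1" using l by linarith
  then show ?thesis
  proof cases
    case 1
    then show ?thesis using bI[of "\<lambda>u. h (u * y)"] bI[of "\<lambda>u. h 0"] bd by auto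
  next
    case 2
    have m: "measure unif {l..1} = 1 - l"
      unfolding unif_def using 2 by (subst measure_uniform_measure) (auto simp: Int_absorb1)
    have "(\<integral>u. h (u * y) \<partial>unif) = (\<integral>u. indicator {0..l} u * h (u * y) + indicator {l..1} u * h (u * y) \<partial>unif)"
    proof (intro integral_cong_AE)
      show "AE u in unif. h (u * y) = indicator {0..l} u * h (u * y) + indicator {l..1} u * h (u * y)"
        using AE_unif AE_unif_neq[of l] by eventually_elim (auto split: split_indicator)
    qed auto
    also have "\<dots> = (\<integral>u. indicator {0..l} u * h (u * y) \<partial>unif) + (\<integral>u. indicator {l..1} u * h (u * y) \<partial>unif)"
      using bd by (intro Bochner_Integration.integral_add integrable_unif_bounded[of _ 1]) (auto split: split_indicator)
    also have "(\<integral>u. indicator {0..l} u * h (u * y) \<partial>unif) = l * (\<integral>u. h (u * (l * y)) \<partial>unif)"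
      using 2 by (subst integral_unif_subinterval) (auto simp: mult_ac)
    finally have eq: "(\<integral>u. h (u * y) \<partial>unif) - (\<integral>u. h (u * (l * y)) \<partial>unif) =
       (l - 1) * (\<integral>u. h (u * (l * y)) \<partial>unif) + (\<integral>u. indicator {l..1} u * h (u * y) \<partial>unif)"
      by (simp add: algebra_simps)
    have "\<bar>\<integral>u. indicator {l..1} u * h (u * y) \<partial>unif\<bar> \<le> (\<integral>u. \<bar>indicator {l..1} u * h (u * y)\<bar> \<partial>unif)"
      by (rule integral_abs_bound)
    also have "\<dots> \<le> (\<integral>u. indicator {l..1} u \<partial>unif)"
      using bd by (intro integral_mono integrable_unif_bounded[of _ 1]) (auto split: split_indicator)
    also have "\<dots> = 1 - l" using m by simp
    finally have "\<bar>\<integral>u. indicator {l..1} u * h (u * y) \<partial>unif\<bar> \<le> 1 - l" .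
    moreover have "\<bar>(l - 1) * (\<integral>u. h (u * (l * y)) \<partial>unif)\<bar> \<le> (1 - l) * 1"
      using bI[of "\<lambda>u. h (u * (l * y))"] bd 2 unfolding abs_mult by (intro mult_mono) auto
    ultimately show ?thesis unfolding eq by (intro order_trans[OF abs_triangle_ineq]) simp
  next
    case 3
    then show ?thesis by simp
  qed
qed

section \<open>The bias of an oscillatory integral\<close>

lemma AE_root: "AE \<xi> in trees. 0 < root \<xi> \<and> root \<xi> < 1"
  using AE_trees_interior by eventually_elim (auto simp: root_def)

lemma emeasure_root_less:
  assumes "0 \<le> \<eta>"
  shows "emeasure trees {\<xi>. root \<xi> < \<eta>} \<le> ennreal \<eta>" "emeasure trees {\<xi>. 1 - root \<xi> < \<eta>} \<le> ennreal \<eta>"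
proof -
  have *: "emeasure trees {\<xi>. P (root \<xi>)} = emeasure unif {c. P c}" if [measurable]: "Measurable.pred borel P" for P
  proof -
    have [measurable]: "{c. P c} \<in> sets borel" "{c. P c} \<in> sets unif" using that by auto
    have "{\<xi>\<in>space trees. P (root \<xi>)} \<in> sets trees" by measurable
    then have "{\<xi>. P (root \<xi>)} \<in> sets trees" by simp
    have "emeasure trees {\<xi>. P (root \<xi>)} = (\<integral>\<^sup>+\<xi>. indicator {c. P c} (root \<xi>) * 1 \<partial>trees)"
      unfolding nn_integral_indicator[OF \<open>{\<xi>. P (root \<xi>)} \<in> sets trees\<close>, symmetric]
      by (intro nn_integral_cong) (auto split: split_indicator)
    also have "\<dots> = emeasure unif {c. P c} * 1"
      using trees.emeasure_space_1 by (subst nn_integral_trees_root) auto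
    finally show ?thesis by simp
  qed
  have "emeasure unif {c. c < \<eta>} = emeasure unif {0..<\<eta>}"
    by (intro emeasure_eq_AE eventually_mono[OF AE_unif]) auto
  also have "\<dots> \<le> ennreal \<eta>" unfolding unif_def
    using emeasure_mono[of "{0..1} \<inter> {0..<\<eta>}" "{0..<\<eta>}" lborel] assms by (subst emeasure_uniform_measure) (auto simp: divide_ennreal_def)
  finally show "emeasure trees {\<xi>. root \<xi> < \<eta>} \<le> ennreal \<eta>" using *[of "\<lambda>c. c < \<eta>"] by simp
  have "emeasure unif {c. 1 - c < \<eta>} = emeasure unif {1-\<eta><..1}"
    by (intro emeasure_eq_AE eventually_mono[OF AE_unif]) auto
  also have "\<dots> \<le> ennreal \<eta>" unfolding unif_def
    using emeasure_mono[of "{0..1} \<inter> {1-\<eta><..1}" "{1-\<eta><..1}" lborel] assms by (subst emeasure_uniform_measure) (auto simp: divide_ennreal_def)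
  finally show "emeasure trees {\<xi>. 1 - root \<xi> < \<eta>} \<le> ennreal \<eta>" using *[of "\<lambda>c. 1 - c < \<eta>"] by simp
qed

text \<open>Relative error of the truncation as seen from 0, and in \<open>right_ratio\<close> from
  1. The denominator is in both cases the larger of the two distances to the end point, so the ratio
  is the quantity \<open>1 - l\<close> of \<open>integral_unif_scale_diff\<close>.\<close>

definition left_ratio :: "nat \<Rightarrow> (bool list \<Rightarrow> real) \<Rightarrow> real \<Rightarrow> real" where
  "left_ratio r \<xi> t = (phi \<xi> t - lam r \<xi> t) / phi \<xi> t"

definition right_ratio :: "nat \<Rightarrow> (bool list \<Rightarrow> real) \<Rightarrow> real \<Rightarrow> real" where
  "right_ratio r \<xi> t = (phi \<xi> t - lam r \<xi> t) / (1 - lam r \<xi> t)"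

lemma measurable_ratios [measurable (raw)]:
  assumes [measurable]: "f \<in> measurable N trees" "g \<in> borel_measurable N"
  shows "(\<lambda>z. left_ratio r (f z) (g z)) \<in> borel_measurable N" "(\<lambda>z. right_ratio r (f z) (g z)) \<in> borel_measurable N"
  unfolding left_ratio_def right_ratio_def by measurable

lemma ratio_bounds: "0 \<le> left_ratio r \<xi> t" "left_ratio r \<xi> t \<le> 1" "0 \<le> right_ratio r \<xi> t" "right_ratio r \<xi> t \<le> 1"
  using lam_le_phi[of r \<xi> t] phi_bounds[of \<xi> t] lam_bounds[of r \<xi> t]
  by (auto simp: left_ratio_def right_ratio_def divide_le_eq_1)

text \<open>Either \<open>s\<close> is below 2^(-m), an event of probability at most 2^(-m), or the
  quotient is at most 2^m times \<open>len\<close>, whose expectation is 2^(-r). The condition on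
  \<open>r\<close> makes the second part no larger than the first bound.\<close>

lemma nn_integral_ratio_step:
  assumes [measurable]: "g \<in> borel_measurable trees" "s \<in> borel_measurable trees"
    and le: "\<And>\<xi>. 0 < s \<xi> \<Longrightarrow> g \<xi> \<le> len r \<xi> t / s \<xi>" "\<And>\<xi>. g \<xi> \<le> 1"
    and p: "emeasure trees {\<xi>. s \<xi> < (1/2)^m} \<le> ennreal ((1/2)^m)" and r: "r \<ge> 2 * m"
  shows "(\<integral>\<^sup>+\<xi>. ennreal (g \<xi>) \<partial>trees) \<le> ennreal (2 * (1/2)^m)"
proof -
  have "{\<xi>\<in>space trees. s \<xi> < (1/2)^m} \<in> sets trees" by measurable
  then have [measurable]: "{\<xi>. s \<xi> < (1/2)^m} \<in> sets trees" by simp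
  have "(\<integral>\<^sup>+\<xi>. ennreal (g \<xi>) \<partial>trees) \<le> (\<integral>\<^sup>+\<xi>. indicator {\<xi>. s \<xi> < (1/2)^m} \<xi> + ennreal (2^m) * ennreal (len r \<xi> t) \<partial>trees)"
  proof (intro nn_integral_mono)
    fix \<xi>
    show "ennreal (g \<xi>) \<le> indicator {\<xi>. s \<xi> < (1/2)^m} \<xi> + ennreal (2^m) * ennreal (len r \<xi> t)"
    proof (cases "s \<xi> < (1/2)^m")
      case True
      have "ennreal (g \<xi>) \<le> 1" using le(2) by simp
      also have "\<dots> \<le> indicator {\<xi>. s \<xi> < (1/2)^m} \<xi> + ennreal (2^m) * ennreal (len r \<xi> t)"
        using True by simp
      finally show ?thesis .
    next
      case False
      then have "0 < s \<xi>" using zero_less_power[of "1/2::real" m] by linarith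
      then have "g \<xi> \<le> len r \<xi> t / s \<xi>" by (rule le)
      also have "\<dots> \<le> len r \<xi> t / (1/2)^m"
        using False len_bounds \<open>0 < s \<xi>\<close> by (intro divide_left_mono) auto
      also have "\<dots> = 2^m * len r \<xi> t" by (simp add: power_divide)
      finally show ?thesis using False by (simp add: ennreal_mult [symmetric] len_bounds ennreal_leI)
    qed
  qed
  also have "\<dots> = emeasure trees {\<xi>. s \<xi> < (1/2)^m} + ennreal (2^m) * ennreal ((1/2)^r)"
    by (subst nn_integral_add) (simp_all add: nn_integral_cmult nn_integral_len)
  finally have "(\<integral>\<^sup>+\<xi>. ennreal (g \<xi>) \<partial>trees) \<le> emeasure trees {\<xi>. s \<xi> < (1/2)^m} + ennreal (2^m) * ennreal ((1/2)^r)" .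
  moreover have "ennreal (2^m) * ennreal ((1/2)^r) \<le> ennreal ((1/2)^m)"
  proof -
    have "2^m * (1/2::real)^r \<le> 2^m * (1/2)^(2*m)" using r by (intro mult_left_mono power_decreasing) auto
    also have "\<dots> = (1/2)^m" by (simp add: power_divide mult_2 power_add)
    finally show ?thesis by (simp add: ennreal_mult [symmetric] ennreal_leI)
  qed
  ultimately have "(\<integral>\<^sup>+\<xi>. ennreal (g \<xi>) \<partial>trees) \<le> emeasure trees {\<xi>. s \<xi> < (1/2)^m} + ennreal ((1/2)^m)"
    by (meson add_left_mono order_trans)
  also have "\<dots> \<le> ennreal ((1/2)^m) + ennreal ((1/2)^m)" using p by (rule add_right_mono)
  also have "\<dots> = ennreal (2 * (1/2)^m)" by (subst ennreal_plus [symmetric]) auto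
  finally show ?thesis .
qed

lemma nn_integral_subtree:
  assumes [measurable]: "g \<in> borel_measurable trees"
  shows "(\<integral>\<^sup>+\<xi>. g (subtree b \<xi>) \<partial>trees) = (\<integral>\<^sup>+\<xi>. g \<xi> \<partial>trees)"
  using nn_integral_trees_root[of "\<lambda>_. 1" g b] unif.emeasure_space_1 by simp

text \<open>On the left half the root cancels from the quotient: the problem moves to the subtree
  with \<open>t\<close> doubled and one level fewer. Within \<open>j\<close> such steps
  \<open>t\<close> reaches 1/2, where \<open>phi\<close> is at least the root and
  \<open>nn_integral_ratio_step\<close> applies with the remaining 2 m levels.\<close>

lemma nn_integral_left_ratio:
  assumes "t \<ge> (1/2)^j" "r \<ge> 2 * m + j"
  shows "(\<integral>\<^sup>+\<xi>. ennreal (left_ratio r \<xi> t) \<partial>trees) \<le> ennreal (2 * (1/2)^m)"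
  using assms
proof (induction j arbitrary: r t)
  case 0
  have "phi \<xi> t - lam r \<xi> t = 0" for \<xi> using 0 by (simp add: phi_eq_1 lam_eq_1)
  then show ?case by (simp add: left_ratio_def)
next
  case (Suc j)
  show ?case
  proof (cases "t < 1/2")
    case True
    obtain r' where r': "r = Suc r'" using Suc.prems by (cases r) auto
    have "(\<integral>\<^sup>+\<xi>. ennreal (left_ratio r \<xi> t) \<partial>trees) = (\<integral>\<^sup>+\<xi>. ennreal (left_ratio r' (subtree False \<xi>) (2*t)) \<partial>trees)"
    proof (intro nn_integral_cong_AE)
      show "AE \<xi> in trees. ennreal (left_ratio r \<xi> t) = ennreal (left_ratio r' (subtree False \<xi>) (2*t))"
        using AE_root
      proof eventually_elim
        case (elim \<xi>)
        have "phi \<xi> t = root \<xi> * phi (subtree False \<xi>) (2*t)" using True by (rule phi_less_half)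
        moreover have "phi \<xi> t - lam r \<xi> t = root \<xi> * (phi (subtree False \<xi>) (2*t) - lam r' (subtree False \<xi>) (2*t))"
          using True by (simp add: r' phi_less_half algebra_simps)
        ultimately show ?case using elim by (simp add: left_ratio_def)
      qed
    qed
    also have "\<dots> = (\<integral>\<^sup>+\<xi>. ennreal (left_ratio r' \<xi> (2*t)) \<partial>trees)"
      by (subst nn_integral_subtree[where g = "\<lambda>\<xi>. ennreal (left_ratio r' \<xi> (2*t))"]) auto
    also have "\<dots> \<le> ennreal (2 * (1/2)^m)" using Suc r' by (intro Suc.IH) auto
    finally show ?thesis .
  next
    case False
    show ?thesis
    proof (rule nn_integral_ratio_step[where s = root and r = r and t = t])
      fix \<xi> assume r: "0 < root \<xi>"
      have "root \<xi> \<le> phi \<xi> t" using False phi_bounds by (simp add: phi_ge_half)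
      then show "left_ratio r \<xi> t \<le> len r \<xi> t / root \<xi>"
        unfolding left_ratio_def using r phi_le_lam_len[of \<xi> t r] len_bounds[of r \<xi> t] by (intro frac_le) auto
    qed (use Suc.prems ratio_bounds emeasure_root_less in auto)
  qed
qed

text \<open>Mirror image at the end point 1: on the right half the factor 1 - root cancels, and on
  the left half 1 - lam is at least 1 - root.\<close>

lemma nn_integral_right_ratio:
  assumes "t \<le> 1 - (1/2)^j" "r \<ge> 2 * m + j"
  shows "(\<integral>\<^sup>+\<xi>. ennreal (right_ratio r \<xi> t) \<partial>trees) \<le> ennreal (2 * (1/2)^m)"
  using assms
proof (induction j arbitrary: r t)
  case 0
  have "phi \<xi> t - lam r \<xi> t = 0" for \<xi> using 0 by (simp add: phi_eq_0 lam_eq_0)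
  then show ?case by (simp add: right_ratio_def)
next
  case (Suc j)
  obtain r' where r': "r = Suc r'" using Suc.prems by (cases r) auto
  show ?case
  proof (cases "t < 1/2")
    case False
    have "(\<integral>\<^sup>+\<xi>. ennreal (right_ratio r \<xi> t) \<partial>trees) = (\<integral>\<^sup>+\<xi>. ennreal (right_ratio r' (subtree True \<xi>) (2*t-1)) \<partial>trees)"
    proof (intro nn_integral_cong_AE)
      show "AE \<xi> in trees. ennreal (right_ratio r \<xi> t) = ennreal (right_ratio r' (subtree True \<xi>) (2*t-1))"
        using AE_root
      proof eventually_elim
        case (elim \<xi>)
        have "1 - lam r \<xi> t = (1 - root \<xi>) * (1 - lam r' (subtree True \<xi>) (2*t-1))"
          using False by (simp add: r' algebra_simps)
        moreover have "phi \<xi> t - lam r \<xi> t = (1 - root \<xi>) * (phi (subtree True \<xi>) (2*t-1) - lam r' (subtree True \<xi>) (2*t-1))"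
          using False by (simp add: r' phi_ge_half algebra_simps)
        ultimately show ?case using elim by (simp add: right_ratio_def)
      qed
    qed
    also have "\<dots> = (\<integral>\<^sup>+\<xi>. ennreal (right_ratio r' \<xi> (2*t-1)) \<partial>trees)"
      by (subst nn_integral_subtree[where g = "\<lambda>\<xi>. ennreal (right_ratio r' \<xi> (2*t-1))"]) auto
    also have "\<dots> \<le> ennreal (2 * (1/2)^m)" using Suc r' by (intro Suc.IH) auto
    finally show ?thesis .
  next
    case True
    show ?thesis
    proof (rule nn_integral_ratio_step[where s = "\<lambda>\<xi>. 1 - root \<xi>" and r = r and t = t])
      fix \<xi> assume r: "0 < 1 - root \<xi>"
      have "lam r \<xi> t \<le> root \<xi>" using True r' lam_bounds by (simp add: mult_left_le)
      then show "right_ratio r \<xi> t \<le> len r \<xi> t / (1 - root \<xi>)"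
        unfolding right_ratio_def using r phi_le_lam_len[of \<xi> t r] len_bounds[of r \<xi> t] by (intro frac_le) auto
    qed (use Suc.prems ratio_bounds emeasure_root_less in auto)
  qed
qed


lemma nn_integral_trees_fst:
  assumes [measurable]: "g \<in> borel_measurable trees"
  shows "(\<integral>\<^sup>+z. g (if b then snd z else fst z) \<partial>(trees \<Otimes>\<^sub>M trees)) = (\<integral>\<^sup>+x. g x \<partial>trees)"
  using trees.emeasure_space_1
  by (cases b) (simp_all add: trees.nn_integral_fst [symmetric])

text \<open>Used with the root average of \<open>F\<close> controlled by a ratio of a single
  subtree, which \<open>b\<close> selects.\<close>

lemma abs_integral_trees_le:
  fixes F :: "(bool list \<Rightarrow> real) \<Rightarrow> real"
  assumes F: "F \<in> borel_measurable trees" "\<And>\<xi>. \<bar>F \<xi>\<bar> \<le> B"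
    and [measurable]: "G \<in> borel_measurable trees"
    and le: "\<And>x y. \<bar>\<integral>c. F (node c x y) \<partial>unif\<bar> \<le> G (if b then y else x)"
    and G: "(\<integral>\<^sup>+\<xi>. ennreal (G \<xi>) \<partial>trees) \<le> ennreal e" and e: "0 \<le> e"
  shows "\<bar>\<integral>\<xi>. F \<xi> \<partial>trees\<bar> \<le> e"
proof -
  have "\<bar>\<integral>\<xi>. F \<xi> \<partial>trees\<bar> \<le> (\<integral>z. \<bar>\<integral>c. F (node c (fst z) (snd z)) \<partial>unif\<bar> \<partial>(trees \<Otimes>\<^sub>M trees))"
    unfolding integral_trees[OF F] by (rule integral_abs_bound)
  also have "\<dots> \<le> e"
  proof (rule integral_real_bounded[OF e])
    have "(\<integral>\<^sup>+z. ennreal \<bar>\<integral>c. F (node c (fst z) (snd z)) \<partial>unif\<bar> \<partial>(trees \<Otimes>\<^sub>M trees))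
      \<le> (\<integral>\<^sup>+z. ennreal (G (if b then snd z else fst z)) \<partial>(trees \<Otimes>\<^sub>M trees))"
      by (intro nn_integral_mono ennreal_leI le)
    also have "\<dots> = (\<integral>\<^sup>+\<xi>. ennreal (G \<xi>) \<partial>trees)"
      by (rule nn_integral_trees_fst) measurable
    finally show "(\<integral>\<^sup>+z. ennreal \<bar>\<integral>c. F (node c (fst z) (snd z)) \<partial>unif\<bar> \<partial>(trees \<Otimes>\<^sub>M trees)) \<le> ennreal e"
      using G by (rule order_trans)
  qed
  finally show ?thesis .
qed

lemma root_node: "0 < c \<Longrightarrow> c < 1 \<Longrightarrow> root (node c x y) = c"
  by (simp add: root_def)

text \<open>Conditionally on the two subtrees, the value at a point is a uniformly distributed multiple of
  a given number (seen from the end point \<^term>\<open>0\<close> or \<^term>\<open>1\<close>), so averaging over the root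
  smoothes \<^term>\<open>h\<close>.\<close>

lemma expectation_phi_lam:
  fixes h :: "real \<Rightarrow> real"
  assumes [measurable]: "h \<in> borel_measurable borel" and bd: "\<And>x. \<bar>h x\<bar> \<le> 1"
    and t: "(1/2)^m \<le> t" "t \<le> 1 - (1/2)^m" and r: "r \<ge> 3 * m"
  shows "\<bar>(\<integral>\<xi>. h (phi \<xi> t) - h (lam r \<xi> t) \<partial>trees)\<bar> \<le> 4 * (1/2)^m"
proof -
  obtain j where j: "m = Suc j" using t by (cases m) auto
  obtain r' where r': "r = Suc r'" using r j by (cases r) auto
  have m: "(\<lambda>\<xi>. h (phi \<xi> t) - h (lam r \<xi> t)) \<in> borel_measurable trees" by measurable
  have b2: "\<bar>h x - h y\<bar> \<le> 2" for x y using bd[of x] bd[of y] by linarith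
  have two: "(\<integral>\<^sup>+\<xi>. ennreal (2 * g \<xi>) \<partial>trees) \<le> ennreal (4 * (1/2)^m)"
    if [measurable]: "g \<in> borel_measurable trees" and "(\<integral>\<^sup>+\<xi>. ennreal (g \<xi>) \<partial>trees) \<le> ennreal (2 * (1/2)^m)"
      "\<And>\<xi>. 0 \<le> g \<xi>" for g
  proof -
    have "(\<integral>\<^sup>+\<xi>. ennreal (2 * g \<xi>) \<partial>trees) = ennreal 2 * (\<integral>\<^sup>+\<xi>. ennreal (g \<xi>) \<partial>trees)"
      using that by (simp add: ennreal_mult nn_integral_cmult)
    also have "\<dots> \<le> ennreal 2 * ennreal (2 * (1/2)^m)" using that by (intro mult_left_mono) auto
    also have "\<dots> = ennreal (4 * (1/2)^m)" by (subst ennreal_mult [symmetric]) auto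
    finally show ?thesis .
  qed
  show ?thesis
  proof (cases "t < 1/2")
    case True
    have le: "\<bar>\<integral>c. h (phi (node c x y) t) - h (lam r (node c x y) t) \<partial>unif\<bar> \<le> 2 * left_ratio r' x (2*t)" for x y
    proof -
      define z z' where "z = phi x (2*t)" and "z' = lam r' x (2*t)"
      \<comment> \<open>If z vanishes then so does z', and the value 1 fits
        \<open>left_ratio\<close>, which is then 0 by division by zero.\<close>
      define l where "l = (if z = 0 then 1 else z' / z)"
      have z: "0 \<le> z'" "z' \<le> z" by (auto simp: z_def z'_def lam_bounds lam_le_phi)
      have l: "0 \<le> l" "l \<le> 1" "z' = l * z" "1 - l = left_ratio r' x (2*t)"
        using z unfolding left_ratio_def z_def[symmetric] z'_def[symmetric]
        by (auto simp: l_def divide_le_eq_1 diff_divide_distrib)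
      have "(\<integral>c. h (phi (node c x y) t) - h (lam r (node c x y) t) \<partial>unif) = (\<integral>c. h (c * z) - h (c * (l * z)) \<partial>unif)"
      proof (intro integral_cong_AE)
        show "AE c in unif. h (phi (node c x y) t) - h (lam r (node c x y) t) = h (c * z) - h (c * (l * z))"
          using AE_unif
          by (rule eventually_mono) (use True l(3) in \<open>simp add: phi_less_half r' root_node z_def z'_def\<close>)
      qed (unfold measurable_unif, measurable)
      also have "\<dots> = (\<integral>c. h (c * z) \<partial>unif) - (\<integral>c. h (c * (l * z)) \<partial>unif)"
        using bd by (intro Bochner_Integration.integral_diff integrable_unif_bounded[of _ 1]) auto
      finally show ?thesis using integral_unif_scale_diff[OF assms(1) bd l(1,2), of z] l(4) by simp
    qed
    show ?thesis
    proof (rule abs_integral_trees_le[where b = False and G = "\<lambda>x. 2 * left_ratio r' x (2*t)" and B = 2])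
      show "(\<integral>\<^sup>+\<xi>. ennreal (2 * left_ratio r' \<xi> (2*t)) \<partial>trees) \<le> ennreal (4 * (1/2)^m)"
        \<comment> \<open>Passing to the half leaves 3 m - 1 = 2 m + j levels, since m = j +
          1.\<close>
        using t r j r' by (intro two nn_integral_left_ratio[where j = j] ratio_bounds) auto
    qed (use b2 le m in auto)
  next
    case False
    have le: "\<bar>\<integral>c. h (phi (node c x y) t) - h (lam r (node c x y) t) \<partial>unif\<bar> \<le> 2 * right_ratio r' y (2*t-1)" for x y
    proof -
      define z z' where "z = 1 - phi y (2*t-1)" and "z' = 1 - lam r' y (2*t-1)"
      define l where "l = (if z' = 0 then 1 else z / z')"
      have z: "0 \<le> z" "z \<le> z'" by (auto simp: z_def z'_def phi_bounds lam_le_phi)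
      have "right_ratio r' y (2*t-1) = (z' - z) / z'" by (simp add: right_ratio_def z_def z'_def)
      then have l: "0 \<le> l" "l \<le> 1" "z = l * z'" "1 - l = right_ratio r' y (2*t-1)"
        using z by (auto simp: l_def divide_le_eq_1 diff_divide_distrib)
      have p: "phi y (2*t-1) = 1 - l * z'" "lam r' y (2*t-1) = 1 - z'"
        using l(3) by (auto simp: z_def z'_def)
      \<comment> \<open>Distances to 1 are multiplied by 1 - c, so after reflecting the uniform
        variable the right half has the form of the left one.\<close>
      have a: "c + (1 - c) * (1 - v) = 1 - (1 - c) * v" for c v :: real by (simp add: algebra_simps)
      have "(\<integral>c. h (phi (node c x y) t) - h (lam r (node c x y) t) \<partial>unif)
        = (\<integral>c. h (1 - (1 - c) * (l * z')) - h (1 - (1 - c) * z') \<partial>unif)"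
      proof (intro integral_cong_AE)
        show "AE c in unif. h (phi (node c x y) t) - h (lam r (node c x y) t)
            = h (1 - (1 - c) * (l * z')) - h (1 - (1 - c) * z')"
          using AE_unif
          by (rule eventually_mono) (use False in \<open>simp add: phi_ge_half r' root_node p a\<close>)
      qed (unfold measurable_unif, measurable)
      also have "\<dots> = (\<integral>u. h (1 - u * (l * z')) - h (1 - u * z') \<partial>unif)"
        by (rule integral_unif_reflect[where g = "\<lambda>u. h (1 - u * (l * z')) - h (1 - u * z')"]) measurable
      also have "\<dots> = (\<integral>u. h (1 - u * (l * z')) \<partial>unif) - (\<integral>u. h (1 - u * z') \<partial>unif)"
        using bd by (intro Bochner_Integration.integral_diff integrable_unif_bounded[of _ 1]) auto
      finally show ?thesis using integral_unif_scale_diff[of "\<lambda>x. h (1 - x)", OF _ bd l(1,2), of z'] l(4)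
        by (simp add: abs_minus_commute)
    qed
    show ?thesis
    proof (rule abs_integral_trees_le[where b = True and G = "\<lambda>y. 2 * right_ratio r' y (2*t-1)" and B = 2])
      show "(\<integral>\<^sup>+\<xi>. ennreal (2 * right_ratio r' \<xi> (2*t-1)) \<partial>trees) \<le> ennreal (4 * (1/2)^m)"
        using t r j r' by (intro two nn_integral_right_ratio[where j = j] ratio_bounds) auto
    qed (use b2 le m in auto)
  qed
qed

text \<open>The weight \<^term>\<open>w\<close> on the \<^term>\<open>c\<close>-th dyadic interval of length \<^term>\<open>(1/2)^d\<close>, rescaled to the unit
  interval so that integrals are preserved.\<close>

definition cell :: "nat \<Rightarrow> nat \<Rightarrow> (real \<Rightarrow> real) \<Rightarrow> real \<Rightarrow> real" where
  "cell d c w t = w ((real c + t) / 2^d) / 2^d"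

lemma measurable_cell [measurable (raw)]:
  assumes [measurable]: "w \<in> borel_measurable borel"
  shows "cell d c w \<in> borel_measurable borel"
  unfolding cell_def[abs_def] by measurable

lemma cell_0 [simp]: "cell 0 0 w = w"
  by (simp add: cell_def fun_eq_iff)

lemma cell_left: "cell d c (\<lambda>t. w (t / 2) / 2) = cell (Suc d) c w"
  by (simp add: cell_def fun_eq_iff field_simps)

lemma cell_right: "cell d c (\<lambda>t. w ((1 + t) / 2) / 2) = cell (Suc d) (2^d + c) w"
  by (simp add: cell_def fun_eq_iff field_simps)

lemma sum_lessThan_double:
  fixes f :: "nat \<Rightarrow> 'a :: comm_monoid_add"
  shows "(\<Sum>c<2 * n. f c) = (\<Sum>c<n. f c) + (\<Sum>c<n. f (n + c))"
proof -
  have "(\<Sum>c<2 * n. f c) = sum f {0..<n} + sum f {0 + n..<n + n}"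
    by (simp add: lessThan_atLeast0 sum.atLeastLessThan_concat mult_2)
  then show ?thesis
    unfolding sum.shift_bounds_nat_ivl by (simp add: lessThan_atLeast0 add.commute)
qed

lemma integral_unif_cells:
  fixes g :: "real \<Rightarrow> real"
  assumes "g \<in> borel_measurable borel" and "\<And>t. \<bar>g t\<bar> \<le> B"
  shows "(\<integral>t. g t \<partial>unif) = (\<Sum>c<2^d. \<integral>t. cell d c g t \<partial>unif)"
  using assms
proof (induction d arbitrary: g B)
  case 0
  have "{..<1::nat} = {0}" by auto
  then show ?case by simp
next
  case (Suc d)
  note [measurable] = Suc.prems(1)
  have B: "\<bar>g t / 2\<bar> \<le> B / 2" for t using Suc.prems(2)[of t] by simp
  have "(\<integral>t. g t \<partial>unif) = (\<integral>t. g (t / 2) / 2 \<partial>unif) + (\<integral>t. g ((1 + t) / 2) / 2 \<partial>unif)"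
    by (rule integral_unif_halves[OF Suc.prems])
  also have "(\<integral>t. g (t / 2) / 2 \<partial>unif) = (\<Sum>c<2^d. \<integral>t. cell (Suc d) c g t \<partial>unif)"
    by (subst Suc.IH[of _ "B / 2"]) (use B in \<open>auto simp: cell_left\<close>)
  also have "(\<integral>t. g ((1 + t) / 2) / 2 \<partial>unif) = (\<Sum>c<2^d. \<integral>t. cell (Suc d) (2^d + c) g t \<partial>unif)"
    by (subst Suc.IH[of _ "B / 2"]) (use B in \<open>auto simp: cell_right\<close>)
  finally show ?case by (simp add: sum_lessThan_double)
qed

lemma lam_cell:
  assumes "c < 2^r" "0 \<le> s" "s < 1"
  shows "lam r \<xi> ((real c + s) / 2^r) = lam r \<xi> (real c / 2^r)"
  using assms(1)
proof (induction r arbitrary: c \<xi>)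
  case (Suc r)
  show ?case
  proof (cases "c < 2^r")
    case True
    have "real c + 1 \<le> 2^r" using True by (metis Suc_leI of_nat_Suc of_nat_le_iff of_nat_numeral of_nat_power add.commute)
    then have "real c + s < 2^r" using assms by linarith
    then have "(real c + s) / 2^Suc r < 1/2" "real c / 2^Suc r < 1/2"
      using assms True by (auto simp: field_simps)
    moreover have "2 * ((real c + s) / 2^Suc r) = (real c + s) / 2^r" "2 * (real c / 2^Suc r) = real c / 2^r"
      by (auto simp: field_simps)
    ultimately show ?thesis using Suc.IH[OF True] by simp
  next
    case False
    define c' where "c' = c - 2^r"
    have c: "real c = 2^r + real c'" "c' < 2^r" using False Suc.prems by (auto simp: c'_def of_nat_diff)
    have "\<not> (real c + s) / 2^Suc r < 1/2" "\<not> real c / 2^Suc r < 1/2"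
      using assms c by (auto simp: field_simps)
    moreover have "2 * ((real c + s) / 2^Suc r) - 1 = (real c' + s) / 2^r" "2 * (real c / 2^Suc r) - 1 = real c' / 2^r"
      using c by (auto simp: field_simps)
    ultimately show ?thesis using Suc.IH[OF c(2)] by simp
  qed
qed (use assms in auto)


interpretation tree_unif: pair_prob_space trees unif ..

lemma integrable_trees_bounded:
  fixes f :: "(bool list \<Rightarrow> real) \<Rightarrow> real"
  assumes "f \<in> borel_measurable trees" "\<And>t. \<bar>f t\<bar> \<le> B"
  shows "integrable trees f"
  using assms by (intro trees.integrable_const_bound[of _ B]) auto

lemma abs_expectation_le:
  fixes f :: "(bool list \<Rightarrow> real) \<Rightarrow> real"
  assumes "f \<in> borel_measurable trees" "\<And>t. \<bar>f t\<bar> \<le> B"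
  shows "\<bar>\<integral>\<xi>. f \<xi> \<partial>trees\<bar> \<le> B"
  using trees.integral_le_const[of f B] trees.integral_ge_const[of f "-B"] integrable_trees_bounded[of f B] assms
  by (auto simp: abs_le_iff minus_le_iff)

lemma abs_integral_unif_le:
  fixes f :: "real \<Rightarrow> real"
  assumes "f \<in> borel_measurable borel" "\<And>t. \<bar>f t\<bar> \<le> B"
  shows "\<bar>\<integral>t. f t \<partial>unif\<bar> \<le> B"
  using unif.integral_le_const[of f B] unif.integral_ge_const[of f "-B"] integrable_unif_bounded[of f B] assms
  by (auto simp: abs_le_iff minus_le_iff)

lemma measure_unif_Icc: "0 \<le> a \<Longrightarrow> a \<le> b \<Longrightarrow> b \<le> 1 \<Longrightarrow> measure unif {a..b} = b - a"
  unfolding unif_def by (subst measure_uniform_measure) (auto simp: Int_absorb1)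

text \<open>By Fubini \<open>h (phi \<xi> t)\<close> may be replaced by its expectation H, and H by
  the truncated L, which is constant on cells of level 3 m and so meets \<open>w\<close> only
  through its cell integrals. The difference H - L is at most 4 * 2^(-m) in the middle, and at most
  2 on two end intervals of length 2^(-m); together this costs 8 S 2^(-m).\<close>

lemma bias_bound:
  fixes h w :: "real \<Rightarrow> real"
  assumes h [measurable]: "h \<in> borel_measurable borel" and bd: "\<And>x. \<bar>h x\<bar> \<le> 1"
    and w [measurable]: "w \<in> borel_measurable borel" and S: "\<And>t. \<bar>w t\<bar> \<le> S"
  shows "\<bar>\<integral>\<xi>. \<integral>t. w t * h (phi \<xi> t) \<partial>unif \<partial>trees\<bar> \<le> 8 * S * (1/2)^m + (\<Sum>c<2^(3*m). \<bar>\<integral>t. cell (3*m) c w t \<partial>unif\<bar>)"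
proof -
  let ?e = "(1/2::real)^m" and ?r = "3 * m"
  define H where "H t = (\<integral>\<xi>. h (phi \<xi> t) \<partial>trees)" for t
  define L where "L t = (\<integral>\<xi>. h (lam ?r \<xi> t) \<partial>trees)" for t
  have [measurable]: "H \<in> borel_measurable borel" "L \<in> borel_measurable borel"
    unfolding H_def L_def by (rule trees.borel_measurable_lebesgue_integral, measurable)+
  have S0: "0 \<le> S" using S[of 0] by linarith
  have H1: "\<bar>H t\<bar> \<le> 1" "\<bar>L t\<bar> \<le> 1" for t
    unfolding H_def L_def using bd by (intro abs_expectation_le; simp)+
  have wb: "\<bar>w t * x\<bar> \<le> S * y" if "\<bar>x\<bar> \<le> y" for t x y
    unfolding abs_mult using S[of t] that S0 by (intro mult_mono) auto
  have "(\<integral>\<xi>. \<integral>t. w t * h (phi \<xi> t) \<partial>unif \<partial>trees) = (\<integral>t. \<integral>\<xi>. w t * h (phi \<xi> t) \<partial>trees \<partial>unif)"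
  proof (rule tree_unif.Fubini_integral [symmetric])
    have "finite_measure (trees \<Otimes>\<^sub>M unif)" by unfold_locales
    then show "integrable (trees \<Otimes>\<^sub>M unif) (\<lambda>(\<xi>, t). w t * h (phi \<xi> t))"
      using wb[OF bd] by (intro finite_measure.integrable_const_bound[where B = S]) (auto simp: case_prod_unfold)
  qed
  also have "\<dots> = (\<integral>t. w t * H t \<partial>unif)" by (simp add: H_def)
  also have "\<dots> = (\<integral>t. w t * (H t - L t) + w t * L t \<partial>unif)" by (simp add: algebra_simps)
  also have "\<dots> = (\<integral>t. w t * (H t - L t) \<partial>unif) + (\<integral>t. w t * L t \<partial>unif)"
  proof (rule Bochner_Integration.integral_add)
    have "\<bar>H t - L t\<bar> \<le> 2" for t using H1[of t] by linarith
    then show "integrable unif (\<lambda>t. w t * (H t - L t))"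
      by (intro integrable_unif_bounded[where B = "S * 2"] wb) auto
    show "integrable unif (\<lambda>t. w t * L t)"
      by (intro integrable_unif_bounded[where B = "S * 1"] wb H1) auto
  qed
  finally have eq: "(\<integral>\<xi>. \<integral>t. w t * h (phi \<xi> t) \<partial>unif \<partial>trees) = (\<integral>t. w t * (H t - L t) \<partial>unif) + (\<integral>t. w t * L t \<partial>unif)" .
  have "\<bar>\<integral>t. w t * (H t - L t) \<partial>unif\<bar> \<le> (\<integral>t. \<bar>w t * (H t - L t)\<bar> \<partial>unif)" by (rule integral_abs_bound)
  also have "\<dots> \<le> (\<integral>t. S * (4 * ?e) + (2 * S * indicator {0..?e} t + 2 * S * indicator {1-?e..1} t) \<partial>unif)"
  proof (intro integral_mono_AE)
    have "\<bar>H t - L t\<bar> \<le> 2" for t using H1[of t] by linarith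
    then have b: "\<bar>w t * (H t - L t)\<bar> \<le> S * 2" for t by (rule wb)
    then show "integrable unif (\<lambda>t. \<bar>w t * (H t - L t)\<bar>)"
      by (intro integrable_unif_bounded[where B = "S * 2"]) auto
    show "integrable unif (\<lambda>t. S * (4 * ?e) + (2 * S * indicator {0..?e} t + 2 * S * indicator {1-?e..1} t))"
      by (intro Bochner_Integration.integrable_add integrable_mult_right integrable_real_indicator) (auto simp: unif.emeasure_eq_measure)
    show "AE t in unif. \<bar>w t * (H t - L t)\<bar> \<le> S * (4 * ?e) + (2 * S * indicator {0..?e} t + 2 * S * indicator {1-?e..1} t)"
    proof (rule eventually_mono[OF AE_unif])
      fix t :: real assume t: "0 < t \<and> t < 1"
      show "\<bar>w t * (H t - L t)\<bar> \<le> S * (4 * ?e) + (2 * S * indicator {0..?e} t + 2 * S * indicator {1-?e..1} t)"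
      proof (cases "?e \<le> t \<and> t \<le> 1 - ?e")
        case True
        have "H t - L t = (\<integral>\<xi>. h (phi \<xi> t) - h (lam ?r \<xi> t) \<partial>trees)"
          unfolding H_def L_def using bd
          by (intro Bochner_Integration.integral_diff [symmetric] integrable_trees_bounded[where B = 1]) auto
        then have "\<bar>H t - L t\<bar> \<le> 4 * ?e"
          using expectation_phi_lam[OF h bd, of m t ?r] True by simp
        then have "\<bar>w t * (H t - L t)\<bar> \<le> S * (4 * ?e)" by (rule wb)
        then show ?thesis using S0 by (auto split: split_indicator)
      next
        case False
        then have "2 * S \<le> 2 * S * indicator {0..?e} t + 2 * S * indicator {1-?e..1} t"
          using t S0 by (auto split: split_indicator)
        moreover have "0 \<le> S * (4 * ?e)" using S0 by simp
        ultimately show ?thesis using b[of t] by linarith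
      qed
    qed
  qed
  also have "\<dots> = S * (4 * ?e) + (2 * S * ?e + 2 * S * ?e)"
    using unif.prob_space[simplified] power_le_one[of "1/2::real" m]
    by (subst Bochner_Integration.integral_add, simp, force simp: unif.emeasure_eq_measure,
        subst Bochner_Integration.integral_add) (auto simp: unif.emeasure_eq_measure measure_unif_Icc)
  finally have 1: "\<bar>\<integral>t. w t * (H t - L t) \<partial>unif\<bar> \<le> 8 * S * ?e" by simp
  have "(\<integral>t. w t * L t \<partial>unif) = (\<Sum>c<2^?r. \<integral>t. cell ?r c (\<lambda>t. w t * L t) t \<partial>unif)"
    using wb[OF H1(2)] by (intro integral_unif_cells[where B = "S * 1"]) auto
  also have "\<dots> = (\<Sum>c<2^?r. L (real c / 2^?r) * (\<integral>t. cell ?r c w t \<partial>unif))"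
  proof (intro sum.cong refl)
    fix c :: nat assume c: "c \<in> {..<2^?r}"
    have "(\<integral>t. cell ?r c (\<lambda>t. w t * L t) t \<partial>unif) = (\<integral>t. L (real c / 2^?r) * cell ?r c w t \<partial>unif)"
    proof (intro integral_cong_AE)
      show "AE t in unif. cell ?r c (\<lambda>t. w t * L t) t = L (real c / 2^?r) * cell ?r c w t"
      proof (rule eventually_mono[OF AE_unif])
        fix t :: real assume t: "0 < t \<and> t < 1"
        have "L ((real c + t) / 2^?r) = L (real c / 2^?r)"
          unfolding L_def using lam_cell[of c ?r t] c t by simp
        then show "cell ?r c (\<lambda>t. w t * L t) t = L (real c / 2^?r) * cell ?r c w t"
          by (simp add: cell_def)
      qed
    qed (unfold measurable_unif, measurable)
    then show "(\<integral>t. cell ?r c (\<lambda>t. w t * L t) t \<partial>unif) = L (real c / 2^?r) * (\<integral>t. cell ?r c w t \<partial>unif)"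
      by simp
  qed
  finally have e: "(\<integral>t. w t * L t \<partial>unif) = (\<Sum>c<2^?r. L (real c / 2^?r) * (\<integral>t. cell ?r c w t \<partial>unif))" .
  have "\<bar>\<integral>t. w t * L t \<partial>unif\<bar> \<le> (\<Sum>c<2^?r. \<bar>L (real c / 2^?r) * (\<integral>t. cell ?r c w t \<partial>unif)\<bar>)"
    unfolding e by (rule sum_abs)
  also have "\<dots> \<le> (\<Sum>c<2^?r. \<bar>\<integral>t. cell ?r c w t \<partial>unif\<bar>)"
    unfolding abs_mult using H1(2) by (intro sum_mono mult_left_le_one_le) auto
  finally show ?thesis unfolding eq using 1 by linarith
qed

section \<open>Subgaussian concentration\<close>

text \<open>\<open>B\<close> bounds the mean and \<open>V\<close> is a variance proxy; both add up
  over cells. The quantifier over all bounded measurable \<open>h\<close> carries the induction, and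
  replaces conditional expectations: restriction to a half turns \<open>h\<close> into its
  composition with an affine map, which belongs to the same class.\<close>

definition subgaussian_weight :: "(real \<Rightarrow> real) \<Rightarrow> real \<Rightarrow> real \<Rightarrow> bool" where
  "subgaussian_weight w B V \<longleftrightarrow>
     (\<forall>h s. h \<in> borel_measurable borel \<longrightarrow> (\<forall>x. \<bar>h x\<bar> \<le> 1) \<longrightarrow> 0 \<le> s \<longrightarrow>
       (\<integral>\<^sup>+\<xi>. ennreal (exp (s * (\<integral>t. w t * h (phi \<xi> t) \<partial>unif))) \<partial>trees) \<le> ennreal (exp (s * B + s\<^sup>2 * V / 2)))"

lemma measurable_weighted_integral [measurable (raw)]:
  fixes w h :: "real \<Rightarrow> real"
  assumes [measurable]: "w \<in> borel_measurable borel" "h \<in> borel_measurable borel" "f \<in> measurable N trees"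
  shows "(\<lambda>z. \<integral>t. w t * h (phi (f z) t) \<partial>unif) \<in> borel_measurable N"
  by (rule unif.borel_measurable_lebesgue_integral) measurable

text \<open>Hoeffding's lemma for a variable with values in [-S, S]: the exponent is s^2 (2 S)^2 / 8
  = s^2 S^2 / 2, to which the mean contributes at most s B.\<close>

lemma subgaussian_weight_base:
  assumes w [measurable]: "w \<in> borel_measurable borel" and S: "\<And>t. \<bar>w t\<bar> \<le> S" "0 < S"
    and B: "\<And>h. h \<in> borel_measurable borel \<Longrightarrow> (\<And>x. \<bar>h x\<bar> \<le> 1) \<Longrightarrow>
       \<bar>\<integral>\<xi>. \<integral>t. w t * h (phi \<xi> t) \<partial>unif \<partial>trees\<bar> \<le> B"
  shows "subgaussian_weight w B (S\<^sup>2)"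
  unfolding subgaussian_weight_def
proof (intro allI impI)
  fix h :: "real \<Rightarrow> real" and s :: real
  assume h [measurable]: "h \<in> borel_measurable borel" and bd: "\<forall>x. \<bar>h x\<bar> \<le> 1" and s: "0 \<le> s"
  define Z where "Z \<xi> = (\<integral>t. w t * h (phi \<xi> t) \<partial>unif)" for \<xi>
  have mZ [measurable]: "Z \<in> borel_measurable trees" unfolding Z_def by measurable
  have "\<bar>w t * h (phi \<xi> t)\<bar> \<le> S * 1" for t \<xi>
    unfolding abs_mult using S bd by (intro mult_mono) auto
  then have Zb: "\<bar>Z \<xi>\<bar> \<le> S" for \<xi>
    unfolding Z_def
    by (intro abs_integral_unif_le) auto
  define \<mu> where "\<mu> = (\<integral>\<xi>. Z \<xi> \<partial>trees)"
  have mu: "\<mu> \<le> B" using B[OF h] bd unfolding \<mu>_def Z_def by (simp add: abs_le_iff)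
  have "- S \<le> Z \<xi>" "Z \<xi> \<le> S" for \<xi> using Zb[of \<xi>] by linarith+
  then interpret I: interval_bounded_random_variable trees Z "-S" S
    by unfold_locales auto
  have "(\<integral>\<^sup>+\<xi>. ennreal (exp (s * (Z \<xi> - \<mu>))) \<partial>trees) \<le> ennreal (exp (s\<^sup>2 * S\<^sup>2 / 2))"
  proof (cases "s = 0")
    case True
    then show ?thesis using trees.emeasure_space_1 by simp
  next
    case False
    then show ?thesis using I.Hoeffdings_lemma_nn_integral[of s] s
      by (simp add: \<mu>_def power2_eq_square mult_ac)
  qed
  then have "ennreal (exp (s * \<mu>)) * (\<integral>\<^sup>+\<xi>. ennreal (exp (s * (Z \<xi> - \<mu>))) \<partial>trees) \<le> ennreal (exp (s * \<mu>)) * ennreal (exp (s\<^sup>2 * S\<^sup>2 / 2))"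
    by (intro mult_left_mono) auto
  also have "\<dots> = ennreal (exp (s * \<mu> + s\<^sup>2 * S\<^sup>2 / 2))" by (simp add: exp_add ennreal_mult)
  also have "\<dots> \<le> ennreal (exp (s * B + s\<^sup>2 * S\<^sup>2 / 2))" using mu s by (intro ennreal_leI) (auto intro: mult_left_mono)
  finally have "ennreal (exp (s * \<mu>)) * (\<integral>\<^sup>+\<xi>. ennreal (exp (s * (Z \<xi> - \<mu>))) \<partial>trees) \<le> ennreal (exp (s * B + s\<^sup>2 * S\<^sup>2 / 2))" .
  moreover have "ennreal (exp (s * \<mu>)) * (\<integral>\<^sup>+\<xi>. ennreal (exp (s * (Z \<xi> - \<mu>))) \<partial>trees) = (\<integral>\<^sup>+\<xi>. ennreal (exp (s * Z \<xi>)) \<partial>trees)"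
    by (subst nn_integral_cmult [symmetric])
      (auto intro!: nn_integral_cong simp: ennreal_mult [symmetric] exp_add [symmetric] right_diff_distrib)
  ultimately show "(\<integral>\<^sup>+\<xi>. ennreal (exp (s * (\<integral>t. w t * h (phi \<xi> t) \<partial>unif))) \<partial>trees) \<le> ennreal (exp (s * B + s\<^sup>2 * S\<^sup>2 / 2))"
    unfolding Z_def by simp
qed

text \<open>Given the root value c, the two halves depend on separate subtrees and the exponential
  moment factors. Each factor concerns \<open>h\<close> composed with x -> c x or x -> c + (1 - c)
  x, so its bound does not depend on c and survives the integration over c.\<close>

lemma subgaussian_weight_step:
  assumes w [measurable]: "w \<in> borel_measurable borel" and S: "\<And>t. \<bar>w t\<bar> \<le> S"
    and L: "subgaussian_weight (\<lambda>t. w (t / 2) / 2) B1 V1" and R: "subgaussian_weight (\<lambda>t. w ((1 + t) / 2) / 2) B2 V2"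
  shows "subgaussian_weight w (B1 + B2) (V1 + V2)"
  unfolding subgaussian_weight_def
proof (intro allI impI)
  fix h :: "real \<Rightarrow> real" and s :: real
  assume h [measurable]: "h \<in> borel_measurable borel" and bd: "\<forall>x. \<bar>h x\<bar> \<le> 1" and s: "0 \<le> s"
  have wb: "\<bar>w t * h x\<bar> \<le> S" for t x
    using mult_mono[of "\<bar>w t\<bar>" S "\<bar>h x\<bar>" 1] S[of t] bd by (auto simp: abs_mult)
  define l where "l c x = (\<integral>t. w (t / 2) / 2 * h (c * phi x t) \<partial>unif)" for c x
  define r where "r c y = (\<integral>t. w ((1 + t) / 2) / 2 * h (c + (1 - c) * phi y t) \<partial>unif)" for c y
  have ml [measurable]: "l c \<in> borel_measurable trees" for c
    unfolding l_def by (rule measurable_weighted_integral[where h = "\<lambda>z. h (c * z)"]) measurable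
  have mr [measurable]: "r c \<in> borel_measurable trees" for c
    unfolding r_def by (rule measurable_weighted_integral[where h = "\<lambda>z. h (c + (1 - c) * z)"]) measurable
  have split: "(\<integral>t. w t * h (phi (node c x y) t) \<partial>unif) = l c x + r c y" if c: "0 < c" "c < 1" for c x y
  proof -
    have "(\<integral>t. w t * h (phi (node c x y) t) \<partial>unif) =
       (\<integral>t. w (t / 2) * h (phi (node c x y) (t / 2)) / 2 \<partial>unif) + (\<integral>t. w ((1 + t) / 2) * h (phi (node c x y) ((1 + t) / 2)) / 2 \<partial>unif)"
      using wb by (intro integral_unif_halves[where B = S]) auto
    also have "(\<integral>t. w (t / 2) * h (phi (node c x y) (t / 2)) / 2 \<partial>unif) = l c x"
      unfolding l_def
    proof (intro integral_cong_AE)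
      show "AE t in unif. w (t / 2) * h (phi (node c x y) (t / 2)) / 2 = w (t / 2) / 2 * h (c * phi x t)"
        by (rule eventually_mono[OF AE_unif]) (use c in \<open>auto simp: phi_le_half root_node\<close>)
    qed (unfold measurable_unif, measurable)
    also have "(\<integral>t. w ((1 + t) / 2) * h (phi (node c x y) ((1 + t) / 2)) / 2 \<partial>unif) = r c y"
      unfolding r_def
    proof (intro integral_cong_AE)
      show "AE t in unif. w ((1 + t) / 2) * h (phi (node c x y) ((1 + t) / 2)) / 2 = w ((1 + t) / 2) / 2 * h (c + (1 - c) * phi y t)"
      proof (rule eventually_mono[OF AE_unif])
        fix t :: real assume "0 < t \<and> t < 1"
        then have "phi (node c x y) ((1 + t) / 2) = c + (1 - c) * phi y (2 * ((1 + t) / 2) - 1)"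
          using c by (subst phi_ge_half) (auto simp: root_node)
        also have "2 * ((1 + t) / 2) - 1 = t" by (simp add: field_simps)
        finally show "w ((1 + t) / 2) * h (phi (node c x y) ((1 + t) / 2)) / 2 = w ((1 + t) / 2) / 2 * h (c + (1 - c) * phi y t)"
          by simp
      qed
    qed (unfold measurable_unif, measurable)
    finally show ?thesis .
  qed
  let ?l = "ennreal (exp (s * B1 + s\<^sup>2 * V1 / 2))" and ?r = "ennreal (exp (s * B2 + s\<^sup>2 * V2 / 2))"
  have "(\<integral>\<^sup>+\<xi>. ennreal (exp (s * (\<integral>t. w t * h (phi \<xi> t) \<partial>unif))) \<partial>trees) =
    (\<integral>\<^sup>+c. \<integral>\<^sup>+x. \<integral>\<^sup>+y. ennreal (exp (s * (\<integral>t. w t * h (phi (node c x y) t) \<partial>unif))) \<partial>trees \<partial>trees \<partial>unif)"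
    by (rule nn_integral_trees) measurable
  also have "\<dots> \<le> (\<integral>\<^sup>+c. ?l * ?r \<partial>unif)"
  proof (intro nn_integral_mono_AE eventually_mono[OF AE_unif])
    fix c :: real assume c: "0 < c \<and> c < 1"
    have "(\<integral>\<^sup>+x. \<integral>\<^sup>+y. ennreal (exp (s * (\<integral>t. w t * h (phi (node c x y) t) \<partial>unif))) \<partial>trees \<partial>trees)
      = (\<integral>\<^sup>+x. \<integral>\<^sup>+y. ennreal (exp (s * l c x)) * ennreal (exp (s * r c y)) \<partial>trees \<partial>trees)"
      using c by (intro nn_integral_cong) (simp add: split exp_add distrib_left ennreal_mult)
    also have "\<dots> = (\<integral>\<^sup>+x. ennreal (exp (s * l c x)) \<partial>trees) * (\<integral>\<^sup>+y. ennreal (exp (s * r c y)) \<partial>trees)"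
      by (simp add: nn_integral_cmult nn_integral_multc)
    also have "\<dots> \<le> ?l * ?r"
    proof (rule mult_mono)
      have "(\<lambda>z. h (c * z)) \<in> borel_measurable borel" by measurable
      then show "(\<integral>\<^sup>+x. ennreal (exp (s * l c x)) \<partial>trees) \<le> ?l"
        using L bd s unfolding subgaussian_weight_def l_def by blast
      have "(\<lambda>z. h (c + (1 - c) * z)) \<in> borel_measurable borel" by measurable
      then show "(\<integral>\<^sup>+y. ennreal (exp (s * r c y)) \<partial>trees) \<le> ?r"
        using R bd s unfolding subgaussian_weight_def r_def by blast
    qed auto
    finally show "(\<integral>\<^sup>+x. \<integral>\<^sup>+y. ennreal (exp (s * (\<integral>t. w t * h (phi (node c x y) t) \<partial>unif))) \<partial>trees \<partial>trees) \<le> ?l * ?r" .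
  qed
  also have "\<dots> = ?l * ?r" using unif.emeasure_space_1 by simp
  also have "\<dots> = ennreal (exp (s * (B1 + B2) + s\<^sup>2 * (V1 + V2) / 2))"
    by (subst ennreal_mult [symmetric]) (auto simp: exp_add [symmetric] algebra_simps add_divide_distrib)
  finally show "(\<integral>\<^sup>+\<xi>. ennreal (exp (s * (\<integral>t. w t * h (phi \<xi> t) \<partial>unif))) \<partial>trees) \<le> ennreal (exp (s * (B1 + B2) + s\<^sup>2 * (V1 + V2) / 2))" .
qed

lemma subgaussian_weight_cells:
  assumes "w \<in> borel_measurable borel" "\<And>t. \<bar>w t\<bar> \<le> S"
    and "\<And>c. c < 2^d \<Longrightarrow> subgaussian_weight (cell d c w) (B c) (V c)"
  shows "subgaussian_weight w (\<Sum>c<2^d. B c) (\<Sum>c<2^d. V c)"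
  using assms
proof (induction d arbitrary: w B V S)
  case 0
  have "{..<1::nat} = {0}" by auto
  then show ?case using 0(3)[of 0] by simp
next
  case (Suc d)
  note [measurable] = Suc.prems(1)
  have S: "\<bar>w t / 2\<bar> \<le> S / 2" for t using Suc.prems(2)[of t] by simp
  have "subgaussian_weight (\<lambda>t. w (t / 2) / 2) (\<Sum>c<2^d. B c) (\<Sum>c<2^d. V c)"
    using Suc.prems(3) S by (intro Suc.IH[of _ "S / 2"]) (auto simp: cell_left)
  moreover have "subgaussian_weight (\<lambda>t. w ((1 + t) / 2) / 2) (\<Sum>c<2^d. B (2^d + c)) (\<Sum>c<2^d. V (2^d + c))"
    using Suc.prems(3) S by (intro Suc.IH[of _ "S / 2"]) (auto simp: cell_right)
  ultimately show ?case
    unfolding power_Suc sum_lessThan_double by (rule subgaussian_weight_step[OF Suc.prems(1,2)])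
qed

text \<open>Chernoff's bound with the optimal parameter tau / V; the lower tail is the upper tail
  for the function - h.\<close>

lemma subgaussian_weight_tail:
  fixes h w :: "real \<Rightarrow> real"
  assumes sg: "subgaussian_weight w B V" and V: "0 < V" and \<tau>: "0 \<le> \<tau>"
    and [measurable]: "w \<in> borel_measurable borel" "h \<in> borel_measurable borel" and bd: "\<And>x. \<bar>h x\<bar> \<le> 1"
  shows "emeasure trees {\<xi>\<in>space trees. \<bar>\<integral>t. w t * h (phi \<xi> t) \<partial>unif\<bar> \<ge> B + \<tau>} \<le> ennreal (2 * exp (- \<tau>\<^sup>2 / (2 * V)))"
proof -
  have one: "emeasure trees {\<xi>\<in>space trees. (\<integral>t. w t * g (phi \<xi> t) \<partial>unif) \<ge> B + \<tau>} \<le> ennreal (exp (- \<tau>\<^sup>2 / (2 * V)))"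
    if g [measurable]: "g \<in> borel_measurable borel" and bg: "\<And>x. \<bar>g x\<bar> \<le> 1" for g :: "real \<Rightarrow> real"
  proof -
    define s where "s = \<tau> / V"
    have s: "0 \<le> s" using V \<tau> by (simp add: s_def)
    define Z where "Z \<xi> = (\<integral>t. w t * g (phi \<xi> t) \<partial>unif)" for \<xi>
    have [measurable]: "Z \<in> borel_measurable trees" unfolding Z_def by measurable
    let ?u = "ennreal (exp (- s * (B + \<tau>)))"
    have "emeasure trees {\<xi>\<in>space trees. Z \<xi> \<ge> B + \<tau>} \<le> emeasure trees {\<xi>\<in>space trees. 1 \<le> ?u * ennreal (exp (s * Z \<xi>))}"
    proof (intro emeasure_mono subsetI)
      fix \<xi> assume "\<xi> \<in> {\<xi>\<in>space trees. Z \<xi> \<ge> B + \<tau>}"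
      then have "0 \<le> - s * (B + \<tau>) + s * Z \<xi>" using mult_left_mono[of "B + \<tau>" "Z \<xi>" s] s by simp
      then show "\<xi> \<in> {\<xi>\<in>space trees. 1 \<le> ?u * ennreal (exp (s * Z \<xi>))}"
        by (simp add: ennreal_mult [symmetric] exp_add [symmetric])
    qed measurable
    also have "\<dots> \<le> ?u * (\<integral>\<^sup>+\<xi>. ennreal (exp (s * Z \<xi>)) \<partial>trees)"
      using nn_integral_Markov_inequality[where u = "\<lambda>\<xi>. ennreal (exp (s * Z \<xi>))" and M = trees and A = "space trees" and c = ?u]
        sets.top[of trees] by simp
    also have "\<dots> \<le> ?u * ennreal (exp (s * B + s\<^sup>2 * V / 2))"
      using sg g bg s unfolding subgaussian_weight_def Z_def by (intro mult_left_mono) auto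
    also have "\<dots> = ennreal (exp (- s * (B + \<tau>) + (s * B + s\<^sup>2 * V / 2)))"
      unfolding exp_add[of "- s * (B + \<tau>)"] by (rule ennreal_mult [symmetric]) auto
    also have "- s * (B + \<tau>) + (s * B + s\<^sup>2 * V / 2) = - \<tau>\<^sup>2 / (2 * V)"
      using V by (simp add: s_def power2_eq_square field_simps)
    finally show ?thesis unfolding Z_def .
  qed
  have neg: "(\<integral>t. w t * (- h (phi \<xi> t)) \<partial>unif) = - (\<integral>t. w t * h (phi \<xi> t) \<partial>unif)" for \<xi> by simp
  have "emeasure trees {\<xi>\<in>space trees. \<bar>\<integral>t. w t * h (phi \<xi> t) \<partial>unif\<bar> \<ge> B + \<tau>} \<le>
    emeasure trees ({\<xi>\<in>space trees. (\<integral>t. w t * h (phi \<xi> t) \<partial>unif) \<ge> B + \<tau>} \<union> {\<xi>\<in>space trees. (\<integral>t. w t * (- h (phi \<xi> t)) \<partial>unif) \<ge> B + \<tau>})"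
  proof (intro emeasure_mono subsetI)
    have [measurable]: "(\<lambda>\<xi>. \<integral>t. w t * (- h (phi \<xi> t)) \<partial>unif) \<in> borel_measurable trees"
      by (rule measurable_weighted_integral[where h = "\<lambda>z. - h z"]) measurable
    show "{\<xi>\<in>space trees. (\<integral>t. w t * h (phi \<xi> t) \<partial>unif) \<ge> B + \<tau>} \<union> {\<xi>\<in>space trees. (\<integral>t. w t * (- h (phi \<xi> t)) \<partial>unif) \<ge> B + \<tau>} \<in> sets trees"
      by measurable
  qed (unfold neg, auto)
  also have "\<dots> \<le> ennreal (exp (- \<tau>\<^sup>2 / (2 * V))) + ennreal (exp (- \<tau>\<^sup>2 / (2 * V)))"
  proof (rule order_trans[OF emeasure_subadditive add_mono])
    have [measurable]: "(\<lambda>\<xi>. \<integral>t. w t * (- h (phi \<xi> t)) \<partial>unif) \<in> borel_measurable trees"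
      by (rule measurable_weighted_integral[where h = "\<lambda>z. - h z"]) measurable
    show "{\<xi>\<in>space trees. (\<integral>t. w t * (- h (phi \<xi> t)) \<partial>unif) \<ge> B + \<tau>} \<in> sets trees"
      "{\<xi>\<in>space trees. (\<integral>t. w t * h (phi \<xi> t) \<partial>unif) \<ge> B + \<tau>} \<in> sets trees" by measurable
    show "emeasure trees {\<xi>\<in>space trees. (\<integral>t. w t * (- h (phi \<xi> t)) \<partial>unif) \<ge> B + \<tau>} \<le> ennreal (exp (- \<tau>\<^sup>2 / (2 * V)))"
      using bd by (intro one) auto
    show "emeasure trees {\<xi>\<in>space trees. (\<integral>t. w t * h (phi \<xi> t) \<partial>unif) \<ge> B + \<tau>} \<le> ennreal (exp (- \<tau>\<^sup>2 / (2 * V)))"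
      using bd by (intro one) auto
  qed
  also have "\<dots> = ennreal (2 * exp (- \<tau>\<^sup>2 / (2 * V)))" by (subst ennreal_plus [symmetric]) auto
  finally show ?thesis .
qed


section \<open>The Dirichlet kernel\<close>

lemma abs_sin_mult_le: "\<bar>sin (real k * x)\<bar> \<le> real k * \<bar>sin x\<bar>"
proof (induction k)
  case (Suc k)
  have "\<bar>sin (real (Suc k) * x)\<bar> = \<bar>sin (real k * x) * cos x + cos (real k * x) * sin x\<bar>"
    unfolding sin_add [symmetric] by (simp add: algebra_simps)
  also have "\<dots> \<le> \<bar>sin (real k * x)\<bar> * \<bar>cos x\<bar> + \<bar>cos (real k * x)\<bar> * \<bar>sin x\<bar>"
    unfolding abs_mult [symmetric] by (rule abs_triangle_ineq)
  also have "\<dots> \<le> \<bar>sin (real k * x)\<bar> * 1 + 1 * \<bar>sin x\<bar>"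
    by (intro add_mono mult_mono) (auto simp: abs_cos_le_one)
  also have "\<dots> \<le> real (Suc k) * \<bar>sin x\<bar>" using Suc by (simp add: algebra_simps)
  finally show ?case .
qed simp

lemma abs_dirichlet_kernel_le: "\<bar>dirichlet_kernel n t\<bar> \<le> 2 * real n + 1"
proof -
  have "\<bar>sin ((2 * real n + 1) * pi * t)\<bar> \<le> (2 * real n + 1) * \<bar>sin (pi * t)\<bar>"
    using abs_sin_mult_le[of "2 * n + 1" "pi * t"] by (simp add: mult.assoc add.commute[of 1])
  \<comment> \<open>At the zeros of the denominator the kernel is 0 by division by zero.\<close>
  then show ?thesis
    by (cases "sin (pi * t) = 0") (auto simp: dirichlet_kernel_def abs_divide pos_divide_le_eq)
qed

lemma measurable_dirichlet_kernel [measurable]: "dirichlet_kernel n \<in> borel_measurable borel"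
  unfolding dirichlet_kernel_def[abs_def] by measurable

lemma dirichlet_kernel_minus [simp]: "dirichlet_kernel n (- t) = dirichlet_kernel n t"
  by (simp add: dirichlet_kernel_def)

text \<open>The concave sine lies above its chord from 0 to pi / 2.\<close>

lemma sin_pi_ge:
  assumes "0 \<le> t" "t \<le> 1/2" shows "2 * t \<le> sin (pi * t)"
proof -
  have "concave_on {0..pi} sin"
    by (rule f''_le0_imp_concave[where f' = cos and f'' = "\<lambda>x. - sin x"])
       (auto intro!: derivative_eq_intros sin_ge_zero)
  then have "(1 - 2 * t) * sin 0 + (2 * t) * sin (pi / 2) \<le> sin ((1 - 2 * t) * 0 + (2 * t) * (pi / 2))"
    using assms concave_onD[of "{0..pi}" sin "2 * t" 0 "pi/2"] by simp
  then show ?thesis by (simp add: mult.commute)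
qed

lemma sin_pi_ge_dist:
  assumes "\<delta> \<le> t" "t \<le> 1 - \<delta>" "0 \<le> \<delta>" shows "2 * \<delta> \<le> sin (pi * t)"
proof (cases "t \<le> 1/2")
  case True then show ?thesis using sin_pi_ge[of t] assms by simp
next
  case False
  have "sin (pi * (1 - t)) = sin (pi * t)" by (simp add: right_diff_distrib)
  then show ?thesis using sin_pi_ge[of "1 - t"] assms False by simp
qed

lemma abs_dirichlet_kernel_le_inverse:
  assumes "\<delta> \<le> t" "t \<le> 1 - \<delta>" "0 < \<delta>" shows "\<bar>dirichlet_kernel n t\<bar> \<le> 1 / (2 * \<delta>)"
proof -
  have "2 * \<delta> \<le> \<bar>sin (pi * t)\<bar>" using sin_pi_ge_dist[of \<delta> t] assms by simp
  then show ?thesis unfolding dirichlet_kernel_def abs_divide using assms by (intro frac_le) (auto simp: abs_sin_le_one)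
qed

lemma dirichlet_kernel_Suc:
  assumes "sin (pi * t) \<noteq> 0"
  shows "dirichlet_kernel (Suc n) t = dirichlet_kernel n t + 2 * cos (2 * pi * real (Suc n) * t)"
proof -
  let ?a = "2 * pi * real (Suc n) * t"
  have 1: "(2 * real (Suc n) + 1) * pi * t = ?a + pi * t" "(2 * real n + 1) * pi * t = ?a - pi * t"
    by (auto simp: algebra_simps)
  have "sin (?a + pi * t) = sin (?a - pi * t) + 2 * cos ?a * sin (pi * t)"
    by (simp add: sin_add sin_diff)
  then show ?thesis unfolding dirichlet_kernel_def 1 using assms by (simp add: add_divide_distrib)
qed

text \<open>Each increment of the index adds one cosine term of size at most 2. This slow variation
  in n is what makes a sparse net of indices sufficient.\<close>

lemma dirichlet_kernel_diff_le:
  assumes "sin (pi * t) \<noteq> 0"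
  shows "\<bar>dirichlet_kernel (n + j) t - dirichlet_kernel n t\<bar> \<le> 2 * real j"
proof (induction j)
  case (Suc j)
  have "\<bar>2 * cos (2 * pi * real (Suc (n + j)) * t)\<bar> \<le> 2" using abs_cos_le_one by (simp add: abs_mult)
  then show ?case using Suc dirichlet_kernel_Suc[OF assms, of "n + j"] by simp
qed simp

lemma sin_pi_pos: "0 < t \<Longrightarrow> t < 1 \<Longrightarrow> 0 < sin (pi * t)"
  by (rule sin_gt_zero) auto

lemma integral_unif_FTC:
  fixes f :: "real \<Rightarrow> real"
  assumes "\<And>t. (G has_real_derivative f t) (at t)" "continuous_on UNIV f"
  shows "(\<integral>t. f t \<partial>unif) = G 1 - G 0"
proof -
  have "f \<in> borel_measurable borel" using assms(2) by (rule borel_measurable_continuous_onI)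
  then have "(\<integral>t. f t \<partial>unif) = (\<integral>t. indicator {0..1} t *\<^sub>R f t \<partial>lborel)" by (subst integral_unif) auto
  also have "\<dots> = G 1 - G 0"
    using assms by (intro integral_FTC_Icc)
      (auto intro: DERIV_subset continuous_on_subset simp: has_real_derivative_iff_has_vector_derivative [symmetric] has_field_derivative_at_within)
  finally show ?thesis .
qed

text \<open>This normalisation allows the constant f(0) to be subtracted from the function; the
  cosine terms integrate to zero.\<close>

lemma integral_dirichlet_kernel: "(\<integral>t. dirichlet_kernel n t \<partial>unif) = 1"
proof (induction n)
  case 0
  have "(\<integral>t. dirichlet_kernel 0 t \<partial>unif) = (\<integral>t. 1 \<partial>unif)"
  proof (intro integral_cong_AE eventually_mono[OF AE_unif])
    fix t :: real assume "0 < t \<and> t < 1"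
    then show "dirichlet_kernel 0 t = 1" using sin_pi_pos[of t] by (simp add: dirichlet_kernel_def)
  qed (unfold measurable_unif, measurable)
  then show ?case using unif.prob_space by simp
next
  case (Suc n)
  have "(\<integral>t. dirichlet_kernel (Suc n) t \<partial>unif) = (\<integral>t. dirichlet_kernel n t + 2 * cos (2 * pi * real (Suc n) * t) \<partial>unif)"
  proof (intro integral_cong_AE eventually_mono[OF AE_unif])
    fix t :: real assume "0 < t \<and> t < 1"
    then show "dirichlet_kernel (Suc n) t = dirichlet_kernel n t + 2 * cos (2 * pi * real (Suc n) * t)"
      using sin_pi_pos[of t] by (intro dirichlet_kernel_Suc) auto
  qed (unfold measurable_unif, measurable)
  also have "\<dots> = (\<integral>t. dirichlet_kernel n t \<partial>unif) + (\<integral>t. 2 * cos (2 * pi * real (Suc n) * t) \<partial>unif)"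
  proof (rule Bochner_Integration.integral_add)
    show "integrable unif (dirichlet_kernel n)"
      using abs_dirichlet_kernel_le by (intro integrable_unif_bounded[where B = "2 * real n + 1"]) auto
    show "integrable unif (\<lambda>t. 2 * cos (2 * pi * real (Suc n) * t))"
      by (intro integrable_unif_bounded[where B = 2]) (auto simp: abs_mult abs_cos_le_one)
  qed
  also have "(\<integral>t. 2 * cos (2 * pi * real (Suc n) * t) \<partial>unif) =
     2 * sin (2 * pi * real (Suc n) * 1) / (2 * pi * real (Suc n)) - 2 * sin (2 * pi * real (Suc n) * 0) / (2 * pi * real (Suc n))"
    by (rule integral_unif_FTC) (auto intro!: derivative_eq_intros continuous_intros simp del: of_nat_Suc)
  also have "\<dots> = 0"
    using sin_npi2[of "2 * Suc n"] by (simp add: mult_ac)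
  finally show ?case using Suc by simp
qed

lemma integral_unif_sin_le:
  assumes "0 < m" "0 < l"
  shows "\<bar>\<integral>t. sin (m * (a + l * t)) \<partial>unif\<bar> \<le> 2 / (m * l)"
proof -
  have "(\<integral>t. sin (m * (a + l * t)) \<partial>unif) = - cos (m * (a + l * 1)) / (m * l) - (- cos (m * (a + l * 0)) / (m * l))"
    using assms by (intro integral_unif_FTC) (auto intro!: derivative_eq_intros continuous_intros)
  also have "\<dots> = (cos (m * (a + l * 0)) - cos (m * (a + l * 1))) / (m * l)" by (simp add: diff_divide_distrib)
  also have "\<bar>\<dots>\<bar> \<le> 2 / (m * l)"
    unfolding abs_divide
  proof (rule frac_le)
    show "\<bar>cos (m * (a + l * 0)) - cos (m * (a + l * 1))\<bar> \<le> 2"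
      using cos_le_one[of "m * (a + l * 0)"] cos_le_one[of "m * (a + l * 1)"]
        cos_ge_minus_one[of "m * (a + l * 0)"] cos_ge_minus_one[of "m * (a + l * 1)"] by linarith
  qed (use assms in auto)
  finally show ?thesis .
qed

lemma abs_sin_diff_le: "\<bar>sin x - sin y\<bar> \<le> \<bar>x - y :: real\<bar>"
proof -
  have "\<bar>sin x - sin y\<bar> = 2 * \<bar>sin ((x - y) / 2)\<bar> * \<bar>cos ((x + y) / 2)\<bar>"
    by (subst sin_diff_sin) (simp add: abs_mult)
  also have "\<dots> \<le> 2 * \<bar>sin ((x - y) / 2)\<bar> * 1"
    by (intro mult_left_mono) (auto simp: abs_cos_le_one)
  moreover have "\<bar>(x - y) / 2\<bar> = \<bar>x - y\<bar> / 2" by (simp add: abs_divide)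
  ultimately show ?thesis using abs_sin_x_le_abs_x[of "(x - y) / 2"] by linarith
qed

text \<open>On a short interval the denominator of the kernel is nearly constant, so only the numerator has to be
  integrated.\<close>

lemma integral_dirichlet_kernel_short:
  assumes \<delta>: "0 < \<delta>" "\<delta> \<le> a" "a + l \<le> 1 - \<delta>" "0 < l"
  shows "\<bar>\<integral>t. dirichlet_kernel n (a + l * t) \<partial>unif\<bar> \<le> 1 / (\<delta> * l * ((2 * real n + 1) * pi)) + pi * l / (4 * \<delta>\<^sup>2)"
proof -
  define m where "m = (2 * real n + 1) * pi"
  have m: "0 < m" unfolding m_def by (intro mult_pos_pos) auto
  define g where "g t = 1 / sin (pi * t)" for t
  have D: "dirichlet_kernel n t = sin (m * t) * g t" for t by (simp add: dirichlet_kernel_def m_def g_def)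
  have sa: "2 * \<delta> \<le> sin (pi * a)" using \<delta> by (intro sin_pi_ge_dist) auto
  have ga: "\<bar>g a\<bar> \<le> 1 / (2 * \<delta>)" unfolding g_def using sa \<delta> by (simp add: frac_le)
  have gd: "\<bar>g (a + l * t) - g a\<bar> \<le> pi * l / (4 * \<delta>\<^sup>2)" if t: "0 < t" "t < 1" for t
  proof -
    have lt: "0 \<le> l * t" "l * t \<le> l" using t \<delta> by (auto simp: mult_left_le)
    have st: "2 * \<delta> \<le> sin (pi * (a + l * t))" using \<delta> lt by (intro sin_pi_ge_dist) linarith+
    have "g (a + l * t) - g a = (sin (pi * a) - sin (pi * (a + l * t))) / (sin (pi * (a + l * t)) * sin (pi * a))"
      using sa st \<delta> unfolding g_def by (simp add: field_simps)
    also have "\<bar>\<dots>\<bar> \<le> pi * l / ((2 * \<delta>) * (2 * \<delta>))"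
      unfolding abs_divide
    proof (rule frac_le)
      have "\<bar>sin (pi * a) - sin (pi * (a + l * t))\<bar> \<le> \<bar>pi * a - pi * (a + l * t)\<bar>" by (rule abs_sin_diff_le)
      also have "\<dots> = pi * (l * t)" using lt by (simp add: algebra_simps)
      also have "\<dots> \<le> pi * l" using lt by simp
      finally show "\<bar>sin (pi * a) - sin (pi * (a + l * t))\<bar> \<le> pi * l" .
      show "2 * \<delta> * (2 * \<delta>) \<le> \<bar>sin (pi * (a + l * t)) * sin (pi * a)\<bar>"
        using sa st \<delta> unfolding abs_mult by (intro mult_mono) auto
    qed (use \<delta> in auto)
    finally show ?thesis by (simp add: power2_eq_square)
  qed
  \<comment> \<open>The indicator confines the remainder to the points where \<open>gd\<close>
    applies, so that \<open>R\<close> is bounded on the whole line.\<close>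
  define R where "R t = sin (m * (a + l * t)) * (indicator {0<..<1} t * (g (a + l * t) - g a))" for t
  have [measurable]: "R \<in> borel_measurable borel" unfolding R_def g_def by measurable
  have Rb: "\<bar>R t\<bar> \<le> pi * l / (4 * \<delta>\<^sup>2)" for t
  proof -
    have "\<bar>indicator {0<..<1} t * (g (a + l * t) - g a)\<bar> \<le> pi * l / (4 * \<delta>\<^sup>2)"
      using gd[of t] \<delta> by (auto split: split_indicator)
    then have "\<bar>R t\<bar> \<le> 1 * (pi * l / (4 * \<delta>\<^sup>2))"
      unfolding R_def abs_mult[of "sin _"] by (intro mult_mono) (auto simp: abs_sin_le_one)
    then show ?thesis by simp
  qed
  have "(\<integral>t. dirichlet_kernel n (a + l * t) \<partial>unif) = (\<integral>t. g a * sin (m * (a + l * t)) + R t \<partial>unif)"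
  proof (intro integral_cong_AE eventually_mono[OF AE_unif])
    fix t :: real assume "0 < t \<and> t < 1"
    then show "dirichlet_kernel n (a + l * t) = g a * sin (m * (a + l * t)) + R t"
      by (simp add: D R_def algebra_simps)
  qed (unfold measurable_unif, measurable)
  also have "\<dots> = (\<integral>t. g a * sin (m * (a + l * t)) \<partial>unif) + (\<integral>t. R t \<partial>unif)"
  proof (rule Bochner_Integration.integral_add)
    have "\<bar>g a * sin (m * (a + l * t))\<bar> \<le> \<bar>g a\<bar> * 1" for t
      unfolding abs_mult by (intro mult_mono) (auto simp: abs_sin_le_one)
    then show "integrable unif (\<lambda>t. g a * sin (m * (a + l * t)))"
      by (intro integrable_unif_bounded) auto
    show "integrable unif R" using Rb by (intro integrable_unif_bounded) auto
  qed
  also have "(\<integral>t. g a * sin (m * (a + l * t)) \<partial>unif) = g a * (\<integral>t. sin (m * (a + l * t)) \<partial>unif)" by simp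
  finally have "\<bar>\<integral>t. dirichlet_kernel n (a + l * t) \<partial>unif\<bar> \<le> \<bar>g a\<bar> * \<bar>\<integral>t. sin (m * (a + l * t)) \<partial>unif\<bar> + \<bar>\<integral>t. R t \<partial>unif\<bar>"
    by (simp add: abs_mult [symmetric] abs_triangle_ineq)
  also have "\<dots> \<le> 1 / (2 * \<delta>) * (2 / (m * l)) + pi * l / (4 * \<delta>\<^sup>2)"
  proof (intro add_mono mult_mono ga)
    show "\<bar>\<integral>t. sin (m * (a + l * t)) \<partial>unif\<bar> \<le> 2 / (m * l)" using m \<delta> by (intro integral_unif_sin_le)
    show "\<bar>\<integral>t. R t \<partial>unif\<bar> \<le> pi * l / (4 * \<delta>\<^sup>2)" using Rb by (intro abs_integral_unif_le) auto
  qed (use \<delta> in auto)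
  also have "1 / (2 * \<delta>) * (2 / (m * l)) = 1 / (\<delta> * l * m)" by simp
  finally show ?thesis unfolding m_def .
qed


section \<open>The contribution of a dyadic block\<close>

text \<open>Open, so that distinct blocks of one level are disjoint; the omitted end points form a
  null set.\<close>

definition block :: "nat \<Rightarrow> nat \<Rightarrow> real set" where
  "block K c = {real c / 2^K <..< (real c + 1) / 2^K}"

definition block_kernel :: "nat \<Rightarrow> nat \<Rightarrow> nat \<Rightarrow> real \<Rightarrow> real" where
  "block_kernel n K c t = indicator (block K c) t * dirichlet_kernel n t"

lemma measurable_block_kernel [measurable]: "block_kernel n K c \<in> borel_measurable borel"
  unfolding block_kernel_def[abs_def] block_def by measurable

lemma real_Suc_le_pow: "c < 2^K \<Longrightarrow> real c + 1 \<le> 2^K"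
  by (metis Suc_leI of_nat_Suc of_nat_le_iff of_nat_numeral of_nat_power add.commute)

lemma block_interior:
  assumes "t \<in> block K c" "1 \<le> c" "c + 1 < 2^K"
  shows "(1/2)^K \<le> t" "t \<le> 1 - (1/2)^K"
proof -
  have "(1/2)^K \<le> real c / 2^K" using assms by (simp add: power_divide divide_right_mono)
  also have "\<dots> \<le> t" using assms by (simp add: block_def)
  finally show "(1/2)^K \<le> t" .
  have "real c + 2 \<le> 2^K" using real_Suc_le_pow[OF assms(3)] by simp
  then have "(real c + 2) / 2^K \<le> 1" by (simp add: divide_le_eq)
  then have "(real c + 1) / 2^K \<le> 1 - (1/2)^K" by (simp add: add_divide_distrib power_divide)
  then show "t \<le> 1 - (1/2)^K" using assms by (simp add: block_def)
qed

lemma abs_block_kernel_le: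
  assumes "1 \<le> c" "c + 1 < 2^K"
  shows "\<bar>block_kernel n K c t\<bar> \<le> 2^K"
proof (cases "t \<in> block K c")
  case True
  have "\<bar>dirichlet_kernel n t\<bar> \<le> 1 / (2 * (1/2)^K)"
    using block_interior[OF True assms] by (intro abs_dirichlet_kernel_le_inverse) auto
  also have "\<dots> \<le> 2^K" by (simp add: power_divide)
  finally show ?thesis using True by (simp add: block_kernel_def)
qed (simp add: block_kernel_def)

lemma cell_cell: "cell e b (cell d c w) = cell (d + e) (2^e * c + b) w"
proof
  fix t :: real
  have "(real c + (real b + t) / 2^e) / 2^d = (real (2^e * c + b) + t) / 2^(d + e)"
    by (simp add: field_simps power_add)
  then show "cell e b (cell d c w) t = cell (d + e) (2^e * c + b) w t"
    by (simp add: cell_def power_add mult.commute)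
qed

lemma subgaussian_weight_0:
  assumes "AE t in unif. w t = 0" "w \<in> borel_measurable borel"
  shows "subgaussian_weight w 0 0"
  unfolding subgaussian_weight_def
proof (intro allI impI)
  fix h :: "real \<Rightarrow> real" and s :: real
  note [measurable] = assms(2)
  assume [measurable]: "h \<in> borel_measurable borel"
  have "(\<integral>t. w t * h (phi \<xi> t) \<partial>unif) = (\<integral>t. 0 \<partial>unif)" for \<xi>
    using assms(1) by (intro integral_cong_AE) (auto elim!: eventually_mono)
  then show "(\<integral>\<^sup>+\<xi>. ennreal (exp (s * (\<integral>t. w t * h (phi \<xi> t) \<partial>unif))) \<partial>trees) \<le> ennreal (exp (s * 0 + s\<^sup>2 * 0 / 2))"
    using trees.emeasure_space_1 by simp
qed

lemma cell_block_kernel_other: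
  assumes "c' \<noteq> c" "0 < t" "t < 1"
  shows "cell K c' (block_kernel n K c) t = 0"
proof -
  have "\<not> (real c < real c' + t \<and> real c' + t < real c + 1)" using assms by linarith
  then have "(real c' + t) / 2^K \<notin> block K c" by (auto simp: block_def divide_less_cancel)
  then show ?thesis by (simp add: cell_def block_kernel_def)
qed

text \<open>After multiplication by the cell length, the two terms of
  \<open>integral_dirichlet_kernel_short\<close> become at most 2^(K - N) <= 2^(-8q), from the
  frequency, and at most 2^(-14q), from the variation of the denominator over a cell 2^(7q) times
  shorter than its block.\<close>

lemma integral_cell_block_kernel:
  assumes c: "1 \<le> c" "c + 1 < 2^K" and b: "b < 2^(7*q)" and n: "2^N \<le> n" and N: "K + 8 * q \<le> N"
  shows "\<bar>\<integral>t. cell (K + 7*q) (2^(7*q) * c + b) (block_kernel n K c) t \<partial>unif\<bar> \<le> 2 * (1/2)^(8*q)"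
proof -
  define d where "d = K + 7 * q"
  define a where "a = real (2^(7*q) * c + b) / 2^d"
  define l where "l = (1/2::real)^d"
  define \<delta> where "\<delta> = (1/2::real)^K"
  have l: "0 < l" "0 < \<delta>" by (auto simp: l_def \<delta>_def)
  have b': "real b + 1 \<le> 2^(7*q)" using real_Suc_le_pow[OF b] .
  have aeq: "a = real c * \<delta> + real b * l"
    by (simp add: a_def \<delta>_def l_def d_def power_add power_divide field_simps)
  have dl: "\<delta> = 2^(7*q) * l" by (simp add: \<delta>_def l_def d_def power_add power_divide)
  have bl: "real b * l + l \<le> \<delta>" using mult_right_mono[OF b', of l] l by (simp add: dl algebra_simps)
  have "real c + 2 \<le> 2^K" using real_Suc_le_pow[OF c(2)] by simp
  then have "(real c + 2) * \<delta> \<le> 2^K * \<delta>" using l by (intro mult_right_mono) auto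
  also have "2^K * \<delta> = 1" by (simp add: \<delta>_def power_divide)
  finally have cd: "real c * \<delta> + 2 * \<delta> \<le> 1" by (simp add: algebra_simps)
  have "1 * \<delta> \<le> real c * \<delta>" using c l by (intro mult_right_mono) auto
  then have a: "\<delta> \<le> a" "a + l \<le> 1 - \<delta>" using aeq cd bl l by (auto intro: add_increasing2)
  have eq: "cell d (2^(7*q) * c + b) (block_kernel n K c) t = l * dirichlet_kernel n (a + l * t)" if t: "0 < t" "t < 1" for t
  proof -
    have e: "(real (2^(7*q) * c + b) + t) / 2^d = a + l * t"
      by (simp add: a_def l_def power_divide add_divide_distrib)
    have lt: "0 < l * t" "l * t < l" using t l by auto
    have "real c / 2^K < a + l * t" "a + l * t < (real c + 1) / 2^K"
    proof -
      have "real c / 2^K = real c * \<delta>" "(real c + 1) / 2^K = real c * \<delta> + \<delta>"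
        by (simp_all add: \<delta>_def power_divide add_divide_distrib)
      moreover have "0 \<le> real b * l" using l by simp
      ultimately show "real c / 2^K < a + l * t" "a + l * t < (real c + 1) / 2^K"
        using lt bl aeq by linarith+
    qed
    then have "a + l * t \<in> block K c" by (simp add: block_def)
    then show ?thesis unfolding cell_def e by (simp add: block_kernel_def l_def power_divide)
  qed
  have "(\<integral>t. cell d (2^(7*q) * c + b) (block_kernel n K c) t \<partial>unif) = (\<integral>t. l * dirichlet_kernel n (a + l * t) \<partial>unif)"
    by (intro integral_cong_AE eventually_mono[OF AE_unif]) (unfold measurable_unif, measurable, use eq in auto)
  then have "\<bar>\<integral>t. cell d (2^(7*q) * c + b) (block_kernel n K c) t \<partial>unif\<bar> = l * \<bar>\<integral>t. dirichlet_kernel n (a + l * t) \<partial>unif\<bar>"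
    using l by (simp add: abs_mult)
  also have "\<dots> \<le> l * (1 / (\<delta> * l * ((2 * real n + 1) * pi)) + pi * l / (4 * \<delta>\<^sup>2))"
    using a l by (intro mult_left_mono integral_dirichlet_kernel_short) auto
  also have "\<dots> = 1 / (\<delta> * ((2 * real n + 1) * pi)) + pi / 4 * (l / \<delta>)\<^sup>2"
  proof -
    have "l * (1 / (\<delta> * l * m)) = 1 / (\<delta> * m)" for m using l by simp
    moreover have "l * (pi * l / (4 * \<delta>\<^sup>2)) = pi / 4 * (l / \<delta>)\<^sup>2" by (simp add: power2_eq_square)
    ultimately show ?thesis by (simp only: distrib_left)
  qed
  also have "1 / (\<delta> * ((2 * real n + 1) * pi)) \<le> (1/2)^(8*q)"
  proof -
    have "2^N \<le> real n" using n by (metis of_nat_le_iff of_nat_numeral of_nat_power)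
    also have "\<dots> \<le> (2 * real n + 1) * 1" by simp
    also have "\<dots> \<le> (2 * real n + 1) * pi" using pi_ge_two by (intro mult_left_mono) auto
    finally have "2^N \<le> (2 * real n + 1) * pi" .
    then have "1 / (\<delta> * ((2 * real n + 1) * pi)) \<le> 1 / (\<delta> * 2^N)"
      using l by (intro divide_left_mono mult_left_mono mult_pos_pos) (auto simp: add_pos_nonneg)
    also have "\<dots> = (1/2)^(N - K)" using N by (simp add: \<delta>_def power_divide power_diff)
    also have "\<dots> \<le> (1/2)^(8*q)" using N by (intro power_decreasing) auto
    finally show ?thesis .
  qed
  also have "pi / 4 * (l / \<delta>)\<^sup>2 \<le> 1 * (1/2)^(8*q)"
  proof (rule mult_mono)
    have "l / \<delta> = (1/2)^(7*q)" using l by (simp add: dl power_divide)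
    then have "(l / \<delta>)\<^sup>2 = (1/2)^(14*q)" by (simp add: power_mult [symmetric] mult.commute)
    also have "\<dots> \<le> (1/2)^(8*q)" by (intro power_decreasing) auto
    finally show "(l / \<delta>)\<^sup>2 \<le> (1/2)^(8*q)" .
  qed (use pi_less_4 in auto)
  finally show ?thesis unfolding d_def by simp
qed

text \<open>Put x = 2^(-q). Each of the 2^(4q) cells carries a weight of size x^4, hence variance
  proxy x^8, and a mean of at most 8 x^5 from smoothing (\<open>bias_bound\<close> with m = q) plus
  2^(3q) times 2 x^8, that is 2 x^5, from oscillation. Over all cells this gives 10 x and
  x^4.\<close>

lemma subgaussian_weight_block_kernel:
  assumes c: "1 \<le> c" "c + 1 < 2^K" and n: "2^N \<le> n" and N: "K + 8 * q \<le> N"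
  shows "subgaussian_weight (block_kernel n K c) (10 * (1/2)^q) ((1/2)^(4*q))"
proof -
  let ?w = "block_kernel n K c"
  define x where "x = (1/2::real)^q"
  have x: "0 < x" "(1/2)^(4*q) = x^4" "(1/2)^(8*q) = x^8" "2^(4*q) * x^4 = 1" "2^(3*q) * x^3 = 1"
    by (auto simp: x_def power_mult [symmetric] mult.commute[of q] power_divide)
  have small: "subgaussian_weight (cell (4*q) b (cell K c ?w)) (10 * x^5) ((x^4)\<^sup>2)" if b: "b < 2^(4*q)" for b
  proof (rule subgaussian_weight_base)
    have "\<bar>cell (4*q) b (cell K c ?w) t\<bar> = \<bar>?w ((real (2^(4*q) * c + b) + t) / 2^(K + 4*q))\<bar> / 2^(K + 4*q)" for t
      unfolding cell_cell by (simp add: cell_def abs_divide)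
    also have "\<dots> t \<le> 2^K / 2^(K + 4*q)" for t
      using abs_block_kernel_le[OF c] by (intro divide_right_mono) auto
    also have "2^K / 2^(K + 4*q) = x^4" unfolding x(2) [symmetric] by (simp add: power_add power_divide)
    finally show wb: "\<bar>cell (4*q) b (cell K c ?w) t\<bar> \<le> x^4" for t .
    fix h :: "real \<Rightarrow> real"
    assume h: "h \<in> borel_measurable borel" and bd: "\<And>x. \<bar>h x\<bar> \<le> 1"
    have "\<bar>\<integral>\<xi>. \<integral>t. cell (4*q) b (cell K c ?w) t * h (phi \<xi> t) \<partial>unif \<partial>trees\<bar>
      \<le> 8 * x^4 * (1/2)^q + (\<Sum>i<2^(3*q). \<bar>\<integral>t. cell (3*q) i (cell (4*q) b (cell K c ?w)) t \<partial>unif\<bar>)"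
      using wb by (intro bias_bound h bd) auto
    also have "(\<Sum>i<2^(3*q). \<bar>\<integral>t. cell (3*q) i (cell (4*q) b (cell K c ?w)) t \<partial>unif\<bar>) \<le> (\<Sum>i<(2::nat)^(3*q). 2 * x^8)"
    proof (rule sum_mono)
      fix i :: nat assume i: "i \<in> {..<2^(3*q)}"
      have "2^(3*q) * b + i < 2^(3*q) * (b + 1)" using i by simp
      also have "\<dots> \<le> 2^(3*q) * 2^(4*q)" using b by (intro mult_left_mono) auto
      also have "\<dots> = 2^(7*q)" by (simp add: power_add [symmetric])
      finally have bi: "2^(3*q) * b + i < 2^(7*q)" .
      have "cell (3*q) i (cell (4*q) b (cell K c ?w)) = cell (K + 7*q) (2^(7*q) * c + (2^(3*q) * b + i)) ?w"
        unfolding cell_cell by (simp add: algebra_simps power_add [symmetric])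
      then show "\<bar>\<integral>t. cell (3*q) i (cell (4*q) b (cell K c ?w)) t \<partial>unif\<bar> \<le> 2 * x^8"
        using integral_cell_block_kernel[OF c bi n N] x by simp
    qed
    also have "(\<Sum>i<(2::nat)^(3*q). 2 * x^8) = (2^(3*q) * x^3) * (2 * x^5)" by (simp add: algebra_simps power_add [symmetric])
    finally show "\<bar>\<integral>\<xi>. \<integral>t. cell (4*q) b (cell K c ?w) t * h (phi \<xi> t) \<partial>unif \<partial>trees\<bar> \<le> 10 * x^5"
      unfolding x(5) by (simp add: x_def [symmetric] eval_nat_numeral algebra_simps)
  qed (use x in auto)
  have "subgaussian_weight (cell K c ?w) (\<Sum>b<(2::nat)^(4*q). 10 * x^5) (\<Sum>b<(2::nat)^(4*q). (x^4)\<^sup>2)"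
  proof (rule subgaussian_weight_cells[OF _ _ small])
    show "\<bar>cell K c ?w t\<bar> \<le> 2^K" for t
      using abs_block_kernel_le[OF c, of n "(real c + t) / 2^K"]
      by (auto simp: cell_def abs_divide pos_divide_le_eq intro: order_trans[OF _ self_le_power] mult_left_mono order_trans)
  qed auto
  also have "(\<Sum>b<(2::nat)^(4*q). 10 * x^5) = (2^(4*q) * x^4) * (10 * x)" by (simp add: eval_nat_numeral algebra_simps)
  also have "(\<Sum>b<(2::nat)^(4*q). (x^4)\<^sup>2) = (2^(4*q) * x^4) * x^4" by (simp add: power2_eq_square)
  finally have one: "subgaussian_weight (cell K c ?w) (10 * x) (x^4)" unfolding x(4) by simp
  \<comment> \<open>From the block back to the unit interval: the other cells of level
    \<open>K\<close> carry the zero weight.\<close>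
  have "subgaussian_weight ?w (\<Sum>c'<2^K. if c' = c then 10 * x else 0) (\<Sum>c'<(2::nat)^K. if c' = c then x^4 else 0)"
  proof (rule subgaussian_weight_cells[where S = "2^K"])
    fix c' :: nat
    show "subgaussian_weight (cell K c' ?w) (if c' = c then 10 * x else 0) (if c' = c then x^4 else 0)"
    proof (cases "c' = c")
      case False
      have "subgaussian_weight (cell K c' ?w) 0 0"
        by (intro subgaussian_weight_0 eventually_mono[OF AE_unif] cell_block_kernel_other) (use False in auto)
      then show ?thesis using False by simp
    qed (use one in simp)
  qed (use abs_block_kernel_le[OF c] in auto)
  then show ?thesis using c by (simp add: x_def [symmetric] x(2))
qed

text \<open>A deviation x = 2^(-q) is set against the variance proxy x^4: the exponent is x^2 / (2
  x^4) = 4^q / 2.\<close>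

lemma block_tail:
  fixes h :: "real \<Rightarrow> real"
  assumes c: "1 \<le> c" "c + 1 < 2^K" and n: "2^N \<le> n" and N: "K + 8 * q \<le> N"
    and h: "h \<in> borel_measurable borel" "\<And>x. \<bar>h x\<bar> \<le> 1"
  shows "emeasure trees {\<xi>\<in>space trees. \<bar>\<integral>t. block_kernel n K c t * h (phi \<xi> t) \<partial>unif\<bar> \<ge> 11 * (1/2)^q} \<le> ennreal (2 * exp (- (4^q / 2)))"
proof -
  have e: "- ((1/2)^q)\<^sup>2 / (2 * (1/2)^(4*q)) = - ((4::real)^q / 2)"
  proof -
    define x where "x = (1/2::real)^q"
    have x: "0 < x" "(1/2)^(4*q) = x^4" by (auto simp: x_def power_mult [symmetric] mult.commute[of q])
    have "(4::real)^q = 2^(2*q)" by (simp add: power_mult)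
    also have "\<dots> = 1 / x\<^sup>2" by (simp add: x_def power_divide power_mult [symmetric] mult.commute)
    finally show ?thesis unfolding x(2) x_def [symmetric] using x(1) by (simp add: field_simps eval_nat_numeral)
  qed
  have "emeasure trees {\<xi>\<in>space trees. \<bar>\<integral>t. block_kernel n K c t * h (phi \<xi> t) \<partial>unif\<bar> \<ge> 10 * (1/2)^q + (1/2)^q}
    \<le> ennreal (2 * exp (- ((1/2)^q)\<^sup>2 / (2 * (1/2)^(4*q))))"
    by (rule subgaussian_weight_tail[OF subgaussian_weight_block_kernel[OF c n N]]) (use h in auto)
  also have "10 * (1/2)^q + (1/2)^q = (11 * (1/2)^q :: real)" by simp
  finally show ?thesis unfolding e .
qed

text \<open>Moving the index by j changes the kernel by at most 2 j, which is integrated over a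
  block of length 2^(-K) only.\<close>

lemma block_net:
  fixes h :: "real \<Rightarrow> real"
  assumes c: "1 \<le> c" "c + 1 < 2^K" and j: "j < 2^(K - q)"
    and [measurable]: "h \<in> borel_measurable borel" and h: "\<And>x. \<bar>h x\<bar> \<le> 1"
  shows "\<bar>(\<integral>t. block_kernel (n + j) K c t * h (phi \<xi> t) \<partial>unif) - (\<integral>t. block_kernel n K c t * h (phi \<xi> t) \<partial>unif)\<bar> \<le> 2 * (1/2)^q"
proof -
  have b: "\<bar>block_kernel n K c t * h y\<bar> \<le> 2^K * 1" for n t y
    unfolding abs_mult using abs_block_kernel_le[OF c] h by (intro mult_mono) auto
  have m: "(\<lambda>t. phi \<xi> t) \<in> borel_measurable borel"
    by (rule measurable_phi) auto
  note [measurable] = m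
  have "(\<integral>t. block_kernel (n + j) K c t * h (phi \<xi> t) \<partial>unif) - (\<integral>t. block_kernel n K c t * h (phi \<xi> t) \<partial>unif)
    = (\<integral>t. block_kernel (n + j) K c t * h (phi \<xi> t) - block_kernel n K c t * h (phi \<xi> t) \<partial>unif)"
    using b by (intro Bochner_Integration.integral_diff [symmetric] integrable_unif_bounded[where B = "2^K * 1"]) auto
  also have "\<bar>\<dots>\<bar> \<le> (\<integral>t. \<bar>block_kernel (n + j) K c t * h (phi \<xi> t) - block_kernel n K c t * h (phi \<xi> t)\<bar> \<partial>unif)"
    by (rule integral_abs_bound)
  also have "\<dots> \<le> (\<integral>t. 2 * real j * indicator {real c / 2^K..(real c + 1) / 2^K} t \<partial>unif)"
  proof (intro integral_mono)
    have "\<bar>block_kernel (n + j) K c t * h (phi \<xi> t) - block_kernel n K c t * h (phi \<xi> t)\<bar> \<le> 2^K * 1 + 2^K * 1" for t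
      using b[of "n + j" t "phi \<xi> t"] b[of n t "phi \<xi> t"] by linarith
    then show "integrable unif (\<lambda>t. \<bar>block_kernel (n + j) K c t * h (phi \<xi> t) - block_kernel n K c t * h (phi \<xi> t)\<bar>)"
      by (intro integrable_unif_bounded) auto
    show "integrable unif (\<lambda>t. 2 * real j * indicator {real c / 2^K..(real c + 1) / 2^K} t)"
      by (intro integrable_unif_bounded[where B = "2 * real j"]) (auto split: split_indicator)
    fix t
    show "\<bar>block_kernel (n + j) K c t * h (phi \<xi> t) - block_kernel n K c t * h (phi \<xi> t)\<bar> \<le> 2 * real j * indicator {real c / 2^K..(real c + 1) / 2^K} t"
    proof (cases "t \<in> block K c")
      case True
      have "0 < (1/2::real)^K" by simp
      then have "0 < t" "t < 1" using block_interior[OF True c] by linarith+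
      then have "\<bar>dirichlet_kernel (n + j) t - dirichlet_kernel n t\<bar> \<le> 2 * real j"
        using sin_pi_pos[of t] by (intro dirichlet_kernel_diff_le) auto
      then have "\<bar>(dirichlet_kernel (n + j) t - dirichlet_kernel n t) * h (phi \<xi> t)\<bar> \<le> 2 * real j * 1"
        unfolding abs_mult using h by (intro mult_mono) auto
      then show ?thesis using True by (auto simp: block_kernel_def block_def left_diff_distrib)
    qed (simp add: block_kernel_def)
  qed
  also have "\<dots> = 2 * real j * measure unif {real c / 2^K..(real c + 1) / 2^K}" by simp
  also have "measure unif {real c / 2^K..(real c + 1) / 2^K} = (1/2)^K"
  proof -
    have "real c + 1 \<le> 2^K" using c real_Suc_le_pow[of c K] by simp
    then show ?thesis by (subst measure_unif_Icc) (auto simp: divide_right_mono power_divide add_divide_distrib [symmetric] diff_divide_distrib [symmetric])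
  qed
  also have "2 * real j * (1/2)^K \<le> 2 * (1/2)^q"
  proof (cases "q \<le> K")
    case True
    have "real j \<le> 2^(K - q)" using real_Suc_le_pow[OF j] by linarith
    then have "2 * real j * (1/2)^K \<le> 2 * 2^(K - q) * (1/2)^K" by (intro mult_right_mono mult_left_mono) auto
    also have "\<dots> = 2 * (1/2)^q" using True by (simp add: power_diff power_divide)
    finally show ?thesis .
  next
    \<comment> \<open>Truncated subtraction makes K - q zero, so j = 0.\<close>
    case False
    then show ?thesis using j by simp
  qed
  finally show ?thesis .
qed


section \<open>Union bound over a net of indices and the Borel-Cantelli lemma\<close>

definition cutoff :: "nat \<Rightarrow> nat" where
  "cutoff N = nat \<lceil>log 2 (ln (real N))\<rceil>"

text \<open>From the cut-off on, a tail of the form exp (- 4^q / 4) is at most exp (- (ln N)^2 / 4),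
  which decays faster than any power of N.\<close>

lemma cutoff_ge:
  assumes "3 \<le> N"
  shows "(ln (real N))\<^sup>2 \<le> 4 ^ cutoff N"
proof -
  have "1 = ln (exp 1 :: real)" by simp
  also have "\<dots> \<le> ln 3" using exp_le by (subst ln_le_cancel_iff) auto
  also have "\<dots> \<le> ln (real N)" using assms by (subst ln_le_cancel_iff) auto
  finally have l: "1 \<le> ln (real N)" .
  have "ln (real N) = 2 powr (log 2 (ln (real N)))" using l by simp
  also have "\<dots> \<le> 2 powr (real (cutoff N))" unfolding cutoff_def by (intro powr_mono real_nat_ceiling_ge) auto
  also have "\<dots> = 2 ^ cutoff N" by (simp add: powr_realpow)
  finally have "(ln (real N))\<^sup>2 \<le> (2 ^ cutoff N)\<^sup>2" using l by (intro power_mono) auto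
  also have "((2::real) ^ cutoff N)\<^sup>2 = (2\<^sup>2) ^ cutoff N" by (simp only: power_mult [symmetric] mult.commute)
  finally show ?thesis by simp
qed

definition depth :: "nat \<Rightarrow> nat \<Rightarrow> nat" where
  "depth N K = (N - K) div 8"

text \<open>The third component j stands for the index j * 2^(K - q) with q =
  \<open>depth N K\<close>; its range covers the multiples from 2^N up to but excluding 2^(N+1). The
  block numbers 1 and 2^K - 2 are the neighbours of the two end blocks.\<close>

definition net_index :: "nat \<Rightarrow> (nat \<times> nat \<times> nat) set" where
  "net_index N = (SIGMA K:{2..N - 8 * cutoff N}. {1, 2^K - 2} \<times> {2^(N - (K - depth N K))..<2^(Suc N - (K - depth N K))})"

definition bad_event :: "(real \<Rightarrow> real) \<Rightarrow> nat \<Rightarrow> nat \<times> nat \<times> nat \<Rightarrow> (bool list \<Rightarrow> real) set" where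
  "bad_event h N = (\<lambda>(K, c, j). {\<xi>\<in>space trees. \<bar>\<integral>t. block_kernel (j * 2^(K - depth N K)) K c t * h (phi \<xi> t) \<partial>unif\<bar> \<ge> 11 * (1/2)^depth N K})"

lemma block_index:
  assumes "c \<in> {1, 2^K - 2}" "2 \<le> K"
  shows "1 \<le> c" "c + 1 < (2::nat)^K"
proof -
  have "(2::nat)^2 \<le> 2^K" using assms by (intro power_increasing) auto
  then have "4 \<le> (2::nat)^K" by simp
  then show "1 \<le> c" "c + 1 < (2::nat)^K" using assms(1) by auto
qed

lemma sets_bad_event:
  assumes [measurable]: "h \<in> borel_measurable borel"
  shows "bad_event h N i \<in> sets trees"
  by (cases i) (simp add: bad_event_def del: space_trees)

text \<open>Half of the exponent pays for counting. Rounding 9 q up to 10 q turns the count into the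
  fifth power of y = 4^q, and y / 20 <= exp (y / 20) has exp (y / 4) as the fifth power of its
  right-hand side.\<close>

lemma exp_quarter_bound: "2^(9 * q + 9) * exp (- (4^q / 2)) \<le> 512 * 20^5 * exp (- (4^q / 4) :: real)"
proof -
  define x where "x = (4::real)^q"
  have x: "0 < x" by (simp add: x_def)
  have "(2::real)^(9 * q) \<le> 2^(10 * q)" by (intro power_increasing) auto
  also have "\<dots> = x^5"
  proof -
    have "(2::real)^(10 * q) = (2^2)^(5 * q)" unfolding power_mult [symmetric] by (simp add: mult.commute)
    then show ?thesis by (simp add: x_def power_mult [symmetric] mult.commute)
  qed
  also have "\<dots> = 20^5 * (x / 20)^5" by (simp add: power_divide)
  also have "\<dots> \<le> 20^5 * (exp (x / 20))^5"
  proof -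
    have "x / 20 \<le> exp (x / 20)" using exp_ge_add_one_self[of "x / 20"] by linarith
    then show ?thesis using x by (intro mult_left_mono power_mono) auto
  qed
  also have "(exp (x / 20))^5 = exp (x / 4)" by (simp add: exp_of_nat_mult [symmetric])
  finally have "2^(9 * q) * exp (- (x / 2)) \<le> 20^5 * exp (x / 4) * exp (- (x / 2))" by (intro mult_right_mono) auto
  also have "\<dots> = 20^5 * exp (- (x / 4))" by (simp add: exp_add [symmetric] mult.assoc)
  finally show ?thesis by (simp add: x_def [symmetric] power_add mult.commute)
qed

lemma emeasure_bad_event:
  fixes h :: "real \<Rightarrow> real"
  assumes h: "h \<in> borel_measurable borel" "\<And>x. \<bar>h x\<bar> \<le> 1" and i: "(K, c, j) \<in> net_index N"
  shows "emeasure trees (bad_event h N (K, c, j)) \<le> ennreal (2 * exp (- (4^depth N K / 2)))"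
proof -
  let ?q = "depth N K"
  have K: "2 \<le> K" "K \<le> N" and c: "c \<in> {1, 2^K - 2}" and j: "2^(N - (K - ?q)) \<le> j"
    using i by (auto simp: net_index_def)
  have N: "K + 8 * ?q \<le> N" using K unfolding depth_def using div_times_less_eq_dividend[of "N - K" 8] by linarith
  have "2^N = (2::nat)^(N - (K - ?q)) * 2^(K - ?q)" using K by (simp add: power_add [symmetric])
  also have "\<dots> \<le> j * 2^(K - ?q)" using j by (intro mult_right_mono) auto
  finally have "2^N \<le> j * 2^(K - ?q)" .
  then show ?thesis unfolding bad_event_def prod.case
    using block_tail[OF block_index[OF c K(1)] _ N h] by blast
qed

lemma emeasure_bad:
  fixes h :: "real \<Rightarrow> real"
  assumes h: "h \<in> borel_measurable borel" "\<And>x. \<bar>h x\<bar> \<le> 1" and N: "3 \<le> N"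
  shows "emeasure trees (\<Union>i\<in>net_index N. bad_event h N i) \<le> ennreal (512 * 20^5 * (real N * exp (- ((ln (real N))\<^sup>2 / 4))))"
proof -
  let ?I = "{2..N - 8 * cutoff N}"
  define J where "J K = {1, (2::nat)^K - 2} \<times> {2^(N - (K - depth N K))..<(2::nat)^(Suc N - (K - depth N K))}" for K :: nat
  have fin: "finite (net_index N)" unfolding net_index_def by auto
  have cJ: "real (card (J K)) \<le> 2 * 2^(9 * depth N K + 7)" if K: "K \<in> ?I" for K
  proof -
    let ?q = "depth N K"
    \<comment> \<open>Spacing 2^(K - q) leaves 2^(N - (K - q)) points, and the rounding in
      \<open>depth\<close> costs at most 7 in N - K.\<close>
    have lt: "N - K < 8 * ?q + 8" unfolding depth_def using dividend_less_times_div[of 8 "N - K"] by simp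
    then have le: "N - (K - ?q) \<le> 9 * ?q + 7" by linarith
    have S: "Suc N - (K - ?q) = Suc (N - (K - ?q))" using K by auto
    have "card {1, (2::nat)^K - 2} \<le> 2" by (simp add: card_insert_if)
    then have "card (J K) \<le> 2 * 2^(N - (K - ?q))" unfolding J_def S by (simp add: card_cartesian_product)
    also have "\<dots> \<le> 2 * 2^(9 * ?q + 7)" using le by (intro mult_left_mono power_increasing) auto
    finally show ?thesis by (metis of_nat_le_iff of_nat_mult of_nat_numeral of_nat_power)
  qed
  have "emeasure trees (\<Union>i\<in>net_index N. bad_event h N i) \<le> (\<Sum>i\<in>net_index N. emeasure trees (bad_event h N i))"
    using fin h by (intro emeasure_subadditive_finite) (auto intro: sets_bad_event)
  also have "\<dots> \<le> (\<Sum>i\<in>net_index N. ennreal (2 * exp (- (4^depth N (fst i) / 2))))"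
  proof (rule sum_mono)
    fix i assume "i \<in> net_index N"
    then show "emeasure trees (bad_event h N i) \<le> ennreal (2 * exp (- (4^depth N (fst i) / 2)))"
      using emeasure_bad_event[OF h, of "fst i" "fst (snd i)" "snd (snd i)" N] by simp
  qed
  also have "\<dots> = ennreal (\<Sum>i\<in>net_index N. 2 * exp (- (4^depth N (fst i) / 2)))"
    by (rule sum_ennreal) auto
  also have "(\<Sum>i\<in>net_index N. 2 * exp (- (4^depth N (fst i) / 2))) = (\<Sum>K\<in>?I. \<Sum>z\<in>J K. 2 * exp (- (4^depth N K / 2) :: real))"
    unfolding net_index_def J_def by (subst sum.Sigma) (auto simp: case_prod_unfold)
  also have "\<dots> = (\<Sum>K\<in>?I. real (card (J K)) * (2 * exp (- (4^depth N K / 2))))" by simp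
  also have "\<dots> \<le> (\<Sum>K\<in>?I. 512 * 20^5 * exp (- ((ln (real N))\<^sup>2 / 4)))"
  proof (rule sum_mono)
    fix K assume K: "K \<in> ?I"
    let ?q = "depth N K"
    \<comment> \<open>Besides the net points there is one factor 2 for the two blocks and one for
      the two tails, which turns 9 q + 7 into 9 q + 9.\<close>
    have "real (card (J K)) * (2 * exp (- (4^?q / 2))) \<le> 2 * 2^(9 * ?q + 7) * (2 * exp (- (4^?q / 2)))"
      using cJ[OF K] by (intro mult_right_mono) auto
    also have "\<dots> = 2^(9 * ?q + 9) * exp (- (4^?q / 2))" by (simp add: power_add)
    also have "\<dots> \<le> 512 * 20^5 * exp (- (4^?q / 4))" by (rule exp_quarter_bound)
    also have "\<dots> \<le> 512 * 20^5 * exp (- ((ln (real N))\<^sup>2 / 4))"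
    proof -
      have "cutoff N = 8 * cutoff N div 8" by simp
      also have "\<dots> \<le> ?q" unfolding depth_def using K by (intro div_le_mono) auto
      finally have "cutoff N \<le> ?q" .
      then have "(4::real) ^ cutoff N \<le> 4^?q" by (intro power_increasing) auto
      then have "(ln (real N))\<^sup>2 \<le> 4^?q" using cutoff_ge[OF N] by linarith
      then show ?thesis by (intro mult_left_mono) auto
    qed
    finally show "real (card (J K)) * (2 * exp (- (4^?q / 2))) \<le> 512 * 20^5 * exp (- ((ln (real N))\<^sup>2 / 4))" .
  qed
  also have "\<dots> = real (card ?I) * (512 * 20^5 * exp (- ((ln (real N))\<^sup>2 / 4)))" by simp
  also have "\<dots> \<le> real N * (512 * 20^5 * exp (- ((ln (real N))\<^sup>2 / 4)))"
    by (intro mult_right_mono) auto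
  also have "\<dots> = 512 * 20^5 * (real N * exp (- ((ln (real N))\<^sup>2 / 4)))" by simp
  finally show ?thesis by (simp add: ennreal_leI)
qed

text \<open>The constant 13 is 11 at a net point, by Borel-Cantelli, plus 2 for rounding the index
  down to that point.\<close>

lemma AE_block_bound:
  fixes h :: "real \<Rightarrow> real"
  assumes h: "h \<in> borel_measurable borel" "\<And>x. \<bar>h x\<bar> \<le> 1"
  shows "AE \<xi> in trees. \<forall>\<^sub>F N in sequentially. \<forall>n\<in>{2^N..<2^Suc N}. \<forall>K\<in>{2..N - 8 * cutoff N}. \<forall>c\<in>{1, 2^K - 2}.
     \<bar>\<integral>t. block_kernel n K c t * h (phi \<xi> t) \<partial>unif\<bar> \<le> 13 * (1/2)^depth N K"
proof -
  define A where "A N = (\<Union>i\<in>net_index N. bad_event h N i)" for N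
  have mA: "A N \<in> sets trees" for N
    unfolding A_def by (intro sets.finite_UN sets_bad_event h) (auto simp: net_index_def)
  let ?g = "\<lambda>N. 512 * 20^5 * (real N * exp (- ((ln (real N))\<^sup>2 / 4)))"
  have g0: "0 \<le> ?g N" for N by simp
  have "summable (\<lambda>N. measure trees (A N))"
  proof (rule summable_comparison_test_ev)
    \<comment> \<open>The factor N, from the number of scales, is harmless against exp (- (ln N)^2 /
      4).\<close>
    have "\<forall>\<^sub>F N in sequentially. ?g N \<le> 1 / (real N)\<^sup>2" by real_asymp
    then show "\<forall>\<^sub>F N in sequentially. norm (measure trees (A N)) \<le> 1 / (real N)\<^sup>2"
      using eventually_ge_at_top[of 3]
    proof eventually_elim
      case (elim N)
      have "ennreal (measure trees (A N)) \<le> ennreal (?g N)"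
        using emeasure_bad[OF h elim(2)] unfolding A_def [symmetric] by (simp only: trees.emeasure_eq_measure)
      then have "measure trees (A N) \<le> ?g N" using g0 by (simp add: ennreal_le_iff)
      then show ?case using elim(1) by simp
    qed
    show "summable (\<lambda>N. 1 / (real N)\<^sup>2)"
      using inverse_power_summable[of 2, where ?'a = real] by (simp add: divide_inverse)
  qed
  then have "AE \<xi> in trees. \<forall>\<^sub>F N in sequentially. \<xi> \<in> space trees - A N"
    using mA by (intro borel_cantelli_AE1) (auto simp: trees.emeasure_eq_measure)
  then show ?thesis
  proof eventually_elim
    case (elim \<xi>)
    then show ?case
    proof eventually_elim
      case (elim N)
      show ?case
      proof (intro ballI)
        fix n K c assume n: "n \<in> {2^N..<(2::nat)^Suc N}" and K: "K \<in> {2..N - 8 * cutoff N}" and c: "c \<in> {1, (2::nat)^K - 2}"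
        let ?q = "depth N K"
        define g where "g = (2::nat)^(K - ?q)"
        define j where "j = n div g"
        have g: "0 < g" "2^N = 2^(N - (K - ?q)) * g" "2^Suc N = 2^(Suc N - (K - ?q)) * g"
          using K by (auto simp: g_def power_add [symmetric] simp del: power_Suc)
        have "(2::nat)^(N - (K - ?q)) \<le> j" unfolding j_def using n g by (simp add: less_eq_div_iff_mult_less_eq del: power_Suc)
        moreover have "j < 2^(Suc N - (K - ?q))" unfolding j_def using n g by (simp add: div_less_iff_less_mult del: power_Suc)
        ultimately have "(K, c, j) \<in> net_index N" using K c by (auto simp: net_index_def simp del: power_Suc)
        then have "\<xi> \<notin> bad_event h N (K, c, j)" using elim by (auto simp: A_def)
        then have 1: "\<bar>\<integral>t. block_kernel (j * g) K c t * h (phi \<xi> t) \<partial>unif\<bar> < 11 * (1/2)^?q"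
          by (simp add: bad_event_def g_def not_le)
        have "n = j * g + n mod g" by (simp add: j_def)
        moreover have "n mod g < 2^(K - ?q)" using g by (simp add: g_def)
        moreover have "2 \<le> K" using K by simp
        ultimately have "\<bar>(\<integral>t. block_kernel n K c t * h (phi \<xi> t) \<partial>unif) - (\<integral>t. block_kernel (j * g) K c t * h (phi \<xi> t) \<partial>unif)\<bar> \<le> 2 * (1/2)^?q"
          using block_net[OF block_index[OF c] _ h, of "n mod g" ?q "j * g" \<xi>] by simp
        then show "\<bar>\<integral>t. block_kernel n K c t * h (phi \<xi> t) \<partial>unif\<bar> \<le> 13 * (1/2)^?q"
          using 1 by linarith
      qed
    qed
  qed
qed


section \<open>Convergence for a fixed tree\<close>

definition block_integral :: "(real \<Rightarrow> real) \<Rightarrow> nat \<Rightarrow> nat \<Rightarrow> real" where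
  "block_integral F K c = (\<integral>t. indicator (block K c) t * F t \<partial>unif)"

lemma measurable_block [measurable]: "block K c \<in> sets borel"
  by (simp add: block_def)

lemma integrable_block:
  fixes F :: "real \<Rightarrow> real"
  assumes [measurable]: "F \<in> borel_measurable borel" and B: "\<And>t. \<bar>F t\<bar> \<le> B"
  shows "integrable unif (\<lambda>t. indicator (block K c) t * F t)"
proof -
  have "0 \<le> B" using B[of 0] by linarith
  then show ?thesis using B by (intro integrable_unif_bounded[where B = B]) (auto split: split_indicator)
qed

lemma block_integral_split:
  fixes F :: "real \<Rightarrow> real"
  assumes F [measurable]: "F \<in> borel_measurable borel" and B: "\<And>t. \<bar>F t\<bar> \<le> B"
  shows "block_integral F K c = block_integral F (Suc K) (2 * c) + block_integral F (Suc K) (2 * c + 1)"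
proof -
  let ?m = "(2 * real c + 1) / 2^Suc K"
  have ends: "real (2 * c) / 2^Suc K = real c / 2^K" "(real (2 * c + 1) + 1) / 2^Suc K = (real c + 1) / 2^K"
    "real (2 * c + 1) / 2^Suc K = ?m" "(real (2 * c) + 1) / 2^Suc K = ?m"
    by (auto simp: field_simps)
  have lt: "real c / 2^K < ?m" "?m < (real c + 1) / 2^K" by (auto simp: field_simps)
  have "block_integral F K c = (\<integral>t. indicator (block (Suc K) (2 * c)) t * F t + indicator (block (Suc K) (2 * c + 1)) t * F t \<partial>unif)"
    unfolding block_integral_def
  proof (intro integral_cong_AE)
    show "AE t in unif. indicator (block K c) t * F t = indicator (block (Suc K) (2 * c)) t * F t + indicator (block (Suc K) (2 * c + 1)) t * F t"
      using AE_unif_neq[of ?m]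
    proof eventually_elim
      case (elim t)
      have b: "t \<in> block K c \<longleftrightarrow> real c / 2^K < t \<and> t < (real c + 1) / 2^K"
        "t \<in> block (Suc K) (2 * c) \<longleftrightarrow> real c / 2^K < t \<and> t < ?m"
        "t \<in> block (Suc K) (2 * c + 1) \<longleftrightarrow> ?m < t \<and> t < (real c + 1) / 2^K"
        by (simp_all only: block_def greaterThanLessThan_iff ends)
      show ?case unfolding indicator_def of_bool_def b using elim lt by auto
    qed
  qed (unfold measurable_unif, measurable)
  also have "\<dots> = block_integral F (Suc K) (2 * c) + block_integral F (Suc K) (2 * c + 1)"
    unfolding block_integral_def by (intro Bochner_Integration.integral_add integrable_block[OF F B])
  finally show ?thesis .
qed

text \<open>Each level halves the two end blocks and releases their inner halves, which are the
  blocks 1 and 2^(K+1) - 2 of the next level.\<close>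

lemma integral_block_decomposition:
  fixes F :: "real \<Rightarrow> real"
  assumes F [measurable]: "F \<in> borel_measurable borel" and B: "\<And>t. \<bar>F t\<bar> \<le> B" and K: "1 \<le> K"
  shows "(\<integral>t. F t \<partial>unif) = (\<Sum>j\<in>{2..K}. block_integral F j 1 + block_integral F j (2^j - 2))
     + block_integral F K 0 + block_integral F K (2^K - 1)"
  using K
proof (induction K rule: nat_induct_at_least)
  case base
  have "(\<integral>t. F t \<partial>unif) = block_integral F 0 0"
    unfolding block_integral_def
    by (intro integral_cong_AE eventually_mono[OF AE_unif]) (unfold measurable_unif, measurable, auto simp: block_def)
  then show ?case using block_integral_split[OF F B, of 0 0] by simp
next
  case (Suc K)
  have p: "(1::nat) \<le> 2^K" by simp
  have e: "2 * (2^K - 1) = (2::nat)^Suc K - 2" "2 * (2^K - 1) + 1 = (2::nat)^Suc K - 1"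
      using p unfolding power_Suc by linarith+
  have "{2..Suc K} = insert (Suc K) {2..K}" using Suc.hyps by auto
  moreover have "block_integral F K (2^K - 1) = block_integral F (Suc K) (2^Suc K - 2) + block_integral F (Suc K) (2^Suc K - 1)"
    using block_integral_split[OF F B, of K "2^K - 1"] unfolding e(2) unfolding e(1) .
  moreover have "block_integral F K 0 = block_integral F (Suc K) 0 + block_integral F (Suc K) 1"
    using block_integral_split[OF F B, of K 0] by simp
  ultimately show ?case using Suc.IH by (simp del: power_Suc)
qed

lemma block_integral_eq_block_kernel:
  "block_integral (\<lambda>t. dirichlet_kernel n t * g t) K c = (\<integral>t. block_kernel n K c t * g t \<partial>unif)"
  unfolding block_integral_def block_kernel_def by (simp add: mult.assoc)

text \<open>The kernel bound 2^K exactly compensates the length 2^(-K), so without cancellation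
  every scale costs a constant.\<close>

lemma block_integral_abs_kernel_le:
  assumes "1 \<le> c" "c + 1 < 2^K"
  shows "block_integral (\<lambda>t. \<bar>dirichlet_kernel n t\<bar>) K c \<le> 1"
proof -
  have "block_integral (\<lambda>t. \<bar>dirichlet_kernel n t\<bar>) K c \<le> (\<integral>t. (2::real)^K * indicator {real c / 2^K..(real c + 1) / 2^K} t \<partial>unif)"
    unfolding block_integral_def
  proof (intro integral_mono)
    show "integrable unif (\<lambda>t. indicator (block K c) t * \<bar>dirichlet_kernel n t\<bar>)"
      using abs_dirichlet_kernel_le by (intro integrable_block[where B = "2 * real n + 1"]) auto
    show "integrable unif (\<lambda>t. (2::real)^K * indicator {real c / 2^K..(real c + 1) / 2^K} t)"
      by (intro integrable_unif_bounded[where B = "2^K"]) (auto split: split_indicator)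
    show "indicator (block K c) t * \<bar>dirichlet_kernel n t\<bar> \<le> 2^K * indicator {real c / 2^K..(real c + 1) / 2^K} t" for t
      using abs_block_kernel_le[OF assms, of n t] by (auto simp: block_kernel_def block_def split: split_indicator)
  qed
  also have "\<dots> = 2^K * measure unif {real c / 2^K..(real c + 1) / 2^K}" by simp
  also have "measure unif {real c / 2^K..(real c + 1) / 2^K} = (1/2)^K"
  proof -
    have "real c + 1 \<le> 2^K" using assms real_Suc_le_pow[of c K] by simp
    then show ?thesis by (subst measure_unif_Icc) (auto simp: divide_right_mono power_divide add_divide_distrib [symmetric] diff_divide_distrib [symmetric])
  qed
  finally show ?thesis by (simp add: power_divide)
qed

text \<open>Halving an end block releases an inner block of mass at most 1; at level N + 1 the bound
  2 n + 1 on the kernel leaves mass at most 2. The logarithmic growth of the Lebesgue constants is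
  thus paid only for the scales between K and N.\<close>

lemma block_integral_end_le:
  assumes n: "n < 2^Suc N" and K: "1 \<le> K" "K \<le> Suc N"
  shows "block_integral (\<lambda>t. \<bar>dirichlet_kernel n t\<bar>) K 0 \<le> 3 + real (N - K) + 1"
    and "block_integral (\<lambda>t. \<bar>dirichlet_kernel n t\<bar>) K (2^K - 1) \<le> 3 + real (N - K) + 1"
proof -
  let ?V = "block_integral (\<lambda>t. \<bar>dirichlet_kernel n t\<bar>)"
  have B: "\<bar>\<bar>dirichlet_kernel n t\<bar>\<bar> \<le> 2 * real n + 1" for t using abs_dirichlet_kernel_le[of n t] by simp
  have m: "(\<lambda>t. \<bar>dirichlet_kernel n t\<bar>) \<in> borel_measurable borel" by measurable
  have last: "?V (Suc N) c \<le> 2" if c: "c < 2^Suc N" for c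
  proof -
    have "?V (Suc N) c \<le> (\<integral>t. (2 * real n + 1) * indicator {real c / 2^Suc N..(real c + 1) / 2^Suc N} t \<partial>unif)"
      unfolding block_integral_def
    proof (intro integral_mono)
      show "integrable unif (\<lambda>t. indicator (block (Suc N) c) t * \<bar>dirichlet_kernel n t\<bar>)"
        by (rule integrable_block[OF m B])
      show "integrable unif (\<lambda>t. (2 * real n + 1) * indicator {real c / 2^Suc N..(real c + 1) / 2^Suc N} t)"
        by (intro integrable_unif_bounded[where B = "2 * real n + 1"]) (auto split: split_indicator)
      show "indicator (block (Suc N) c) t * \<bar>dirichlet_kernel n t\<bar> \<le> (2 * real n + 1) * indicator {real c / 2^Suc N..(real c + 1) / 2^Suc N} t" for t
        using abs_dirichlet_kernel_le[of n t] by (auto simp: block_def split: split_indicator)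
    qed
    also have "\<dots> = (2 * real n + 1) * measure unif {real c / 2^Suc N..(real c + 1) / 2^Suc N}" by simp
    also have "measure unif {real c / 2^Suc N..(real c + 1) / 2^Suc N} = (1/2)^Suc N"
      using real_Suc_le_pow[OF c]
      by (subst measure_unif_Icc) (auto simp: divide_right_mono power_divide add_divide_distrib [symmetric] diff_divide_distrib [symmetric] simp del: power_Suc)
    also have "(2 * real n + 1) * (1/2)^Suc N \<le> (2 * 2^Suc N) * (1/2)^Suc N"
      using real_Suc_le_pow[OF n] by (intro mult_right_mono) auto
    also have "\<dots> = 2" by (simp add: power_divide)
    finally show ?thesis .
  qed
  have stp: "?V K 0 \<le> ?V (Suc K) 0 + 1" "?V K (2^K - 1) \<le> ?V (Suc K) (2^Suc K - 1) + 1" if K: "1 \<le> K" for K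
  proof -
    have "(2::nat)^1 \<le> 2^K" using K by (intro power_increasing) auto
    then have p: "2 \<le> (2::nat)^K" by simp
    have e: "2 * (2^K - 1) = (2::nat)^Suc K - 2" "2 * (2^K - 1) + 1 = (2::nat)^Suc K - 1"
      using p unfolding power_Suc by linarith+
    show "?V K 0 \<le> ?V (Suc K) 0 + 1"
      using block_integral_split[OF m B, of K 0] block_integral_abs_kernel_le[of 1 "Suc K" n] p by simp
    show "?V K (2^K - 1) \<le> ?V (Suc K) (2^Suc K - 1) + 1"
    proof -
      have "?V K (2^K - 1) = ?V (Suc K) (2^Suc K - 2) + ?V (Suc K) (2^Suc K - 1)"
        using block_integral_split[OF m B, of K "2^K - 1"] unfolding e(2) unfolding e(1) .
      moreover have "1 \<le> (2::nat)^Suc K - 2" "(2^Suc K - 2) + 1 < (2::nat)^Suc K"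
        using p unfolding power_Suc by linarith+
      ultimately show ?thesis using block_integral_abs_kernel_le[of "2^Suc K - 2" "Suc K" n] by linarith
    qed
  qed
  have "?V K 0 \<le> 2 + real (Suc N - K) \<and> ?V K (2^K - 1) \<le> 2 + real (Suc N - K)"
    using K(2,1)
  proof (induction K rule: inc_induct)
    case base
    then show ?case using last[of 0] last[of "2^Suc N - 1"] by simp
  next
    case (step K')
    then have "1 \<le> K'" by simp
    moreover have "real (Suc N - K') = real (Suc N - Suc K') + 1" using step.hyps by (simp add: of_nat_diff)
    ultimately show ?case using step.IH stp[of K'] by linarith
  qed
  moreover have "real (Suc N - K) \<le> real (N - K) + 1" by simp
  ultimately show "?V K 0 \<le> 3 + real (N - K) + 1" "?V K (2^K - 1) \<le> 3 + real (N - K) + 1" by linarith+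
qed

text \<open>Every exponent occurs eight times, so the geometric sum 2 ((1/2)^a - (1/2)^b) is
  multiplied by 8.\<close>

lemma sum_half_div_8:
  assumes "a \<le> b"
  shows "(\<Sum>i\<in>{8 * a..<8 * b}. (1/2::real)^(i div 8)) = 16 * (1/2)^a - 16 * (1/2)^b"
  using assms
proof (induction b rule: dec_induct)
  case (step b)
  have "(\<Sum>i\<in>{8 * a..<8 * Suc b}. (1/2::real)^(i div 8)) = (\<Sum>i\<in>{8 * a..<8 * b}. (1/2)^(i div 8)) + (\<Sum>i\<in>{8 * b..<8 * Suc b}. (1/2)^(i div 8))"
    using step by (intro sum.atLeastLessThan_concat [symmetric]) auto
  also have "(\<Sum>i\<in>{8 * b..<8 * Suc b}. (1/2::real)^(i div 8)) = (\<Sum>i\<in>{8 * b..<8 * Suc b}. (1/2)^b)"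
  proof (intro sum.cong refl)
    fix i assume "i \<in> {8 * b..<8 * Suc b}"
    then have "i div 8 = b" by (intro div_nat_eqI) auto
    then show "(1/2::real)^(i div 8) = (1/2)^b" by simp
  qed
  also have "\<dots> = 8 * (1/2)^b" by simp
  finally show ?case using step by simp
qed simp

lemma sum_half_depth:
  "(\<Sum>K\<in>{2..N - 8 * a}. (1/2::real)^depth N K) \<le> 16 * (1/2)^a"
proof (cases "2 \<le> N - 8 * a")
  case True
  have "(\<Sum>K\<in>{2..N - 8 * a}. (1/2::real)^depth N K) = (\<Sum>i\<in>(\<lambda>K. N - K) ` {2..N - 8 * a}. (1/2)^(i div 8))"
    unfolding depth_def by (subst sum.reindex) (auto simp: inj_on_def)
  \<comment> \<open>Enlarging the range to end at a multiple of 8 makes the closed formula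
    applicable.\<close>
  also have "\<dots> \<le> (\<Sum>i\<in>{8 * a..<8 * N}. (1/2)^(i div 8))"
    using True by (intro sum_mono2) auto
  also have "\<dots> = 16 * (1/2)^a - 16 * (1/2)^N" using True by (intro sum_half_div_8) auto
  finally have "(\<Sum>K\<in>{2..N - 8 * a}. (1/2::real)^depth N K) \<le> 16 * (1/2)^a - 16 * (1/2)^N" .
  moreover have "0 \<le> (1/2::real)^N" by simp
  ultimately show ?thesis by linarith
qed (simp add: not_le)


section \<open>Smallness near the ends and the limit along one tree\<close>

lemma cutoff_le:
  assumes "3 \<le> N"
  shows "real (cutoff N) \<le> log 2 (ln (real N)) + 1"
proof -
  have "1 = ln (exp 1 :: real)" by simp
  also have "\<dots> \<le> ln 3" using exp_le by (subst ln_le_cancel_iff) auto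
  also have "\<dots> \<le> ln (real N)" using assms by (subst ln_le_cancel_iff) auto
  finally have "0 \<le> log 2 (ln (real N))" by (subst zero_le_log_cancel_iff) auto
  then have "real (cutoff N) = of_int \<lceil>log 2 (ln (real N))\<rceil>" unfolding cutoff_def by simp
  then show ?thesis by linarith
qed

lemma half_pow_cutoff_le:
  assumes "3 \<le> N"
  shows "(1/2) ^ cutoff N \<le> 1 / ln (real N)"
proof -
  have l: "0 < ln (real N)" using assms by simp
  have "(ln (real N))\<^sup>2 \<le> (2 ^ cutoff N)\<^sup>2"
    using cutoff_ge[OF assms] by (simp add: power_mult [symmetric] mult.commute[of _ 2] power_mult[of 2 2])
  then have "ln (real N) \<le> 2 ^ cutoff N" by (rule power2_le_imp_le) simp
  then have "1 / 2 ^ cutoff N \<le> 1 / ln (real N)" using l by (intro divide_left_mono) auto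
  then show ?thesis by (simp add: power_divide)
qed

text \<open>The depth is eventually at least N / 2, and geometric decay in N beats exp (- 2 sqrt N).
  The scale exp (- sqrt N) is harmless for the hypothesis on f, as replacing N by sqrt N changes ln
  (ln N) only by ln 2.\<close>

lemma eventually_phi_near_ends:
  assumes A: "\<And>d. sqsum d \<xi> \<le> A * (3/4)^d"
  shows "\<forall>\<^sub>F N in sequentially. sqrt (sqsum (N - 8 * cutoff N) \<xi>) \<le> exp (- sqrt (real N))"
proof -
  have "((\<lambda>N. A * ((3/4) powr (real N / 2) * exp (2 * sqrt (real N)))) \<longlongrightarrow> A * 0) sequentially"
    by (intro tendsto_mult tendsto_const) real_asymp
  then have "\<forall>\<^sub>F N in sequentially. A * ((3/4) powr (real N / 2) * exp (2 * sqrt (real N))) < 1"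
    by (rule order_tendstoD(2)) simp
  moreover have "\<forall>\<^sub>F N in sequentially. 8 * (log 2 (ln (real N)) + 1) \<le> real N / 2" by real_asymp
  ultimately show ?thesis using eventually_ge_at_top[of 3]
  proof eventually_elim
    case (elim N)
    have A0: "0 \<le> A" using A[of 0] by simp
    have "real N - 8 * real (cutoff N) \<le> real (N - 8 * cutoff N)" by (cases "8 * cutoff N \<le> N") (auto simp: of_nat_diff)
    then have "real N / 2 \<le> real (N - 8 * cutoff N)" using cutoff_le[OF elim(3)] elim(2) by argo
    then have "(3/4::real) powr real (N - 8 * cutoff N) \<le> (3/4) powr (real N / 2)"
      by (intro powr_mono') auto
    then have "(3/4::real)^(N - 8 * cutoff N) \<le> (3/4) powr (real N / 2)" by (simp add: powr_realpow)
    then have "A * (3/4)^(N - 8 * cutoff N) \<le> A * (3/4) powr (real N / 2)" using A0 by (rule mult_left_mono)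
    also have "\<dots> = A * ((3/4) powr (real N / 2) * exp (2 * sqrt (real N))) * exp (- (2 * sqrt (real N)))"
      by (simp add: mult.assoc exp_add [symmetric])
    also have "\<dots> \<le> 1 * exp (- (2 * sqrt (real N)))" using elim(1) by (intro mult_right_mono) auto
    also have "\<dots> = (exp (- sqrt (real N)))\<^sup>2" by (simp add: power2_eq_square exp_add [symmetric])
    finally have "sqsum (N - 8 * cutoff N) \<xi> \<le> (exp (- sqrt (real N)))\<^sup>2" using A[of "N - 8 * cutoff N"] by linarith
    then show ?case by (intro real_le_lsqrt) auto
  qed
qed

lemma block_integral_le_sup:
  fixes h :: "real \<Rightarrow> real"
  assumes [measurable]: "g \<in> borel_measurable borel" and b: "\<And>t. \<bar>g t\<bar> \<le> 1"
    and le: "\<And>t. t \<in> block K c \<Longrightarrow> \<bar>g t\<bar> \<le> \<omega>"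
  shows "\<bar>block_integral (\<lambda>t. dirichlet_kernel n t * g t) K c\<bar> \<le> \<omega> * block_integral (\<lambda>t. \<bar>dirichlet_kernel n t\<bar>) K c"
proof -
  have Dg: "\<bar>dirichlet_kernel n t * g t\<bar> \<le> (2 * real n + 1) * 1" for t
    unfolding abs_mult using abs_dirichlet_kernel_le b by (intro mult_mono) auto
  have "\<bar>block_integral (\<lambda>t. dirichlet_kernel n t * g t) K c\<bar> \<le> (\<integral>t. \<bar>indicator (block K c) t * (dirichlet_kernel n t * g t)\<bar> \<partial>unif)"
    unfolding block_integral_def by (rule integral_abs_bound)
  also have "\<dots> \<le> (\<integral>t. \<omega> * (indicator (block K c) t * \<bar>dirichlet_kernel n t\<bar>) \<partial>unif)"
  proof (intro integral_mono)
    show "integrable unif (\<lambda>t. \<bar>indicator (block K c) t * (dirichlet_kernel n t * g t)\<bar>)"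
      by (intro integrable_abs integrable_block[OF _ Dg]) measurable
    show "integrable unif (\<lambda>t. \<omega> * (indicator (block K c) t * \<bar>dirichlet_kernel n t\<bar>))"
      using abs_dirichlet_kernel_le by (intro integrable_mult_right integrable_block[where B = "2 * real n + 1"]) auto
    show "\<bar>indicator (block K c) t * (dirichlet_kernel n t * g t)\<bar> \<le> \<omega> * (indicator (block K c) t * \<bar>dirichlet_kernel n t\<bar>)" for t
      using mult_right_mono[OF le[of t], of "\<bar>dirichlet_kernel n t\<bar>"] by (auto simp: abs_mult mult.commute split: split_indicator)
  qed
  also have "\<dots> = \<omega> * block_integral (\<lambda>t. \<bar>dirichlet_kernel n t\<bar>) K c" by (simp add: block_integral_def)
  finally show ?thesis .
qed

text \<open>A deterministic statement: probability enters only through the decay of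
  \<open>sqsum\<close> and the block bounds. Of the budget e one half goes to the inner blocks and a
  quarter to each end interval.\<close>

lemma kernel_integral_tendsto_0:
  fixes h :: "real \<Rightarrow> real"
  assumes h: "h \<in> borel_measurable borel" "\<And>x. \<bar>h x\<bar> \<le> 1"
    and A: "\<And>d. sqsum d \<xi> \<le> A * (3/4)^d"
    and blocks: "\<forall>\<^sub>F N in sequentially. \<forall>n\<in>{2^N..<2^Suc N}. \<forall>K\<in>{2..N - 8 * cutoff N}. \<forall>c\<in>{1, 2^K - 2}.
     \<bar>\<integral>t. block_kernel n K c t * h (phi \<xi> t) \<partial>unif\<bar> \<le> 13 * (1/2)^depth N K"
    and small: "\<And>e. 0 < e \<Longrightarrow> \<forall>\<^sub>F N in sequentially. \<forall>x. 0 \<le> x \<and> x \<le> exp (- sqrt (real N)) \<longrightarrow>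
      \<bar>h x\<bar> \<le> e / ln (ln (sqrt (real N))) \<and> \<bar>h (1 - x)\<bar> \<le> e / ln (ln (sqrt (real N)))"
  shows "(\<lambda>n. \<integral>t. dirichlet_kernel n t * h (phi \<xi> t) \<partial>unif) \<longlonglongrightarrow> 0"
proof (rule LIMSEQ_I)
  fix e :: real assume e: "0 < e"
  note [measurable] = h(1)
  have mphi [measurable]: "phi \<xi> \<in> borel_measurable borel" using measurable_phi[of "\<lambda>_. \<xi>" borel "\<lambda>t. t"] by simp
  define Z where "Z n = (\<integral>t. dirichlet_kernel n t * h (phi \<xi> t) \<partial>unif)" for n
  \<comment> \<open>416 = 2 * 13 * 16: two blocks per scale, the constant of the block bound, and
    the geometric sum over the scales.\<close>
  have "\<forall>\<^sub>F N in sequentially. 416 / ln (real N) < e / 2"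
    using e by (intro order_tendstoD(2)[where y = 0]) (real_asymp, simp)
  \<comment> \<open>The left side bounds the mass of the kernel on an end interval. Doubling 12 to
    24 absorbs the constant and the loss of ln 2 in passing to sqrt N.\<close>
  moreover have "\<forall>\<^sub>F N in sequentially. 12 + 12 * ln (ln (real N)) \<le> 24 * ln (ln (sqrt (real N)))" by real_asymp
  moreover have "\<forall>\<^sub>F N in sequentially. 8 * (log 2 (ln (real N)) + 1) \<le> real N - 2" by real_asymp
  moreover have "\<forall>\<^sub>F N in sequentially. 0 < ln (ln (sqrt (real N)))" by real_asymp
  \<comment> \<open>96 = 4 * 24, so that the mass 24 ln (ln (sqrt N)) of an end interval yields e /
    4.\<close>
  moreover have "\<forall>\<^sub>F N in sequentially. \<forall>x. 0 \<le> x \<and> x \<le> exp (- sqrt (real N)) \<longrightarrow>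
      \<bar>h x\<bar> \<le> (e / 96) / ln (ln (sqrt (real N))) \<and> \<bar>h (1 - x)\<bar> \<le> (e / 96) / ln (ln (sqrt (real N)))"
    using e by (intro small) auto
  ultimately have "\<forall>\<^sub>F N in sequentially. \<forall>n\<in>{2^N..<2^Suc N}. \<bar>Z n\<bar> < e"
    using blocks eventually_phi_near_ends[OF A] eventually_ge_at_top[of 3]
  proof eventually_elim
    case (elim N)
    let ?K = "N - 8 * cutoff N"
    define L where "L = ln (ln (sqrt (real N)))"
    define \<omega> where "\<omega> = (e / 96) / L"
    have L: "0 < L" using elim(4) by (simp add: L_def)
    have w0: "0 \<le> \<omega>" using L e by (simp add: \<omega>_def)
    have q: "real (cutoff N) \<le> log 2 (ln (real N)) + 1" by (rule cutoff_le[OF elim(8)])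
    have q8: "real (8 * cutoff N) \<le> 12 * ln (ln (real N)) + 8"
    proof -
      have "0 < ln (real N)" using elim(8) by simp
      have "exp 1 \<le> real N" using exp_le elim(8) by linarith
      then have "ln (exp 1) \<le> ln (real N)" by (subst ln_le_cancel_iff) (use elim(8) in auto)
      then have "0 \<le> ln (ln (real N))" by simp
      \<comment> \<open>Since ln 2 >= 2/3, the binary logarithm is at most 3/2 times the natural
        one, and eight times the cut-off is at most 12 ln (ln N) + 8.\<close>
      then have "ln (ln (real N)) * (2 / 3) \<le> ln (ln (real N)) * ln 2" using ln2_ge_two_thirds by (intro mult_left_mono) auto
      then have "log 2 (ln (real N)) \<le> 3 / 2 * ln (ln (real N))" unfolding log_def
        using \<open>0 \<le> ln (ln (real N))\<close> by (simp add: pos_divide_le_eq mult.commute)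
      then show ?thesis using q by simp
    qed
    have K: "2 \<le> ?K" "N - ?K = 8 * cutoff N"
    proof -
      have "8 * real (cutoff N) + 2 \<le> real N" using q elim(3) by argo
      then have "8 * cutoff N + 2 \<le> N" by linarith
      then show "2 \<le> ?K" "N - ?K = 8 * cutoff N" by linarith+
    qed
    show ?case
    proof
      fix n assume n: "n \<in> {2^N..<(2::nat)^Suc N}"
      let ?V = "block_integral (\<lambda>t. dirichlet_kernel n t * h (phi \<xi> t))"
      have Db: "\<bar>dirichlet_kernel n t * h (phi \<xi> t)\<bar> \<le> (2 * real n + 1) * 1" for t
        unfolding abs_mult using abs_dirichlet_kernel_le h(2) by (intro mult_mono) auto
      have "Z n = (\<Sum>j\<in>{2..?K}. ?V j 1 + ?V j (2^j - 2)) + ?V ?K 0 + ?V ?K (2^?K - 1)"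
        unfolding Z_def by (rule integral_block_decomposition[OF _ Db]) (measurable, use K in auto)
      then have Z: "\<bar>Z n\<bar> \<le> (\<Sum>j\<in>{2..?K}. \<bar>?V j 1 + ?V j (2^j - 2)\<bar>) + \<bar>?V ?K 0\<bar> + \<bar>?V ?K (2^?K - 1)\<bar>"
        using sum_abs[of "\<lambda>j. ?V j 1 + ?V j (2^j - 2)" "{2..?K}"] by linarith
      have "(\<Sum>j\<in>{2..?K}. \<bar>?V j 1 + ?V j (2^j - 2)\<bar>) \<le> (\<Sum>j\<in>{2..?K}. 26 * (1/2)^depth N j)"
      proof (rule sum_mono)
        fix j assume j: "j \<in> {2..?K}"
        have "\<bar>?V j 1\<bar> \<le> 13 * (1/2)^depth N j" "\<bar>?V j (2^j - 2)\<bar> \<le> 13 * (1/2)^depth N j"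
          unfolding block_integral_eq_block_kernel using elim(6) n j by blast+
        then show "\<bar>?V j 1 + ?V j (2^j - 2)\<bar> \<le> 26 * (1/2)^depth N j" by linarith
      qed
      also have "\<dots> = 26 * (\<Sum>j\<in>{2..?K}. (1/2)^depth N j)" by (simp add: sum_distrib_left)
      also have "\<dots> \<le> 26 * (16 * (1/2)^cutoff N)" by (intro mult_left_mono sum_half_depth) auto
      also have "\<dots> \<le> 416 * (1 / ln (real N))" using half_pow_cutoff_le[OF elim(8)] by simp
      also have "\<dots> < e / 2" using elim(1) by simp
      finally have main: "(\<Sum>j\<in>{2..?K}. \<bar>?V j 1 + ?V j (2^j - 2)\<bar>) < e / 2" .
      have small': "\<bar>h x\<bar> \<le> \<omega>" "\<bar>h (1 - x)\<bar> \<le> \<omega>" if "0 \<le> x" "x \<le> sqrt (sqsum ?K \<xi>)" for x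
        using elim(5)[rule_format, of x] elim(7) that unfolding \<omega>_def L_def by auto
      have "\<bar>?V ?K 0\<bar> \<le> \<omega> * block_integral (\<lambda>t. \<bar>dirichlet_kernel n t\<bar>) ?K 0"
      proof (intro block_integral_le_sup h(2))
        fix t assume "t \<in> block ?K 0"
        then have "t \<le> (1/2)^?K" by (simp add: block_def power_divide)
        then show "\<bar>h (phi \<xi> t)\<bar> \<le> \<omega>" by (intro small' phi_bounds phi_le_sqrt_sqsum)
      qed measurable
      also have "\<dots> \<le> \<omega> * (4 + real (8 * cutoff N))"
        using block_integral_end_le(1)[of n N ?K] n K w0 by (intro mult_left_mono) auto
      finally have left: "\<bar>?V ?K 0\<bar> \<le> \<omega> * (4 + real (8 * cutoff N))" .
      have "\<bar>?V ?K (2^?K - 1)\<bar> \<le> \<omega> * block_integral (\<lambda>t. \<bar>dirichlet_kernel n t\<bar>) ?K (2^?K - 1)"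
      proof (intro block_integral_le_sup h(2))
        fix t assume "t \<in> block ?K (2^?K - 1)"
        then have "1 - (1/2)^?K \<le> t" by (simp add: block_def power_divide of_nat_diff diff_divide_distrib)
        then have "1 - phi \<xi> t \<le> sqrt (sqsum ?K \<xi>)" by (rule one_minus_phi_le_sqrt_sqsum)
        then show "\<bar>h (phi \<xi> t)\<bar> \<le> \<omega>" using small'(2)[of "1 - phi \<xi> t"] phi_bounds[of \<xi> t] by simp
      qed measurable
      also have "\<dots> \<le> \<omega> * (4 + real (8 * cutoff N))"
        using block_integral_end_le(2)[of n N ?K] n K w0 by (intro mult_left_mono) auto
      finally have right: "\<bar>?V ?K (2^?K - 1)\<bar> \<le> \<omega> * (4 + real (8 * cutoff N))" .
      have "\<omega> * (4 + real (8 * cutoff N)) \<le> \<omega> * (24 * L)"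
        using q8 elim(2) w0 unfolding L_def by (intro mult_left_mono) auto
      also have "\<dots> = e / 4" using L by (simp add: \<omega>_def)
      finally show "\<bar>Z n\<bar> < e" using Z main left right by linarith
    qed
  qed
  then obtain N0 where N0: "\<And>N n. N0 \<le> N \<Longrightarrow> n \<in> {2^N..<2^Suc N} \<Longrightarrow> \<bar>Z n\<bar> < e"
    unfolding eventually_sequentially by blast
  have "norm (Z n - 0) < e" if n: "2^N0 \<le> n" for n
  proof -
    have "1 \<le> n" using n order_trans[of 1 "2^N0" n] by simp
    \<comment> \<open>Each positive n lies in exactly one range from 2^N to 2^(N+1), so a bound for
      all large N is a bound for all large n.\<close>
    then obtain N where N: "2^N \<le> n" "n < 2^(N + 1)" using ex_power_ivl1[of 2 n] by auto
    have "(2::nat)^N0 < 2^(N + 1)" using n N by linarith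
    then have "N0 \<le> N" by (simp add: power_strict_increasing_iff del: power_Suc)
    then show ?thesis using N0[of N n] N by simp
  qed
  then show "\<exists>no. \<forall>n\<ge>no. norm ((\<integral>t. dirichlet_kernel n t * h (phi \<xi> t) \<partial>unif) - 0) < e"
    unfolding Z_def by blast
qed


section \<open>Transfer to the given probability space\<close>

text \<open>Reindexing the independent ratios along the injection \<open>dyad\<close> yields a
  random tree, so almost sure properties of trees pull back to the given space.\<close>

lemma distr_dyad:
  fixes M :: "'a measure" and X :: "nat \<Rightarrow> nat \<Rightarrow> 'a \<Rightarrow> real"
  assumes M: "prob_space M"
    and ind: "prob_space.indep_vars M (\<lambda>_. borel) (\<lambda>(n, k). X n k) midpoint_indices"
    and unif: "\<And>n k. (n, k) \<in> midpoint_indices \<Longrightarrow> distr M borel (X n k) = uniform_measure lborel {0..1}"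
  defines "T \<equiv> \<lambda>\<omega> p. X (fst (dyad p)) (snd (dyad p)) \<omega>"
  shows "T \<in> measurable M trees" "distr M trees T = trees"
proof -
  interpret M: prob_space M by (rule M)
  define Y where "Y = (\<lambda>i \<omega>. X (fst i) (snd i) \<omega>)"
  have ind': "M.indep_vars (\<lambda>_. borel) Y midpoint_indices"
    using ind by (simp add: Y_def case_prod_unfold)
  have rv: "Y i \<in> borel_measurable M" if "i \<in> midpoint_indices" for i
    using ind' that unfolding M.indep_vars_def by blast
  have ne: "midpoint_indices \<noteq> {}" using dyad_in by blast
  have d: "distr M borel (Y i) = unif" if "i \<in> midpoint_indices" for i
    using unif[of "fst i" "snd i"] that by (simp add: Y_def unif_def)
  let ?P = "PiM midpoint_indices (\<lambda>_. borel :: real measure)"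
  let ?R = "\<lambda>\<omega>. \<lambda>i\<in>midpoint_indices. Y i \<omega>"
  have mR: "?R \<in> measurable M ?P" by (intro measurable_restrict rv)
  have "distr M ?P ?R = PiM midpoint_indices (\<lambda>i. distr M borel (Y i))"
    using M.indep_vars_iff_distr_eq_PiM'[where I = midpoint_indices and X = Y and M' = "\<lambda>_. borel", OF ne rv] ind' by simp
  also have "\<dots> = PiM midpoint_indices (\<lambda>_. unif)" by (intro PiM_cong) (auto simp: d)
  finally have dR: "distr M ?P ?R = PiM midpoint_indices (\<lambda>_. unif)" .
  show mT: "T \<in> measurable M trees"
    unfolding T_def using rv[unfolded Y_def] dyad_in by (intro measurable_treesI) auto
  have comp: "T = (\<lambda>z. \<lambda>p\<in>UNIV. z (dyad p)) \<circ> ?R"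
    by (auto simp: T_def Y_def fun_eq_iff dyad_in)
  have sP: "sets ?P = sets (PiM midpoint_indices (\<lambda>_. unif))" by (intro sets_PiM_cong) auto
  have mr: "(\<lambda>z. \<lambda>p\<in>UNIV. z (dyad p)) \<in> measurable ?P trees"
    using dyad_in by (intro measurable_treesI) (auto intro!: measurable_component_singleton)
  have "distr M trees T = distr (distr M ?P ?R) trees (\<lambda>z. \<lambda>p\<in>UNIV. z (dyad p))"
    unfolding comp by (rule distr_distr[OF mr mR, symmetric])
  also have "\<dots> = trees"
    unfolding dR trees_def by (rule distr_PiM_reindex) (auto intro: prob_space_unif inj_dyad dyad_in)
  finally show "distr M trees T = trees" .
qed

section \<open>From Fourier partial sums to kernel integrals\<close>

lemma integrable_lborel_unif:
  fixes F :: "real \<Rightarrow> real"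
  assumes "F \<in> borel_measurable borel" "integrable unif F"
  shows "integrable lborel (\<lambda>t. indicator {0..1} t * F t)"
proof -
  have *: "unif = density lborel (\<lambda>t. ennreal (indicator {0..1} t))"
    unfolding unif_eq_density by (intro density_cong) (auto split: split_indicator)
  show ?thesis using assms unfolding * by (subst (asm) integrable_density) auto
qed

text \<open>At the point 0 the kernel is evaluated at - t and is even; its integral is 1, so the
  constant w passes through unchanged and the two real components separate.\<close>

lemma fourier_partial_sum_eq:
  fixes u v :: "real \<Rightarrow> real"
  assumes u: "u \<in> borel_measurable borel" "\<And>t. \<bar>u t\<bar> \<le> 1" and v: "v \<in> borel_measurable borel" "\<And>t. \<bar>v t\<bar> \<le> 1"
    and g: "\<And>t. t \<in> {0..1} \<Longrightarrow> g t = w + of_real C * (of_real (u t) + \<i> * of_real (v t))"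
  shows "fourier_partial_sum n g 0 = w + of_real C * (of_real (\<integral>t. dirichlet_kernel n t * u t \<partial>unif) + \<i> * of_real (\<integral>t. dirichlet_kernel n t * v t \<partial>unif))"
proof -
  note [measurable] = u(1) v(1)
  define I where "I F t = (indicator {0..1} t * (dirichlet_kernel n t * F t) :: real)" for F t
  have int: "integrable lborel (I F)" and eq: "(\<integral>t. I F t \<partial>lborel) = (\<integral>t. dirichlet_kernel n t * F t \<partial>unif)"
    if [measurable]: "F \<in> borel_measurable borel" and b: "\<And>t. \<bar>F t\<bar> \<le> 1" for F
  proof -
    have Db: "\<bar>dirichlet_kernel n t * F t\<bar> \<le> (2 * real n + 1) * 1" for t
      unfolding abs_mult using abs_dirichlet_kernel_le b by (intro mult_mono) auto
    have m: "(\<lambda>t. dirichlet_kernel n t * F t) \<in> borel_measurable borel" by measurable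
    show "integrable lborel (I F)"
      unfolding I_def by (intro integrable_lborel_unif integrable_unif_bounded[OF m Db] m)
    show "(\<integral>t. I F t \<partial>lborel) = (\<integral>t. dirichlet_kernel n t * F t \<partial>unif)"
      unfolding I_def by (rule integral_unif [OF m, symmetric])
  qed
  have "fourier_partial_sum n g 0 = (\<integral>t. w * of_real (I (\<lambda>_. 1) t) + of_real C * (of_real (I u t) + \<i> * of_real (I v t)) \<partial>lborel)"
    unfolding fourier_partial_sum_def set_lebesgue_integral_def
    by (intro Bochner_Integration.integral_cong refl) (auto simp: g I_def algebra_simps split: split_indicator)
  also have "\<dots> = w * of_real (\<integral>t. I (\<lambda>_. 1) t \<partial>lborel) + of_real C * (of_real (\<integral>t. I u t \<partial>lborel) + \<i> * of_real (\<integral>t. I v t \<partial>lborel))"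
    using int[of "\<lambda>_. 1"] int[OF u] int[OF v]
    by (simp add: integrable_of_real)
  finally show ?thesis using eq[of "\<lambda>_. 1"] eq[OF u] eq[OF v] by (simp add: integral_dirichlet_kernel)
qed

text \<open>By periodicity values just below 1 are values at small negative arguments, which is
  where the two-sided form of the hypothesis enters.\<close>

lemma smallo_imp_small_near_ends:
  fixes f :: "real \<Rightarrow> complex" and h :: "real \<Rightarrow> real"
  assumes o: "(\<lambda>\<delta>::real. cmod (f \<delta> - f 0)) \<in> o[at 0](\<lambda>\<delta>. 1 / ln (ln (ln (1 / \<bar>\<delta>\<bar>))))"
    and per: "\<And>t. f (t + 1) = f t" and le: "\<And>x. \<bar>h x\<bar> \<le> cmod (f x - f 0)" and e: "0 < e"
  shows "\<forall>\<^sub>F N in sequentially. \<forall>x. 0 \<le> x \<and> x \<le> exp (- sqrt (real N)) \<longrightarrow>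
      \<bar>h x\<bar> \<le> e / ln (ln (sqrt (real N))) \<and> \<bar>h (1 - x)\<bar> \<le> e / ln (ln (sqrt (real N)))"
proof -
  have "\<forall>\<^sub>F \<delta> in at 0. norm (cmod (f \<delta> - f 0)) \<le> e * norm (1 / ln (ln (ln (1 / \<bar>\<delta>\<bar>))))"
    using landau_o.smallD[OF o e] by simp
  then obtain \<eta> where \<eta>: "0 < \<eta>"
    "\<And>\<delta>. \<delta> \<noteq> 0 \<Longrightarrow> \<bar>\<delta>\<bar> < \<eta> \<Longrightarrow> cmod (f \<delta> - f 0) \<le> e * \<bar>1 / ln (ln (ln (1 / \<bar>\<delta>\<bar>)))\<bar>"
    unfolding eventually_at by (auto simp: dist_real_def)
  have "\<forall>\<^sub>F N in sequentially. exp (- sqrt (real N)) < \<eta>"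
    using \<eta>(1) by (intro order_tendstoD(2)[where y = 0]) (real_asymp, simp)
  moreover have "\<forall>\<^sub>F N in sequentially. 1 < ln (sqrt (real N))" by real_asymp
  ultimately show ?thesis using eventually_ge_at_top[of 1]
  proof eventually_elim
    case (elim N)
    let ?b = "e / ln (ln (sqrt (real N)))"
    have b0: "0 < ?b" using elim(2) e by (intro divide_pos_pos ln_gt_zero) auto
    have f: "cmod (f \<delta> - f 0) \<le> ?b" if \<delta>: "\<bar>\<delta>\<bar> \<le> exp (- sqrt (real N))" for \<delta>
    proof (cases "\<delta> = 0")
      case True
      then show ?thesis using b0 by simp
    next
      case False
      have sN: "0 < sqrt (real N)" using elim(3) by simp
      have "1 / exp (- sqrt (real N)) \<le> 1 / \<bar>\<delta>\<bar>" using \<delta> False by (intro divide_left_mono) auto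
      then have "ln (exp (sqrt (real N))) \<le> ln (1 / \<bar>\<delta>\<bar>)"
        using False by (subst ln_le_cancel_iff) (auto simp: exp_minus field_simps)
      then have 1: "sqrt (real N) \<le> ln (1 / \<bar>\<delta>\<bar>)" by simp
      then have 2: "ln (sqrt (real N)) \<le> ln (ln (1 / \<bar>\<delta>\<bar>))" using sN by (subst ln_le_cancel_iff) linarith+
      then have 3: "ln (ln (sqrt (real N))) \<le> ln (ln (ln (1 / \<bar>\<delta>\<bar>)))" using elim(2) by (subst ln_le_cancel_iff) linarith+
      have 4: "0 < ln (ln (sqrt (real N)))" using elim(2) by (intro ln_gt_zero)
      have "cmod (f \<delta> - f 0) \<le> e * \<bar>1 / ln (ln (ln (1 / \<bar>\<delta>\<bar>)))\<bar>" using \<delta> elim(1) False by (intro \<eta>(2)) auto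
      also have "\<dots> = e / ln (ln (ln (1 / \<bar>\<delta>\<bar>)))" using 3 4 by simp
      also have "\<dots> \<le> ?b" using 3 4 e by (intro divide_left_mono mult_pos_pos) auto
      finally show ?thesis .
    qed
    show ?case
    proof (intro allI impI)
      fix x :: real assume x: "0 \<le> x \<and> x \<le> exp (- sqrt (real N))"
      have "f (1 - x) = f (- x)" using per[of "- x"] by (simp add: add.commute)
      then show "\<bar>h x\<bar> \<le> ?b \<and> \<bar>h (1 - x)\<bar> \<le> ?b"
        using le[of x] le[of "1 - x"] f[of x] f[of "- x"] x by auto
    qed
  qed
qed

theorem theorem1:
  fixes M :: "'a measure"
    and X :: "nat \<Rightarrow> nat \<Rightarrow> 'a \<Rightarrow> real"
    and f :: "real \<Rightarrow> complex"
  assumes "prob_space M"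
    and "prob_space.indep_vars M (\<lambda>_. borel) (\<lambda>(n, k). X n k) midpoint_indices"
    and "\<And>n k. (n, k) \<in> midpoint_indices \<Longrightarrow>
           distr M borel (X n k) = uniform_measure lborel {0..1}"
    and "continuous_on UNIV f"
    and "\<And>t. f (t + 1) = f t"
    and "(\<lambda>\<delta>::real. cmod (f \<delta> - f 0)) \<in> o[at 0](\<lambda>\<delta>. 1 / ln (ln (ln (1 / \<bar>\<delta>\<bar>))))"
  shows "AE \<omega> in M. \<exists>\<phi>. dyadic_homeo (\<lambda>n k. X n k \<omega>) \<phi> \<and>
           convergent (\<lambda>n. fourier_partial_sum n (f \<circ> \<phi>) 0)"
proof -
  interpret M: prob_space M by (rule assms(1))
  define T where "T = (\<lambda>\<omega> p. X (fst (dyad p)) (snd (dyad p)) \<omega>)"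
  have T: "T \<in> measurable M trees" "distr M trees T = trees"
    unfolding T_def by (rule distr_dyad[OF assms(1-3)]; assumption)+
  have "bounded (f ` {0..1})"
    using assms(4) by (intro compact_imp_bounded compact_continuous_image) (auto intro: continuous_on_subset)
  then obtain B where B: "\<And>x. x \<in> {0..1} \<Longrightarrow> cmod (f x) \<le> B" unfolding bounded_iff by blast
  \<comment> \<open>2 B bounds f - f(0); the added 1 makes division by \<open>C\<close> legitimate
    and norm-decreasing.\<close>
  define C where "C = 2 * B + 1"
  have "cmod (f 0) \<le> B" by (rule B) simp
  then have B0: "0 \<le> B" using norm_ge_zero[of "f 0"] by linarith
  have C: "1 \<le> C" "\<And>x. x \<in> {0..1} \<Longrightarrow> cmod (f x - f 0) \<le> C"
  proof -
    show "1 \<le> C" using B0 by (simp add: C_def)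
    fix x :: real assume x: "x \<in> {0..1}"
    have "cmod (f x - f 0) \<le> cmod (f x) + cmod (f 0)" by (rule norm_triangle_ineq4)
    also have "\<dots> \<le> C" using B[OF x] B[of 0] by (simp add: C_def)
    finally show "cmod (f x - f 0) \<le> C" .
  qed
  \<comment> \<open>The indicator yields the bound 1 on the whole line, as the general estimates
    demand; on the values of \<open>phi\<close>, which lie in the unit interval, it equals
    1.\<close>
  define hr hi where "hr x = indicator {0..1} x * (Re (f x - f 0) / C)" and "hi x = indicator {0..1} x * (Im (f x - f 0) / C)" for x
  have [measurable]: "f \<in> borel_measurable borel" using assms(4) by (rule borel_measurable_continuous_onI)
  have mh: "hr \<in> borel_measurable borel" "hi \<in> borel_measurable borel" unfolding hr_def hi_def by measurable
  have le: "\<bar>hr x\<bar> \<le> cmod (f x - f 0)" "\<bar>hi x\<bar> \<le> cmod (f x - f 0)" for x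
  proof -
    have "\<bar>z\<bar> / C \<le> y" if "\<bar>z\<bar> \<le> y" for y z :: real
    proof -
      have "\<bar>z\<bar> / C \<le> \<bar>z\<bar> / 1" using C(1) by (intro divide_left_mono) auto
      then show ?thesis using that by simp
    qed
    then show "\<bar>hr x\<bar> \<le> cmod (f x - f 0)" "\<bar>hi x\<bar> \<le> cmod (f x - f 0)"
      using abs_Re_le_cmod[of "f x - f 0"] abs_Im_le_cmod[of "f x - f 0"] C(1)
      by (auto simp: hr_def hi_def abs_mult abs_divide split: split_indicator)
  qed
  have h1: "\<bar>hr x\<bar> \<le> 1" "\<bar>hi x\<bar> \<le> 1" for x
    using abs_Re_le_cmod[of "f x - f 0"] abs_Im_le_cmod[of "f x - f 0"] C(1) C(2)[of x]
    by (auto simp: hr_def hi_def abs_mult abs_divide pos_divide_le_eq split: split_indicator)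
  \<comment> \<open>\<open>inv dyad\<close> finds the node belonging to a midpoint. Outside
    \<open>midpoint_indices\<close> its value is arbitrary, but \<open>dyadic_homeo\<close> consults
    the ratios only at those indices.\<close>
  have "AE \<xi> in trees. dyadic_homeo (\<lambda>n k. \<xi> (inv dyad (n, k))) (phi \<xi>)
     \<and> convergent (\<lambda>n. fourier_partial_sum n (f \<circ> phi \<xi>) 0)"
    using AE_trees_interior AE_sqsum_geometric AE_block_bound[OF mh(1) h1(1)] AE_block_bound[OF mh(2) h1(2)]
  proof eventually_elim
    case (elim \<xi>)
    obtain A where A: "\<And>d. sqsum d \<xi> \<le> A * (3/4)^d" using elim(2) by blast
    have "(\<lambda>d. A * (3/4::real)^d) \<longlonglongrightarrow> A * 0" by (intro tendsto_mult tendsto_const LIMSEQ_power_zero) simp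
    then have b: "(\<lambda>d. A * (3/4::real)^d) \<longlonglongrightarrow> 0" by simp
    have lim: "(\<lambda>d. sqsum d \<xi>) \<longlonglongrightarrow> 0"
    proof (rule tendsto_sandwich[OF _ _ tendsto_const b])
      show "\<forall>\<^sub>F d in sequentially. 0 \<le> sqsum d \<xi>" "\<forall>\<^sub>F d in sequentially. sqsum d \<xi> \<le> A * (3/4)^d"
        by (intro always_eventually allI sqsum_nonneg A)+
    qed
    have homeo: "dyadic_homeo (\<lambda>n k. \<xi> (inv dyad (n, k))) (phi \<xi>)"
    proof (rule dyadic_homeo_phi[OF _ lim])
      show "0 < \<xi> p \<and> \<xi> p < 1" for p using elim(1) by blast
      show "\<xi> (inv dyad (fst (dyad p), snd (dyad p))) = \<xi> p" for p by (simp add: inv_f_f[OF inj_dyad])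
    qed
    have mphi: "phi \<xi> \<in> borel_measurable borel" using measurable_phi[of "\<lambda>_. \<xi>" borel "\<lambda>t. t"] by simp
    have "fourier_partial_sum n (f \<circ> phi \<xi>) 0 = f 0 + of_real C * (of_real (\<integral>t. dirichlet_kernel n t * hr (phi \<xi> t) \<partial>unif)
       + \<i> * of_real (\<integral>t. dirichlet_kernel n t * hi (phi \<xi> t) \<partial>unif))" for n
    proof (rule fourier_partial_sum_eq)
      fix t
      have "of_real C * (of_real (hr (phi \<xi> t)) + \<i> * of_real (hi (phi \<xi> t))) = f (phi \<xi> t) - f 0"
        using C(1) by (simp add: hr_def hi_def phi_bounds complex_eq_iff)
      then show "(f \<circ> phi \<xi>) t = f 0 + of_real C * (of_real (hr (phi \<xi> t)) + \<i> * of_real (hi (phi \<xi> t)))" by simp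
      show "(\<lambda>t. hr (phi \<xi> t)) \<in> borel_measurable borel" "(\<lambda>t. hi (phi \<xi> t)) \<in> borel_measurable borel"
        by (rule measurable_compose[OF mphi], rule mh)+
    qed (use h1 in auto)
    moreover have "(\<lambda>n. \<integral>t. dirichlet_kernel n t * hr (phi \<xi> t) \<partial>unif) \<longlonglongrightarrow> 0"
      by (rule kernel_integral_tendsto_0[OF mh(1) h1(1) A elim(3) smallo_imp_small_near_ends[OF assms(6,5) le(1)]])
    moreover have "(\<lambda>n. \<integral>t. dirichlet_kernel n t * hi (phi \<xi> t) \<partial>unif) \<longlonglongrightarrow> 0"
      by (rule kernel_integral_tendsto_0[OF mh(2) h1(2) A elim(4) smallo_imp_small_near_ends[OF assms(6,5) le(2)]])
    ultimately have "(\<lambda>n. fourier_partial_sum n (f \<circ> phi \<xi>) 0) \<longlonglongrightarrow> f 0 + of_real C * (of_real 0 + \<i> * of_real 0)"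
      by (simp only:) (intro tendsto_intros)
    then show ?case using homeo by (auto simp: convergent_def)
  qed
  then have "AE \<omega> in M. dyadic_homeo (\<lambda>n k. T \<omega> (inv dyad (n, k))) (phi (T \<omega>))
     \<and> convergent (\<lambda>n. fourier_partial_sum n (f \<circ> phi (T \<omega>)) 0)"
    by (intro AE_distrD[OF T(1)]) (simp only: T(2))
  then show ?thesis
  proof eventually_elim
    case (elim \<omega>)
    have "T \<omega> (inv dyad (n, k)) = X n k \<omega>" if "(n, k) \<in> midpoint_indices" for n k
    proof -
      have "dyad (inv dyad (n, k)) = (n, k)" using that range_dyad by (intro f_inv_into_f) auto
      then show ?thesis by (simp add: T_def)
    qed
    then have "dyadic_homeo (\<lambda>n k. X n k \<omega>) (phi (T \<omega>))"
      using elim unfolding dyadic_homeo_def by (auto simp: case_prod_unfold)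
    then show ?case using elim by blast
  qed
qed

end
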